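(* Let $p>1$, $\bar p=\max\{p,p/(p-1)\}$, let $\chi\in L^p(\mathbf{R},\mathbf{C})$ and let $f=P[\chi]$ be its Poisson extension to the upper half-plane. Then the sharp inequalities $$\|\tilde\chi\|_{L^p}\le \cot\frac{\pi}{2\bar p}\,\|\chi\|_{L^p}\qquad\text{and}\qquad \|\tilde f\|_{\mathbf{h}^p}\le\cot\frac{\pi}{2\bar p}\,\|f\|_{\mathbf{h}^p}$$ hold. In other words, $$\|\mathcal{H}:L^p(\mathbf{R},\mathbf{C})\to L^p(\mathbf{R},\mathbf{C})\|=\cot\frac{\pi}{2\bar p}\qquad\text{and}\qquad\|\mathcal{H}:\mathbf{h}^p(\mathbf{H},\mathbf{C})\to\mathbf{h}^p(\mathbf{H},\mathbf{C})\|=\cot\frac{\pi}{2\bar p}.$$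
   Context: For $p>1$ and $\chi\in L^p(\mathbf{R},\mathbf{C})$, the (nonperiodic) Hilbert transform is $$\mathcal{H}[\chi](x)=\tilde\chi(x)=\frac1\pi\int_{-\infty}^{\infty}\frac{\chi(t)}{x-t}\,dt=-\frac1\pi\lim_{\epsilon\downarrow0}\int_\epsilon^\infty\frac{\chi(x+t)-\chi(x-t)}{t}\,dt$$ (principal value). $\mathbf{H}=\{z\in\mathbf{C}:\Im z>0\}$ and $P$ is the Poisson integral on $\mathbf{H}$. $\mathbf{h}^p=\mathbf{h}^p(\mathbf{H})=\mathbf{h}^p(\mathbf{H},\mathbf{C})$ is the class of complex-valued harmonic functions $f$ on $\mathbf{H}$ with $\|f\|_{\mathbf{h}^p(\mathbf{H})}=\sup_{y>0}\|f(\cdot+iy)\|_{L^p(\mathbf{R})}<\infty$; for $f=P[\chi]$ one has $\|f\|_{\mathbf{h}^p(\mathbf{H})}=\|\chi\|_{L^p(\mathbf{R})}$. For $f=P[\chi]$, the harmonic conjugate is $\tilde f=P[\tilde\chi]$, and $\mathcal{H}f=\tilde f$ on $\mathbf{h}^p(\mathbf{H},\mathbf{C})$. *)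

theory Defs
  imports "HOL-Analysis.Analysis"
begin

text \<open>
  Elements of \<open>L\<^sup>p(\<real>, \<complex>)\<close> are represented by functions, not by classes modulo null sets;
  \<open>Lp_norm\<close> is therefore a seminorm. It is extended-valued, so that an infinite norm
  is not confused with norm 0.
\<close>

definition Lp_norm :: "real \<Rightarrow> (real \<Rightarrow> complex) \<Rightarrow> ennreal" where
  "Lp_norm p g =
     (let I = (\<integral>\<^sup>+ x. ennreal (norm (g x) powr p) \<partial>lebesgue)
      in if I = \<infinity> then \<infinity> else ennreal (enn2real I powr (1 / p)))"

definition Lp :: "real \<Rightarrow> (real \<Rightarrow> complex) set" where
  "Lp p = {g. g \<in> borel_measurable lebesgue \<and> Lp_norm p g < \<infinity>}"

text \<open>
  For \<open>g\<close> in \<open>L\<^sup>p\<close> with \<open>1 < p < \<infinity>\<close> the truncated integrals converge absolutely, by Hoelder's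
  inequality. Where the principal value does not exist, \<open>hilbert g x\<close> is an unspecified constant.
\<close>

definition hilbert_trunc :: "(real \<Rightarrow> complex) \<Rightarrow> real \<Rightarrow> real \<Rightarrow> complex" where
  "hilbert_trunc g x \<epsilon> =
     - (1 / of_real pi) * (LINT t:{\<epsilon><..}|lebesgue. (g (x + t) - g (x - t)) / of_real t)"

definition hilbert :: "(real \<Rightarrow> complex) \<Rightarrow> real \<Rightarrow> complex" where
  "hilbert g x = Lim (at_right 0) (hilbert_trunc g x)"

definition upper_half_plane :: "complex set" where
  "upper_half_plane = {z. Im z > 0}"

definition poisson :: "(real \<Rightarrow> complex) \<Rightarrow> complex \<Rightarrow> complex" where
  "poisson g z =
     (LINT t|lebesgue. of_real (Im z / (pi * ((Re z - t)\<^sup>2 + (Im z)\<^sup>2))) * g t)"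

text \<open>
  A function is harmonic on an open set if it is twice continuously differentiable in the real
  sense and its Laplacian vanishes; \<open>fx, fy, fxx, \<dots>\<close> are the partial derivatives.
\<close>

definition has_continuous_partials_on ::
  "(complex \<Rightarrow> complex) \<Rightarrow> (complex \<Rightarrow> complex) \<Rightarrow> (complex \<Rightarrow> complex) \<Rightarrow> complex set \<Rightarrow> bool" where
  "has_continuous_partials_on f fx fy S \<longleftrightarrow>
     continuous_on S fx \<and> continuous_on S fy \<and>
     (\<forall>z\<in>S. (f has_derivative (\<lambda>h. Re h *\<^sub>R fx z + Im h *\<^sub>R fy z)) (at z))"

definition harmonic_on :: "(complex \<Rightarrow> complex) \<Rightarrow> complex set \<Rightarrow> bool" where
  "harmonic_on f S \<longleftrightarrow>
     (\<exists>fx fy fxx fxy fyx fyy.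
        has_continuous_partials_on f fx fy S \<and>
        has_continuous_partials_on fx fxx fxy S \<and>
        has_continuous_partials_on fy fyx fyy S \<and>
        (\<forall>z\<in>S. fxx z + fyy z = 0))"

definition hp_norm :: "real \<Rightarrow> (complex \<Rightarrow> complex) \<Rightarrow> ennreal" where
  "hp_norm p f = (SUP y\<in>{0<..}. Lp_norm p (\<lambda>x. f (Complex x y)))"

text \<open>Values outside the upper half-plane are irrelevant for membership in \<open>hp p\<close>.\<close>

definition hp :: "real \<Rightarrow> (complex \<Rightarrow> complex) set" where
  "hp p = {f. harmonic_on f upper_half_plane \<and> hp_norm p f < \<infinity>}"

text \<open>
  The operator \<open>f = P[g] \<mapsto> P[H[g]]\<close> on \<open>hp p\<close>. For \<open>1 < p < \<infinity>\<close> every \<open>f\<close> in \<open>hp p\<close> is the Poisson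
  integral of some \<open>g\<close> in \<open>L\<^sup>p\<close>, which is unique up to null sets, so the result does not depend on
  the choice made here.
\<close>

definition hp_hilbert :: "real \<Rightarrow> (complex \<Rightarrow> complex) \<Rightarrow> complex \<Rightarrow> complex" where
  "hp_hilbert p f =
     poisson (hilbert (SOME g. g \<in> Lp p \<and> (\<forall>z\<in>upper_half_plane. f z = poisson g z)))"

text \<open>Norm of an operator \<open>T\<close> on a space \<open>V\<close> with norm \<open>N\<close>, where \<open>N\<close> also measures the values.\<close>

definition operator_norm :: "'a set \<Rightarrow> ('a \<Rightarrow> ennreal) \<Rightarrow> ('a \<Rightarrow> 'a) \<Rightarrow> ennreal" where
  "operator_norm V N T = (SUP v\<in>{v \<in> V. N v \<le> 1}. N (T v))"

end

theory Submission
  imports Defs "HOL-Complex_Analysis.Complex_Analysis" "HOL-Probability.Sinc_Integral"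
begin

text \<open>
  The proof takes place in the upper half-plane. For \<open>g\<close> in \<open>L\<^sup>p\<close> the Cauchy integral of \<open>g\<close> against
  \<open>1 / (t - z)\<close> converges absolutely off the real line. Its values at \<open>z\<close> and at the conjugate of \<open>z\<close>
  combine to the Poisson integral \<open>P[g]\<close> and to the conjugate Poisson integral \<open>Q[g]\<close>
  (\<open>conj_poisson\<close>), which are harmonic; for real \<open>g\<close> the function \<open>P[g] + i Q[g]\<close> is holomorphic.

  The analytic core is \<open>conj_poisson_bound\<close>: on each horizontal line \<open>Q[g]\<close> has \<open>p\<close>-norm at most
  \<open>cot (pi / (2 pbar))\<close> times that of \<open>g\<close>. For real \<open>g\<close> and \<open>1 < p \<le> 2\<close> this is the argument of
  Pichorides. With \<open>u = P[g]\<close>, \<open>v = Q[g]\<close> and a constant \<open>D \<ge> 0\<close>,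
  \<open>\<bar>v\<bar>\<^sup>p \<le> tan\<^sup>p (pi / (2 p)) \<bar>u\<bar>\<^sup>p - D Re ((\<bar>u\<bar> + i v)\<^sup>p)\<close>
  holds pointwise (\<open>pichorides_inequality\<close>), and the last term is subharmonic. It lies below the
  Poisson integral of its boundary values and decays like \<open>\<bar>z\<bar>\<close> to the power \<open>-p\<close>; comparing both along the
  imaginary axis shows that its integral over a horizontal line is nonnegative
  (\<open>folded_power_integral_nonneg\<close>), so it can be dropped. The case \<open>p > 2\<close> follows by duality from
  the oddness of the conjugate kernel, and complex \<open>g\<close> are reduced to real ones by averaging over
  all rotations \<open>Re (cis (- \<theta>) g)\<close>.

  Thus \<open>Q[g]\<close> is a harmonic function with bounded \<open>p\<close>-norms on horizontal lines. Every such function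
  is the Poisson integral of some \<open>h\<close> in \<open>L\<^sup>p\<close> (\<open>poisson_representation\<close>): by the maximum principle the
  traces on horizontal lines form a semigroup under convolution with Poisson kernels, their norms
  increase as the line descends, and uniform convexity turns convergence of the norms into
  convergence in \<open>L\<^sup>p\<close>. Poisson integrals converge to their boundary functions at almost every
  point, and at the same points the integral truncated at \<open>\<epsilon>\<close> has the same limit as \<open>Q[g]\<close> at height
  \<open>\<epsilon>\<close>, because the two kernels differ by at most a Poisson kernel. Hence the principal value exists
  almost everywhere, it equals \<open>h\<close>, and \<open>P[hilbert g] = Q[g]\<close> (\<open>hilbert_boundary_values\<close>). The
  statements about \<open>hp\<close> follow since \<open>g \<mapsto> P[g]\<close> is, up to null sets, an isometric
  bijection between \<open>L\<^sup>p\<close> and \<open>hp\<close>.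

  For sharpness take the boundary values of \<open>(1 - i z) powr (- b)\<close> with \<open>b\<close> slightly above \<open>1 / p\<close>.
  The Hilbert transform interchanges the real and imaginary part up to sign, the argument of
  the function at infinity is \<open>b pi / 2\<close> in absolute value, and it stays below this value everywhere. For
  \<open>p \<ge> 2\<close> this gives the cotangent at once; for \<open>p \<le> 2\<close> the mass concentrates at infinity as \<open>b\<close> tends to
  \<open>1 / p\<close>, and the quotient of the norms tends to the tangent.
\<close>

section \<open>Cauchy transforms and Poisson integrals\<close>

text \<open>
  The \<open>p\<close>-th power of the norm. Being an extended nonnegative integral it is
  directly accessible to Jensen, Tonelli and Fatou, and among measurable functions it is finite
  exactly on \<open>L\<^sup>p\<close>.
\<close>

definition mass :: "real \<Rightarrow> (real \<Rightarrow> complex) \<Rightarrow> ennreal" where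
  "mass p g = (\<integral>\<^sup>+ x. ennreal (norm (g x) powr p) \<partial>lborel)"

text \<open>
  The integrability condition under which Cauchy integrals converge off the real line. It is
  weaker than membership in any \<open>L\<^sup>p\<close> with \<open>1 < p <
  \<infinity>\<close>, so it covers all exponents at once.
\<close>

definition tame :: "(real \<Rightarrow> complex) \<Rightarrow> bool" where
  "tame g \<longleftrightarrow> g \<in> borel_measurable borel \<and> integrable lborel (\<lambda>t. norm (g t) / (1 + \<bar>t\<bar>))"

definition cauchy_transform :: "(real \<Rightarrow> complex) \<Rightarrow> complex \<Rightarrow> complex" where
  "cauchy_transform g z = (LINT t|lborel. g t / (of_real t - z))"

definition conj_poisson :: "(real \<Rightarrow> complex) \<Rightarrow> complex \<Rightarrow> complex" where
  "conj_poisson g z =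
     (LINT t|lborel. of_real ((Re z - t) / (pi * ((Re z - t)\<^sup>2 + (Im z)\<^sup>2))) * g t)"

lemma tame_measurable [measurable_dest]: "tame g \<Longrightarrow> g \<in> borel_measurable borel"
  by (simp add: tame_def)

lemma integrable_even:
  fixes f :: "real \<Rightarrow> real"
  assumes "set_integrable lborel {0<..} f" and [measurable]: "f \<in> borel_measurable borel"
    and even: "\<And>x. f (- x) = f x"
  shows "integrable lborel f"
proof -
  have 1: "integrable lborel (\<lambda>x. indicator {0<..} x *\<^sub>R f x)"
    using assms(1) by (simp add: set_integrable_def)
  from lborel_integrable_real_affine[OF 1, of "-1" 0]
  have 2: "integrable lborel (\<lambda>x. indicator {0<..} (-x) *\<^sub>R f x)"
    by (simp add: even)
  have "integrable lborel (\<lambda>x. indicator {0<..} x *\<^sub>R f x + indicator {0<..} (-x) *\<^sub>R f x)"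
    by (rule Bochner_Integration.integrable_add[OF 1 2])
  moreover have "AE x in lborel. indicator {0<..} x *\<^sub>R f x + indicator {0<..} (-x) *\<^sub>R f x = f x"
  proof -
    have "AE x in lborel. x \<noteq> (0::real)" by (rule AE_lborel_singleton)
    then show ?thesis by eventually_elim (auto simp: indicator_def)
  qed
  ultimately show ?thesis
    by (subst integrable_cong_AE[symmetric]) (auto)
qed

lemma integrable_powr_tail:
  fixes q :: real assumes "q > 1"
  shows "integrable lborel (\<lambda>t. (1 + \<bar>t\<bar>) powr (- q))"
proof (rule integrable_even)
  have "((\<lambda>x. x powr (-q)) has_integral - (1 powr (-q+1)) / (-q+1)) {1..}"
    by (rule has_integral_powr_to_inf) (use assms in auto)
  then have "(\<lambda>x. x powr (-q)) absolutely_integrable_on {1..}"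
    by (intro nonnegative_absolutely_integrable_1) (auto simp: integrable_on_def)
  then have "set_integrable lborel {1..} (\<lambda>x. x powr (-q))"
    unfolding set_integrable_def by (subst (asm) integrable_completion) auto
  then have "integrable lborel (\<lambda>x. indicator {1..} (1 + 1 * x) *\<^sub>R ((1 + 1 * x) powr (-q)))"
    unfolding set_integrable_def by (rule lborel_integrable_real_affine) auto
  then show "set_integrable lborel {0<..} (\<lambda>t. (1 + \<bar>t\<bar>) powr (- q))"
    unfolding set_integrable_def
    by (rule Bochner_Integration.integrable_bound) (auto simp: indicator_def)
qed auto

text \<open>
  A crude form of the inequality of Young: whichever of \<open>b\<close> and \<open>a powr (p -
  1)\<close> is the larger decides which summand already dominates the product.
\<close>

lemma mult_le_powr_add_powr:
  fixes a b p :: real assumes "p > 1" "a \<ge> 0" "b > 0"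
  shows "a * b \<le> a powr p + b powr (p / (p - 1))"
proof (cases "b \<le> a powr (p - 1)")
  case True
  then have "a * b \<le> a * a powr (p - 1)" using assms by (intro mult_left_mono) auto
  also have "\<dots> = a powr p" using assms by (cases "a = 0") (auto simp: powr_mult_base)
  finally show ?thesis by (smt (verit) powr_ge_zero)
next
  case False
  then have "(a powr (p - 1)) powr (1 / (p - 1)) \<le> b powr (1 / (p - 1))"
    using assms by (intro powr_mono2) auto
  then have "a \<le> b powr (1 / (p - 1))" using assms by (simp add: powr_powr)
  then have "a * b \<le> b * b powr (1 / (p - 1))" using assms by (metis mult.commute mult_left_mono less_imp_le)
  also have "\<dots> = b powr (p / (p - 1))" using assms by (simp add: powr_mult_base divide_simps)
  finally show ?thesis by (smt (verit) powr_ge_zero)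
qed

lemma mass_finite_integrable:
  assumes [measurable]: "g \<in> borel_measurable borel" and "mass p g < \<infinity>"
  shows "integrable lborel (\<lambda>x. norm (g x) powr p)"
  using assms(2) unfolding mass_def by (intro integrableI_nonneg) auto

lemma mass_finite_tame:
  assumes p: "p > 1" and [measurable]: "g \<in> borel_measurable borel" and fin: "mass p g < \<infinity>"
  shows "tame g"
proof -
  define q where "q = p / (p - 1)"
  have "q > 1" using p by (simp add: q_def field_simps)
  have "integrable lborel (\<lambda>t. norm (g t) powr p + (1 + \<bar>t\<bar>) powr (-q))"
    by (intro Bochner_Integration.integrable_add integrable_powr_tail mass_finite_integrable fin
        \<open>q > 1\<close>) auto
  moreover have "norm (g t) / (1 + \<bar>t\<bar>) \<le> norm (g t) powr p + (1 + \<bar>t\<bar>) powr (-q)" for t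
    using mult_le_powr_add_powr[OF p, of "norm (g t)" "inverse (1 + \<bar>t\<bar>)"]
    by (simp add: q_def powr_minus divide_inverse inverse_powr)
  ultimately have "integrable lborel (\<lambda>t. norm (g t) / (1 + \<bar>t\<bar>))"
    by (intro Bochner_Integration.integrable_bound[where g="\<lambda>t. norm (g t) / (1 + \<bar>t\<bar>)"]) (auto intro!: AE_I2 order_trans[OF _ abs_ge_self])
  then show ?thesis by (simp add: tame_def)
qed

lemma cauchy_kernel_bound:
  assumes "Im z \<noteq> 0"
  shows "1 / norm (of_real t - z) \<le> (1 + (1 + norm z) / \<bar>Im z\<bar>) / (1 + \<bar>t\<bar>)"
proof -
  have im: "\<bar>Im z\<bar> \<le> norm (of_real t - z)"
    using abs_Im_le_cmod[of "of_real t - z"] by simp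
  have pos: "norm (of_real t - z) > 0" using im assms by linarith
  have "\<bar>t\<bar> = norm ((of_real t - z) + z)" by simp
  also have "\<dots> \<le> norm (of_real t - z) + norm z" by (rule norm_triangle_ineq)
  finally have "1 + \<bar>t\<bar> \<le> norm (of_real t - z) + (1 + norm z) * 1" by simp
  also have "(1 + norm z) * 1 \<le> (1 + norm z) * (norm (of_real t - z) / \<bar>Im z\<bar>)"
    using im assms by (intro mult_left_mono) (auto simp: field_simps)
  finally have "1 + \<bar>t\<bar> \<le> norm (of_real t - z) + (1 + norm z) * (norm (of_real t - z) / \<bar>Im z\<bar>)"
    by simp
  also have "norm (of_real t - z) + (1 + norm z) * (norm (of_real t - z) / \<bar>Im z\<bar>)
      = (1 + (1 + norm z) / \<bar>Im z\<bar>) * norm (of_real t - z)" by (simp add: field_simps)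
  finally have le: "1 + \<bar>t\<bar> \<le> (1 + (1 + norm z) / \<bar>Im z\<bar>) * norm (of_real t - z)" .
  have "0 < 1 + \<bar>t\<bar>" by simp
  with le pos show ?thesis by (simp only: pos_le_divide_eq pos_divide_le_eq times_divide_eq_left mult_1)
qed

lemma cauchy_kernel_le:
  assumes "Im z \<noteq> 0"
  shows "1 / norm (of_real t - z) \<le> 1 / \<bar>Im z\<bar>"
proof -
  have "\<bar>Im z\<bar> \<le> norm (of_real t - z)"
    using abs_Im_le_cmod[of "of_real t - z"] by simp
  then show ?thesis using assms by (intro frac_le) auto
qed

lemma of_real_neq_nonreal [simp]: "Im z \<noteq> 0 \<Longrightarrow> of_real t - z \<noteq> 0"
  by (auto simp: complex_eq_iff)

lemma integrable_norm_cauchy: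
  assumes g: "tame g" and z: "Im z \<noteq> 0"
  shows "integrable lborel (\<lambda>t. norm (g t) / norm (of_real t - z))"
proof -
  note [measurable] = tame_measurable[OF g]
  have "integrable lborel (\<lambda>t. (1 + (1 + norm z) / \<bar>Im z\<bar>) * (norm (g t) / (1 + \<bar>t\<bar>)))"
    using g by (intro integrable_mult_right) (simp add: tame_def)
  then show ?thesis
  proof (rule Bochner_Integration.integrable_bound, measurable, intro AE_I2)
    fix t
    have "norm (g t) * (1 / norm (of_real t - z)) \<le>
        norm (g t) * ((1 + (1 + norm z) / \<bar>Im z\<bar>) / (1 + \<bar>t\<bar>))"
      by (intro mult_left_mono cauchy_kernel_bound z) auto
    then show "norm (norm (g t) / norm (of_real t - z))
        \<le> norm ((1 + (1 + norm z) / \<bar>Im z\<bar>) * (norm (g t) / (1 + \<bar>t\<bar>)))"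
      using z by (simp add: mult.commute abs_mult)
  qed
qed

lemma integrable_cauchy:
  assumes g: "tame g" and z: "Im z \<noteq> 0"
  shows "integrable lborel (\<lambda>t. g t / (of_real t - z))"
proof -
  note [measurable] = tame_measurable[OF g]
  show ?thesis
    by (rule Bochner_Integration.integrable_bound[OF integrable_norm_cauchy[OF g z]])
       (auto simp: norm_divide)
qed

text \<open>
  The difference quotient minus the expected derivative is \<open>w - z\<close> times an
  absolutely convergent integral which stays bounded as \<open>w\<close> tends to
  \<open>z\<close>.
\<close>

lemma has_field_derivative_cauchy_transform:
  assumes g: "tame g" and z: "Im z \<noteq> 0"
  shows "(cauchy_transform g has_field_derivative (LINT t|lborel. g t / (of_real t - z)\<^sup>2)) (at z)"
proof -
  note [measurable] = tame_measurable[OF g]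
  define N where "N = (LINT t|lborel. norm (g t) / norm (of_real t - z))"
  define C where "C = 2 / \<bar>Im z\<bar> * (1 / \<bar>Im z\<bar>) * N"
  let ?D = "LINT t|lborel. g t / (of_real t - z)\<^sup>2"
  have int2: "integrable lborel (\<lambda>t. g t / (of_real t - z)\<^sup>2)"
  proof (rule Bochner_Integration.integrable_bound)
    show "integrable lborel (\<lambda>t. 1 / \<bar>Im z\<bar> * (norm (g t) / norm (of_real t - z)))"
      by (intro integrable_mult_right integrable_norm_cauchy g z)
    show "AE t in lborel. norm (g t / (of_real t - z)\<^sup>2)
        \<le> norm (1 / \<bar>Im z\<bar> * (norm (g t) / norm (of_real t - z)))"
    proof (intro AE_I2)
      fix t
      have "norm (g t) / norm (of_real t - z) * (1 / norm (of_real t - z))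
          \<le> norm (g t) / norm (of_real t - z) * (1 / \<bar>Im z\<bar>)"
        by (intro mult_left_mono cauchy_kernel_le z) auto
      then show "norm (g t / (of_real t - z)\<^sup>2)
        \<le> norm (1 / \<bar>Im z\<bar> * (norm (g t) / norm (of_real t - z)))"
        by (simp add: norm_divide norm_mult power2_eq_square mult.commute)
    qed
  qed measurable
  have est: "norm ((cauchy_transform g w - cauchy_transform g z) / (w - z) - ?D) \<le> C * norm (w - z)"
    if w: "w \<noteq> z" "dist w z < \<bar>Im z\<bar> / 2" for w
  proof -
    have "\<bar>Im w - Im z\<bar> < \<bar>Im z\<bar> / 2"
      using w(2) abs_Im_le_cmod[of "w - z"] by (simp add: dist_norm)
    then have imw: "\<bar>Im w\<bar> \<ge> \<bar>Im z\<bar> / 2" and w0: "Im w \<noteq> 0" using z by linarith+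
    have eq: "(g t / (of_real t - w) - g t / (of_real t - z)) / (w - z) - g t / (of_real t - z)\<^sup>2
        = (w - z) * (g t / ((of_real t - w) * (of_real t - z)\<^sup>2))" for t
    proof -
      have nz: "of_real t - w \<noteq> 0" "of_real t - z \<noteq> 0" "w - z \<noteq> 0" using w0 z w(1) by auto
      have *: "(G / a - G / b) / (b - a) - G / b\<^sup>2 = (b - a) * (G / (a * b\<^sup>2))"
        if ab: "a \<noteq> 0" "b \<noteq> 0" "b - a \<noteq> 0" for G a b :: complex
      proof -
        have "G / a - G / b = (G / (a * b)) * (b - a)" using ab by (simp add: field_simps)
        then have "(G / a - G / b) / (b - a) = G / (a * b)" using ab by simp
        then show ?thesis using ab by (simp add: field_simps power2_eq_square)
      qed
      show ?thesis using *[of "of_real t - w" "of_real t - z" "g t"] nz by simp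
    qed
    have "(cauchy_transform g w - cauchy_transform g z) / (w - z) - ?D
        = (LINT t|lborel. (g t / (of_real t - w) - g t / (of_real t - z)) / (w - z)
             - g t / (of_real t - z)\<^sup>2)"
      unfolding cauchy_transform_def using int2 integrable_cauchy[OF g w0] integrable_cauchy[OF g z]
      by simp
    also have "\<dots> = (LINT t|lborel. (w - z) * (g t / ((of_real t - w) * (of_real t - z)\<^sup>2)))"
      by (simp only: eq)
    also have "norm \<dots> \<le> (LINT t|lborel. norm (w - z) * (2 / \<bar>Im z\<bar> * (1 / \<bar>Im z\<bar>) *
          (norm (g t) / norm (of_real t - z))))"
    proof (rule Bochner_Integration.integral_norm_bound_integral)
      show "integrable lborel (\<lambda>t. (w - z) * (g t / ((of_real t - w) * (of_real t - z)\<^sup>2)))"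
        unfolding eq[symmetric] using int2 integrable_cauchy[OF g w0] integrable_cauchy[OF g z] by simp
      show "integrable lborel (\<lambda>t. norm (w - z) * (2 / \<bar>Im z\<bar> * (1 / \<bar>Im z\<bar>) *
          (norm (g t) / norm (of_real t - z))))"
        by (intro integrable_mult_right integrable_norm_cauchy g z)
      fix t
      have "norm (g t) / norm (of_real t - z) * ((1 / norm (of_real t - w)) * (1 / norm (of_real t - z)))
          \<le> norm (g t) / norm (of_real t - z) * ((2 / \<bar>Im z\<bar>) * (1 / \<bar>Im z\<bar>))"
      proof (intro mult_left_mono mult_mono cauchy_kernel_le z)
        have "1 / norm (of_real t - w) \<le> 1 / \<bar>Im w\<bar>" by (rule cauchy_kernel_le[OF w0])
        also have "\<dots> \<le> 1 / (\<bar>Im z\<bar> / 2)" using imw z by (intro divide_left_mono) auto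
        finally show "1 / norm (of_real t - w) \<le> 2 / \<bar>Im z\<bar>" by simp
      qed auto
      then have "norm (w - z) * (norm (g t) / norm (of_real t - z) * ((1 / norm (of_real t - w)) * (1 / norm (of_real t - z))))
          \<le> norm (w - z) * (norm (g t) / norm (of_real t - z) * ((2 / \<bar>Im z\<bar>) * (1 / \<bar>Im z\<bar>)))"
        by (rule mult_left_mono) auto
      then show "norm ((w - z) * (g t / ((of_real t - w) * (of_real t - z)\<^sup>2)))
         \<le> norm (w - z) * (2 / \<bar>Im z\<bar> * (1 / \<bar>Im z\<bar>) * (norm (g t) / norm (of_real t - z)))"
        by (simp add: norm_mult norm_divide power2_eq_square mult_ac)
    qed
    also have "\<dots> = C * norm (w - z)"
      unfolding C_def N_def by (simp only: integral_mult_right_zero mult_ac)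
    finally show ?thesis .
  qed
  show ?thesis
    unfolding has_field_derivative_iff
  proof (rule Lim_null[THEN iffD2], rule Lim_null_comparison)
    show "\<forall>\<^sub>F w in at z. norm ((cauchy_transform g w - cauchy_transform g z) / (w - z) - ?D)
        \<le> C * norm (w - z)"
      unfolding eventually_at using est z by (intro exI[of _ "\<bar>Im z\<bar> / 2"]) auto
    have "((\<lambda>w. C * norm (w - z)) \<longlongrightarrow> C * norm (z - z)) (at z)" by (intro tendsto_intros)
    then show "((\<lambda>w. C * norm (w - z)) \<longlongrightarrow> 0) (at z)" by simp
  qed
qed

lemma open_upper_half_plane: "open upper_half_plane"
  unfolding upper_half_plane_def by (simp add: open_halfspace_Im_gt)

lemma convex_upper_half_plane: "convex upper_half_plane"
  unfolding upper_half_plane_def by (rule convex_halfspace_Im_gt)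

lemma open_lower_half_plane: "open {z. Im z < 0}"
  by (simp add: open_halfspace_Im_lt)

lemma holomorphic_on_upper_half_plane_shift:
  assumes F: "F holomorphic_on upper_half_plane" and a: "Im a \<ge> 0"
  shows "(\<lambda>z. F (z + a)) holomorphic_on upper_half_plane"
proof -
  have "(F \<circ> (\<lambda>z. z + a)) holomorphic_on upper_half_plane"
    by (rule holomorphic_on_compose_gen[OF _ F])
       (use a in \<open>auto intro!: holomorphic_intros simp: upper_half_plane_def\<close>)
  then show ?thesis by (simp add: o_def)
qed

lemma powr_le_imp_le_root:
  fixes x m p :: real
  assumes "p > 0" "x \<ge> 0" "x powr p \<le> m"
  shows "x \<le> m powr (1 / p)"
proof -
  have "(x powr p) powr (1 / p) \<le> m powr (1 / p)" using assms by (intro powr_mono2) auto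
  then show ?thesis using assms by (simp add: powr_powr)
qed

lemma holomorphic_cauchy_transform:
  assumes "tame g" "\<And>z. z \<in> S \<Longrightarrow> Im z \<noteq> 0"
  shows "cauchy_transform g holomorphic_on S"
  unfolding holomorphic_on_def
  using has_field_derivative_cauchy_transform[OF assms(1)] assms(2)
  by (meson field_differentiable_def field_differentiable_at_within)

text \<open>
  Difference and sum of \<open>1 / (t - z)\<close> and \<open>1 / (t - cnj z)\<close> are, up to
  constants, the Poisson kernel and its conjugate.
\<close>

lemma integrable_poisson_kernel_mult:
  assumes g: "tame g" and z: "Im z \<noteq> 0"
  shows "integrable lborel (\<lambda>t. of_real (Im z / (pi * ((Re z - t)\<^sup>2 + (Im z)\<^sup>2))) * g t)" (is ?A)
    and "integrable lborel (\<lambda>t. of_real ((Re z - t) / (pi * ((Re z - t)\<^sup>2 + (Im z)\<^sup>2))) * g t)" (is ?B)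
    and "(LINT t|lborel. of_real (Im z / (pi * ((Re z - t)\<^sup>2 + (Im z)\<^sup>2))) * g t)
         = (cauchy_transform g z - cauchy_transform g (cnj z)) / (2 * pi * \<i>)" (is ?C)
    and "conj_poisson g z = - (cauchy_transform g z + cauchy_transform g (cnj z)) / (2 * pi)" (is ?D)
proof -
  have z': "Im (cnj z) \<noteq> 0" using z by simp
  have nz: "(Re z - t)\<^sup>2 + (Im z)\<^sup>2 \<noteq> 0" for t using z by (simp add: sum_power2_eq_zero_iff)
  have fac: "(of_real t - z) * (of_real t - cnj z) = of_real ((Re z - t)\<^sup>2 + (Im z)\<^sup>2)" for t
    by (simp add: complex_eq_iff power2_eq_square algebra_simps)
  have i1: "of_real (1 / ((Re z - t)\<^sup>2 + (Im z)\<^sup>2)) = 1 / ((of_real t - z) * (of_real t - cnj z))" for t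
    unfolding fac by simp
  have 1: "of_real (Im z / (pi * ((Re z - t)\<^sup>2 + (Im z)\<^sup>2))) * g t
        = (g t / (of_real t - z) - g t / (of_real t - cnj z)) / (2 * pi * \<i>)" for t
  proof -
    have "of_real (Im z / (pi * ((Re z - t)\<^sup>2 + (Im z)\<^sup>2)))
        = of_real (1 / ((Re z - t)\<^sup>2 + (Im z)\<^sup>2)) * ((z - cnj z) / (2 * pi * \<i>))"
      by (simp add: complex_diff_cnj field_simps)
    also have "\<dots> = 1 / ((of_real t - z) * (of_real t - cnj z)) * ((z - cnj z) / (2 * pi * \<i>))"
      by (simp only: i1)
    finally have "of_real (Im z / (pi * ((Re z - t)\<^sup>2 + (Im z)\<^sup>2))) * g t
      = 1 / ((of_real t - z) * (of_real t - cnj z)) * ((z - cnj z) / (2 * pi * \<i>)) * g t" by simp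
    also have "\<dots> = (g t / (of_real t - z) - g t / (of_real t - cnj z)) / (2 * pi * \<i>)"
    proof -
      have a: "of_real t - z \<noteq> 0" "of_real t - cnj z \<noteq> 0" using of_real_neq_nonreal[OF z] of_real_neq_nonreal[OF z'] by blast+
      have "1 / (of_real t - z) - 1 / (of_real t - cnj z)
          = ((of_real t - cnj z) - (of_real t - z)) / ((of_real t - z) * (of_real t - cnj z))"
        using a by (simp add: diff_frac_eq)
      then have b: "(z - cnj z) / ((of_real t - z) * (of_real t - cnj z))
           = 1 / (of_real t - z) - 1 / (of_real t - cnj z)" by simp
      have "1 / ((of_real t - z) * (of_real t - cnj z)) * ((z - cnj z) / (2 * pi * \<i>)) * g t
          = g t * ((z - cnj z) / ((of_real t - z) * (of_real t - cnj z))) / (2 * pi * \<i>)"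
        by simp
      also have "\<dots> = g t * (1 / (of_real t - z) - 1 / (of_real t - cnj z)) / (2 * pi * \<i>)"
        by (simp only: b)
      finally show ?thesis by (simp add: right_diff_distrib)
    qed
    finally show ?thesis .
  qed
  have 2: "of_real ((Re z - t) / (pi * ((Re z - t)\<^sup>2 + (Im z)\<^sup>2))) * g t
        = - (g t / (of_real t - z) + g t / (of_real t - cnj z)) / (2 * pi)" for t
  proof -
    have a: "of_real t - z \<noteq> 0" "of_real t - cnj z \<noteq> 0" using of_real_neq_nonreal[OF z] of_real_neq_nonreal[OF z'] by blast+
    have gen: "(2 * r) * (1 / d) / (2 * pi) = r / (pi * d)" for r d :: real by simp
    have "1 / (of_real t - z) + 1 / (of_real t - cnj z)
        = ((of_real t - cnj z) + (of_real t - z)) / ((of_real t - z) * (of_real t - cnj z))"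
      using a by (simp add: add_frac_eq)
    also have "(of_real t - cnj z) + (of_real t - z) = - of_real (2 * (Re z - t))"
      by (simp add: complex_eq_iff)
    finally have b: "1 / (of_real t - z) + 1 / (of_real t - cnj z)
       = - of_real (2 * (Re z - t)) * of_real (1 / ((Re z - t)\<^sup>2 + (Im z)\<^sup>2))" by (simp add: fac)
    have "- (g t / (of_real t - z) + g t / (of_real t - cnj z)) / (2 * pi)
       = - g t * (1 / (of_real t - z) + 1 / (of_real t - cnj z)) / (2 * pi)"
      by (simp add: distrib_left)
    also have "\<dots> = g t * (of_real (2 * (Re z - t)) * of_real (1 / ((Re z - t)\<^sup>2 + (Im z)\<^sup>2))) / (2 * pi)"
      by (simp only: b mult_minus_left mult_minus_right minus_minus)
    also have "\<dots> = of_real ((2 * (Re z - t)) * (1 / ((Re z - t)\<^sup>2 + (Im z)\<^sup>2)) / (2 * pi)) * g t"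
      by (simp only: of_real_mult of_real_divide of_real_numeral mult_ac times_divide_eq_left times_divide_eq_right)
    also have "(2 * (Re z - t)) * (1 / ((Re z - t)\<^sup>2 + (Im z)\<^sup>2)) / (2 * pi) = (Re z - t) / (pi * ((Re z - t)\<^sup>2 + (Im z)\<^sup>2))"
      using gen[of "Re z - t" "(Re z - t)\<^sup>2 + (Im z)\<^sup>2"] .
    finally show ?thesis by simp
  qed
  note ic = integrable_cauchy[OF g z] integrable_cauchy[OF g z']
  show ?A ?B unfolding 1 2 using ic by auto
  show ?C unfolding 1 cauchy_transform_def using ic by simp
  show ?D unfolding conj_poisson_def 2 cauchy_transform_def using ic by simp
qed

lemma poisson_borel:
  assumes [measurable]: "g \<in> borel_measurable borel"
  shows "poisson g z = (LINT t|lborel. of_real (Im z / (pi * ((Re z - t)\<^sup>2 + (Im z)\<^sup>2))) * g t)"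
  unfolding poisson_def by (rule integral_completion) measurable

lemma poisson_cauchy:
  assumes "tame g" "Im z \<noteq> 0"
  shows "poisson g z = (cauchy_transform g z - cauchy_transform g (cnj z)) / (2 * pi * \<i>)"
  using integrable_poisson_kernel_mult(3)[OF assms] poisson_borel[OF tame_measurable[OF assms(1)], of z]
  by simp

text \<open>
  Poisson integrals of complex functions are not real parts, but sums of a holomorphic and an
  antiholomorphic function. This class is stable under both partial derivatives, which act on
  the pair \<open>(A, B)\<close> as \<open>(A', B')\<close> and \<open>(\<i> A', - \<i>
  B')\<close>; hence the second derivatives come from applying the lemma twice.
\<close>

lemma has_continuous_partials_holomorphic_cnj:
  assumes A: "A holomorphic_on upper_half_plane" and B: "B holomorphic_on {z. Im z < 0}"
  shows "has_continuous_partials_on (\<lambda>z. A z + B (cnj z))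
     (\<lambda>z. deriv A z + deriv B (cnj z)) (\<lambda>z. \<i> * deriv A z + (- \<i>) * deriv B (cnj z)) upper_half_plane"
proof -
  have sub: "cnj ` upper_half_plane \<subseteq> {z. Im z < 0}" by (auto simp: upper_half_plane_def)
  have cA: "continuous_on upper_half_plane (deriv A)"
    by (intro holomorphic_on_imp_continuous_on holomorphic_deriv A open_upper_half_plane)
  have "continuous_on {z. Im z < 0} (deriv B)"
    by (intro holomorphic_on_imp_continuous_on holomorphic_deriv B open_lower_half_plane)
  then have cB: "continuous_on upper_half_plane (\<lambda>z. deriv B (cnj z))"
    by (rule continuous_on_compose2[OF _ continuous_on_cnj[OF continuous_on_id] sub])
  show ?thesis
    unfolding has_continuous_partials_on_def
  proof (intro conjI ballI)
    fix z assume z: "z \<in> upper_half_plane"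
    have dA: "(A has_field_derivative deriv A z) (at z)"
      using holomorphic_derivI[OF A open_upper_half_plane z] .
    have dB: "(B has_field_derivative deriv B (cnj z)) (at (cnj z))"
      using z by (intro holomorphic_derivI[OF B open_lower_half_plane]) (auto simp: upper_half_plane_def)
    have "((\<lambda>z. A z + B (cnj z)) has_derivative (\<lambda>h. deriv A z * h + deriv B (cnj z) * cnj h)) (at z)"
    proof (intro has_derivative_add)
      show "(A has_derivative (*) (deriv A z)) (at z)" using dA by (simp add: has_field_derivative_def)
      have "(B has_derivative (*) (deriv B (cnj z))) (at (cnj z))" using dB by (simp add: has_field_derivative_def)
      from has_derivative_compose[OF bounded_linear_imp_has_derivative[OF bounded_linear_cnj] this]
      show "((\<lambda>z. B (cnj z)) has_derivative (\<lambda>h. deriv B (cnj z) * cnj h)) (at z)" .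
    qed
    moreover have "(\<lambda>h. deriv A z * h + deriv B (cnj z) * cnj h) =
      (\<lambda>h. Re h *\<^sub>R (deriv A z + deriv B (cnj z)) + Im h *\<^sub>R (\<i> * deriv A z + (- \<i>) * deriv B (cnj z)))"
      by (auto simp: fun_eq_iff complex_eq_iff algebra_simps)
    ultimately show "((\<lambda>z. A z + B (cnj z)) has_derivative
      (\<lambda>h. Re h *\<^sub>R (deriv A z + deriv B (cnj z)) + Im h *\<^sub>R (\<i> * deriv A z + (- \<i>) * deriv B (cnj z)))) (at z)"
      by simp
  qed (intro continuous_intros cA cB)+
qed

lemma harmonic_onI:
  assumes "has_continuous_partials_on f fx fy S" "has_continuous_partials_on fx fxx fxy S"
    "has_continuous_partials_on fy fyx fyy S" "\<And>z. z \<in> S \<Longrightarrow> fxx z + fyy z = 0"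
  shows "harmonic_on f S"
  using assms unfolding harmonic_on_def by (intro exI conjI ballI)

lemma harmonic_on_holomorphic_cnj:
  assumes A: "A holomorphic_on upper_half_plane" and B: "B holomorphic_on {z. Im z < 0}"
  shows "harmonic_on (\<lambda>z. A z + B (cnj z)) upper_half_plane"
proof -
  have A': "deriv A holomorphic_on upper_half_plane"
    by (rule holomorphic_deriv[OF A open_upper_half_plane])
  have B': "deriv B holomorphic_on {z. Im z < 0}"
    by (rule holomorphic_deriv[OF B open_lower_half_plane])
  have iA: "(\<lambda>z. \<i> * deriv A z) holomorphic_on upper_half_plane"
   and iB: "(\<lambda>z. (-\<i>) * deriv B z) holomorphic_on {z. Im z < 0}"
    by (intro holomorphic_intros A' B')+
  have dA: "deriv (\<lambda>z. \<i> * deriv A z) z = \<i> * deriv (deriv A) z" if "z \<in> upper_half_plane" for z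
    using that holomorphic_on_imp_differentiable_at[OF A' open_upper_half_plane] by (intro deriv_cmult) auto
  have dB: "deriv (\<lambda>z. (-\<i>) * deriv B z) z = (-\<i>) * deriv (deriv B) z" if "Im z < 0" for z
    using that holomorphic_on_imp_differentiable_at[OF B' open_lower_half_plane] by (intro deriv_cmult) auto
  show ?thesis
  proof (rule harmonic_onI[OF has_continuous_partials_holomorphic_cnj[OF A B]
        has_continuous_partials_holomorphic_cnj[OF A' B']
        has_continuous_partials_holomorphic_cnj[OF iA iB]])
    fix z assume z: "z \<in> upper_half_plane"
    then have "Im (cnj z) < 0" by (simp add: upper_half_plane_def)
    show "deriv (deriv A) z + deriv (deriv B) (cnj z) +
     (\<i> * deriv (\<lambda>z. \<i> * deriv A z) z + (- \<i>) * deriv (\<lambda>z. (-\<i>) * deriv B z) (cnj z)) = 0"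
      unfolding dA[OF z] dB[OF \<open>Im (cnj z) < 0\<close>] by (simp add: algebra_simps)
  qed
qed

lemma harmonic_on_cong:
  assumes "harmonic_on f S" "open S" "\<And>z. z \<in> S \<Longrightarrow> f z = f' z"
  shows "harmonic_on f' S"
proof -
  have *: "has_continuous_partials_on f' fx fy S" if h: "has_continuous_partials_on f fx fy S" for fx fy
    unfolding has_continuous_partials_on_def
  proof (intro conjI ballI)
    show "continuous_on S fx" "continuous_on S fy"
      using h by (auto simp: has_continuous_partials_on_def)
    fix z assume z: "z \<in> S"
    then have "(f has_derivative (\<lambda>h. Re h *\<^sub>R fx z + Im h *\<^sub>R fy z)) (at z)"
      using h by (auto simp: has_continuous_partials_on_def)
    then show "(f' has_derivative (\<lambda>h. Re h *\<^sub>R fx z + Im h *\<^sub>R fy z)) (at z)"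
      by (rule has_derivative_transform_within_open[OF _ assms(2) z assms(3)])
  qed
  from assms(1) obtain fx fy fxx fxy fyx fyy where h:
    "has_continuous_partials_on f fx fy S" "has_continuous_partials_on fx fxx fxy S"
    "has_continuous_partials_on fy fyx fyy S" "\<forall>z\<in>S. fxx z + fyy z = 0"
    unfolding harmonic_on_def by (elim exE conjE)
  show ?thesis by (rule harmonic_onI[OF *[OF h(1)] h(2,3)]) (use h(4) in auto)
qed

lemma harmonic_poisson:
  assumes g: "tame g"
  shows "harmonic_on (poisson g) upper_half_plane" "harmonic_on (conj_poisson g) upper_half_plane"
proof -
  have 1: "cauchy_transform g holomorphic_on upper_half_plane"
       "cauchy_transform g holomorphic_on {z. Im z < 0}"
    by (auto intro!: holomorphic_cauchy_transform g simp: upper_half_plane_def)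
  have "harmonic_on (\<lambda>z. cauchy_transform g z / (2 * pi * \<i>)
       + - cauchy_transform g (cnj z) / (2 * pi * \<i>)) upper_half_plane"
    by (rule harmonic_on_holomorphic_cnj[of _ "\<lambda>z. - cauchy_transform g z / (2 * pi * \<i>)"])
       (intro holomorphic_intros 1; simp)+
  then show "harmonic_on (poisson g) upper_half_plane"
    by (rule harmonic_on_cong[OF _ open_upper_half_plane])
       (simp add: poisson_cauchy[OF g] upper_half_plane_def diff_divide_distrib)
  have "harmonic_on (\<lambda>z. - cauchy_transform g z / (2 * pi)
       + - cauchy_transform g (cnj z) / (2 * pi)) upper_half_plane"
    by (rule harmonic_on_holomorphic_cnj[of _ "\<lambda>z. - cauchy_transform g z / (2 * pi)"])
       (intro holomorphic_intros 1; simp)+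
  then show "harmonic_on (conj_poisson g) upper_half_plane"
    by (rule harmonic_on_cong[OF _ open_upper_half_plane])
       (simp add: integrable_poisson_kernel_mult(4)[OF g] upper_half_plane_def diff_divide_distrib)
qed

section \<open>The Poisson kernel\<close>

definition poisson_kernel :: "real \<Rightarrow> real \<Rightarrow> real" where
  "poisson_kernel y u = y / (pi * (u\<^sup>2 + y\<^sup>2))"

lemma poisson_kernel_measurable [measurable]: "poisson_kernel y \<in> borel_measurable borel"
  unfolding poisson_kernel_def[abs_def] by measurable

lemma poisson_kernel_nonneg [simp]: "y \<ge> 0 \<Longrightarrow> poisson_kernel y u \<ge> 0"
  by (simp add: poisson_kernel_def)

lemma poisson_kernel_even [simp]: "poisson_kernel y (- u) = poisson_kernel y u"
  by (simp add: poisson_kernel_def)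

lemma nn_integral_swap:
  assumes "case_prod f \<in> borel_measurable (lborel \<Otimes>\<^sub>M lborel)"
  shows "(\<integral>\<^sup>+x. \<integral>\<^sup>+y. f x y \<partial>lborel \<partial>lborel) = (\<integral>\<^sup>+y. \<integral>\<^sup>+x. f x y \<partial>lborel \<partial>(lborel :: real measure))"
  using lborel_pair.Fubini'[OF assms] by simp

lemma nn_integral_reflect_shift:
  fixes f :: "real \<Rightarrow> ennreal"
  assumes [measurable]: "f \<in> borel_measurable borel"
  shows "(\<integral>\<^sup>+t. f (x - t) \<partial>lborel) = (\<integral>\<^sup>+t. f t \<partial>lborel)"
  using nn_integral_real_affine[OF assms, of "-1" x] by simp

lemma nn_integral_shift:
  fixes f :: "real \<Rightarrow> ennreal"
  assumes [measurable]: "f \<in> borel_measurable borel"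
  shows "(\<integral>\<^sup>+t. f (t - x) \<partial>lborel) = (\<integral>\<^sup>+t. f t \<partial>lborel)"
  using nn_integral_real_affine[OF assms, of 1 "-x"] by simp

lemma inverse_1_plus_square:
  "integrable lborel (\<lambda>x::real. inverse (1 + x\<^sup>2))" "(LINT x|lborel. inverse (1 + x\<^sup>2)) = pi"
  using integrable_inverse_1_plus_square LBINT_inverse_1_plus_square
  by (simp_all add: set_integrable_def interval_lebesgue_integral_def set_lebesgue_integral_def)

lemma poisson_kernel_scale:
  assumes y: "y > 0"
  shows "y * poisson_kernel y (y * u) = 1 / pi * inverse (1 + u\<^sup>2)"
proof -
  have "pi * ((y * u)\<^sup>2 + y\<^sup>2) = (y * y) * (pi * (1 + u\<^sup>2))"
    by (simp add: power2_eq_square algebra_simps)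
  moreover have "y * (y / ((y * y) * c)) = 1 / c" for c using y by simp
  ultimately show ?thesis by (simp add: poisson_kernel_def divide_inverse)
qed

lemma nn_integral_poisson_kernel:
  assumes y: "y > 0"
  shows "(\<integral>\<^sup>+u. ennreal (poisson_kernel y u) \<partial>lborel) = 1"
proof -
  have "(\<integral>\<^sup>+u. ennreal (poisson_kernel y u) \<partial>lborel)
      = ennreal y * (\<integral>\<^sup>+u. ennreal (poisson_kernel y (y * u)) \<partial>lborel)"
    using nn_integral_real_affine[of "\<lambda>u. ennreal (poisson_kernel y u)" y 0] y by simp
  also have "\<dots> = (\<integral>\<^sup>+u. ennreal (1 / pi * inverse (1 + u\<^sup>2)) \<partial>lborel)"
  proof (subst nn_integral_cmult[symmetric])
    show "(\<integral>\<^sup>+u. ennreal y * ennreal (poisson_kernel y (y * u)) \<partial>lborel)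
       = (\<integral>\<^sup>+u. ennreal (1 / pi * inverse (1 + u\<^sup>2)) \<partial>lborel)"
      by (simp only: poisson_kernel_scale[OF y] ennreal_mult'[symmetric, OF less_imp_le[OF y]])
  qed measurable
  also have "\<dots> = ennreal (LINT u|lborel. 1 / pi * inverse (1 + u\<^sup>2))"
    by (intro nn_integral_eq_integral integrable_mult_right inverse_1_plus_square) auto
  also have "(LINT u|lborel. 1 / pi * inverse (1 + u\<^sup>2)) = (1::real)"
    by (subst integral_mult_right_zero) (simp add: inverse_1_plus_square)
  finally show ?thesis by simp
qed

lemma integrable_poisson_kernel:
  assumes y: "y > 0"
  shows "integrable lborel (poisson_kernel y)" "(LINT u|lborel. poisson_kernel y u) = 1"
proof -
  show 1: "integrable lborel (poisson_kernel y)"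
    using nn_integral_poisson_kernel[OF y] y by (intro integrableI_nonneg) auto
  have "ennreal (LINT u|lborel. poisson_kernel y u) = 1"
    using nn_integral_poisson_kernel[OF y] nn_integral_eq_integral[OF 1] y by simp
  then show "(LINT u|lborel. poisson_kernel y u) = 1" by simp
qed

lemma integrable_poisson_kernel_shift:
  assumes y: "y > 0"
  shows "integrable lborel (\<lambda>t. poisson_kernel y (x - t))"
    "(LINT t|lborel. poisson_kernel y (x - t)) = 1"
proof -
  show "integrable lborel (\<lambda>t. poisson_kernel y (x - t))"
    using lborel_integrable_real_affine[OF integrable_poisson_kernel(1)[OF y], of "-1" x] by simp
  show "(LINT t|lborel. poisson_kernel y (x - t)) = 1"
    using lborel_integral_real_affine[of "-1" "poisson_kernel y" x]
      integrable_poisson_kernel(2)[OF y] by simp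
qed

lemma poisson_eq:
  "tame g \<Longrightarrow> poisson g (Complex x y) = (LINT t|lborel. of_real (poisson_kernel y (x - t)) * g t)"
  by (simp add: poisson_borel[OF tame_measurable] poisson_kernel_def)

lemma integrable_poisson_kernel_tame:
  assumes "tame g" "y > 0"
  shows "integrable lborel (\<lambda>t. of_real (poisson_kernel y (x - t)) * g t)"
  using integrable_poisson_kernel_mult(1)[OF assms(1), of "Complex x y"] assms(2)
  by (simp add: poisson_kernel_def)

lemma integrable_poisson_kernel_norm:
  assumes "tame g" "y > 0"
  shows "integrable lborel (\<lambda>t. poisson_kernel y (x - t) * norm (g t))"
  using integrable_norm[OF integrable_poisson_kernel_tame[OF assms, of x]] assms(2)
  by (simp add: norm_mult)

section \<open>Convolution with probability kernels contracts the \<open>p\<close>-norm\<close>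

text \<open>
  With \<open>m\<close> the mean of \<open>h\<close>, the inequality of Young for the product of
  \<open>h\<close> and \<open>m powr (p - 1)\<close>, integrated against the probability density
  \<open>k\<close>, bounds \<open>m powr p\<close> by the convex combination with weights
  \<open>1 / p\<close> and \<open>1 / q\<close> of the mean of \<open>h powr p\<close> and
  \<open>m powr p\<close> itself.
\<close>

lemma jensen_kernel:
  fixes k h :: "real \<Rightarrow> real"
  assumes p: "p > 1" and [measurable]: "k \<in> borel_measurable borel" "h \<in> borel_measurable borel"
    and k0: "\<And>t. k t \<ge> 0" and h0: "\<And>t. h t \<ge> 0"
    and k1: "(\<integral>\<^sup>+t. ennreal (k t) \<partial>lborel) = 1"
    and int: "integrable lborel (\<lambda>t. k t * h t)"
  shows "ennreal ((LINT t|lborel. k t * h t) powr p) \<le> (\<integral>\<^sup>+t. ennreal (k t) * ennreal (h t powr p) \<partial>lborel)"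
proof (cases "(\<integral>\<^sup>+t. ennreal (k t) * ennreal (h t powr p) \<partial>lborel) = \<infinity>")
  case False
  define m where "m = (LINT t|lborel. k t * h t)"
  have m0: "m \<ge> 0" unfolding m_def using k0 h0 by (intro integral_nonneg_AE) auto
  define q where "q = p / (p - 1)"
  have q: "q > 1" "1 / p + 1 / q = 1" using p by (auto simp: q_def field_simps)
  have iP: "integrable lborel (\<lambda>t. k t * h t powr p)"
    using False k0 h0 by (intro integrableI_nonneg) (auto simp: ennreal_mult top.not_eq_extremum)
  have ik: "integrable lborel k" using k1 k0 by (intro integrableI_nonneg) auto
  have "ennreal (LINT t|lborel. k t) = 1" using k1 nn_integral_eq_integral[OF ik] k0 by simp
  then have k1': "(LINT t|lborel. k t) = 1" by simp
  have "m * m powr (p - 1) = (LINT t|lborel. k t * h t * m powr (p - 1))"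
    by (simp add: m_def)
  also have "\<dots> \<le> (LINT t|lborel. k t * h t powr p / p + k t * (m powr p / q))"
  proof (rule integral_mono)
    show "integrable lborel (\<lambda>t. k t * h t * m powr (p - 1))" using int by auto
    show "integrable lborel (\<lambda>t. k t * h t powr p / p + k t * (m powr p / q))"
      using iP ik by auto
    fix t
    have "h t * m powr (p - 1) \<le> h t powr p / p + (m powr (p - 1)) powr q / q"
      using p q h0 by (intro Youngs_inequality) auto
    also have "(m powr (p - 1)) powr q = m powr p" using p by (simp add: powr_powr q_def)
    finally show "k t * h t * m powr (p - 1) \<le> k t * h t powr p / p + k t * (m powr p / q)"
      using mult_left_mono[OF _ k0[of t]] by (fastforce simp: distrib_left mult.assoc)
  qed
  also have "\<dots> = (LINT t|lborel. k t * h t powr p) / p + m powr p / q"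
    using iP ik k1' by (subst Bochner_Integration.integral_add) auto
  finally have "m powr p \<le> (LINT t|lborel. k t * h t powr p) / p + m powr p / q"
    using m0 p by (cases "m = 0") (auto simp: powr_mult_base)
  also have "m powr p / q = m powr p - m powr p / p"
    using q p by (simp add: q_def field_simps)
  finally have "m powr p \<le> (LINT t|lborel. k t * h t powr p)" using p by (simp add: field_simps)
  then have "ennreal (m powr p) \<le> ennreal (LINT t|lborel. k t * h t powr p)" by (rule ennreal_leI)
  also have "\<dots> = (\<integral>\<^sup>+t. ennreal (k t * h t powr p) \<partial>lborel)"
    using iP k0 by (subst nn_integral_eq_integral) auto
  finally show ?thesis using k0 by (simp add: m_def ennreal_mult)
qed auto

text \<open>
  Jensen at each \<open>x\<close>; then Tonelli, since the kernel has total mass 1 also as a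
  function of \<open>x\<close>.
\<close>

lemma mass_convolution_le:
  fixes k :: "real \<Rightarrow> real" and g F :: "real \<Rightarrow> complex"
  assumes p: "p > 1" and [measurable]: "k \<in> borel_measurable borel" "g \<in> borel_measurable borel"
    and k0: "\<And>t. k t \<ge> 0" and k1: "(\<integral>\<^sup>+t. ennreal (k t) \<partial>lborel) = 1"
    and int: "\<And>x. integrable lborel (\<lambda>t. k (x - t) * norm (g t))"
    and F: "\<And>x. norm (F x) \<le> (LINT t|lborel. k (x - t) * norm (g t))"
  shows "mass p F \<le> mass p g"
proof -
  have "mass p F \<le> (\<integral>\<^sup>+x. \<integral>\<^sup>+t. ennreal (k (x - t)) * ennreal (norm (g t) powr p) \<partial>lborel \<partial>lborel)"
    unfolding mass_def
  proof (rule nn_integral_mono)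
    fix x
    have "norm (F x) powr p \<le> (LINT t|lborel. k (x - t) * norm (g t)) powr p"
      using F[of x] p by (intro powr_mono2) auto
    then have "ennreal (norm (F x) powr p) \<le> ennreal ((LINT t|lborel. k (x - t) * norm (g t)) powr p)"
      by (rule ennreal_leI)
    also have "\<dots> \<le> (\<integral>\<^sup>+t. ennreal (k (x - t)) * ennreal (norm (g t) powr p) \<partial>lborel)"
      using k0 int k1 by (intro jensen_kernel p) (auto simp: nn_integral_reflect_shift[of "\<lambda>t. ennreal (k t)"])
    finally show "ennreal (norm (F x) powr p)
        \<le> (\<integral>\<^sup>+t. ennreal (k (x - t)) * ennreal (norm (g t) powr p) \<partial>lborel)" .
  qed
  also have "\<dots> = (\<integral>\<^sup>+t. \<integral>\<^sup>+x. ennreal (k (x - t)) * ennreal (norm (g t) powr p) \<partial>lborel \<partial>lborel)"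
    by (rule nn_integral_swap) measurable
  also have "\<dots> = (\<integral>\<^sup>+t. ennreal (norm (g t) powr p) \<partial>lborel)"
    by (intro nn_integral_cong)
       (simp add: nn_integral_multc nn_integral_shift[of "\<lambda>t. ennreal (k t)"] k1)
  finally show ?thesis by (simp add: mass_def)
qed

lemma norm_poisson_le:
  assumes g: "tame g" and y: "y > 0"
  shows "norm (poisson g (Complex x y)) \<le> (LINT t|lborel. poisson_kernel y (x - t) * norm (g t))"
proof -
  have "norm (poisson g (Complex x y)) \<le> (LINT t|lborel. norm (of_real (poisson_kernel y (x - t)) * g t))"
    unfolding poisson_eq[OF g] by (rule integral_norm_bound)
  then show ?thesis using y by (simp add: norm_mult)
qed

lemma mass_poisson_le:
  assumes p: "p > 1" and g: "tame g" and y: "y > 0"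
  shows "mass p (\<lambda>x. poisson g (Complex x y)) \<le> mass p g"
proof (rule mass_convolution_le[OF p, of "poisson_kernel y"])
  show "(\<integral>\<^sup>+t. ennreal (poisson_kernel y t) \<partial>lborel) = 1" by (rule nn_integral_poisson_kernel[OF y])
qed (use y in \<open>auto intro!: integrable_poisson_kernel_norm norm_poisson_le g tame_measurable\<close>)

lemma norm_poisson_powr_le:
  assumes p: "p > 1" and g: "tame g" and y: "y > 0"
  shows "ennreal (norm (poisson g (Complex x y)) powr p) \<le> ennreal (1 / (pi * y)) * mass p g"
proof -
  note [measurable] = tame_measurable[OF g]
  have "ennreal (norm (poisson g (Complex x y)) powr p)
      \<le> ennreal ((LINT t|lborel. poisson_kernel y (x - t) * norm (g t)) powr p)"
    using norm_poisson_le[OF g y, of x] p by (intro ennreal_leI powr_mono2) auto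
  also have "\<dots> \<le> (\<integral>\<^sup>+t. ennreal (poisson_kernel y (x - t)) * ennreal (norm (g t) powr p) \<partial>lborel)"
    using y nn_integral_poisson_kernel[OF y]
    by (intro jensen_kernel p)
       (auto intro!: integrable_poisson_kernel_norm g
         simp: nn_integral_reflect_shift[of "\<lambda>t. ennreal (poisson_kernel y t)"])
  also have "\<dots> \<le> (\<integral>\<^sup>+t. ennreal (1 / (pi * y)) * ennreal (norm (g t) powr p) \<partial>lborel)"
  proof (intro nn_integral_mono mult_right_mono ennreal_leI)
    fix t
    have "y / (pi * ((x - t)\<^sup>2 + y\<^sup>2)) \<le> y / (pi * y\<^sup>2)"
      using y by (intro divide_left_mono mult_left_mono mult_pos_pos) (auto intro: add_nonneg_pos)
    then show "poisson_kernel y (x - t) \<le> 1 / (pi * y)"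
      using y by (simp add: poisson_kernel_def power2_eq_square)
  qed auto
  also have "\<dots> = ennreal (1 / (pi * y)) * mass p g"
    unfolding mass_def by (rule nn_integral_cmult) measurable
  finally show ?thesis .
qed

section \<open>Boundary values almost everywhere\<close>

text \<open>
  The kernel is a superposition of indicators of centred intervals; this is how averages over
  intervals control Poisson averages.
\<close>

lemma poisson_kernel_layer_cake:
  assumes y: "y > 0"
  shows "ennreal (poisson_kernel y u) =
    (\<integral>\<^sup>+r. ennreal (2 * y * r / (pi * (r\<^sup>2 + y\<^sup>2)\<^sup>2)) * indicator {\<bar>u\<bar>..} r \<partial>lborel)"
proof -
  have "(\<integral>\<^sup>+r. ennreal (2 * y * r / (pi * (r\<^sup>2 + y\<^sup>2)\<^sup>2)) * indicator {\<bar>u\<bar>..} r \<partial>lborel)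
      = ennreal (0 - (- poisson_kernel y \<bar>u\<bar>))"
  proof (rule nn_integral_FTC_atLeast)
    fix r assume r: "\<bar>u\<bar> \<le> r"
    have nz: "pi * (r\<^sup>2 + y\<^sup>2) \<noteq> 0" using y by (simp add: sum_power2_eq_zero_iff)
    show "((\<lambda>r. - poisson_kernel y r) has_real_derivative 2 * y * r / (pi * (r\<^sup>2 + y\<^sup>2)\<^sup>2)) (at r)"
    proof -
      have "((\<lambda>r. - (y / (pi * (r\<^sup>2 + y\<^sup>2)))) has_real_derivative
          y * (pi * (2 * r)) / ((pi * (r\<^sup>2 + y\<^sup>2)) * (pi * (r\<^sup>2 + y\<^sup>2)))) (at r)"
        using nz by (auto intro!: derivative_eq_intros)
      moreover have "y * (pi * (2 * r)) / ((pi * (r\<^sup>2 + y\<^sup>2)) * (pi * (r\<^sup>2 + y\<^sup>2)))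
          = 2 * y * r / (pi * (r\<^sup>2 + y\<^sup>2)\<^sup>2)" by (simp add: power2_eq_square mult_ac)
      ultimately show ?thesis unfolding poisson_kernel_def by simp
    qed
    show "0 \<le> 2 * y * r / (pi * (r\<^sup>2 + y\<^sup>2)\<^sup>2)" using r y by auto
  next
    have "((\<lambda>r. y / (pi * (r\<^sup>2 + y\<^sup>2))) \<longlongrightarrow> 0) at_top"
      by real_asymp
    then show "((\<lambda>r. - poisson_kernel y r) \<longlongrightarrow> 0) at_top"
      unfolding poisson_kernel_def using tendsto_minus by fastforce
  qed measurable
  then show ?thesis by (simp add: poisson_kernel_def)
qed

lemma nn_integral_poisson_layer:
  assumes y: "y > 0" and [measurable]: "H \<in> borel_measurable borel"
  shows "(\<integral>\<^sup>+t. ennreal (poisson_kernel y (x - t)) * H t \<partial>lborel) =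
    (\<integral>\<^sup>+r. ennreal (2 * y * r / (pi * (r\<^sup>2 + y\<^sup>2)\<^sup>2)) * indicator {0..} r *
        (\<integral>\<^sup>+t. H t * indicator {x - r..x + r} t \<partial>lborel) \<partial>lborel)"
proof -
  let ?m = "\<lambda>r. ennreal (2 * y * r / (pi * (r\<^sup>2 + y\<^sup>2)\<^sup>2))"
  have "(\<integral>\<^sup>+t. ennreal (poisson_kernel y (x - t)) * H t \<partial>lborel) =
     (\<integral>\<^sup>+t. \<integral>\<^sup>+r. (if \<bar>x - t\<bar> \<le> r then ?m r * H t else 0) \<partial>lborel \<partial>lborel)"
    unfolding poisson_kernel_layer_cake[OF y]
    by (subst nn_integral_multc[symmetric])
       (auto intro!: nn_integral_cong simp: indicator_def)
  also have "\<dots> = (\<integral>\<^sup>+r. \<integral>\<^sup>+t. (if \<bar>x - t\<bar> \<le> r then ?m r * H t else 0) \<partial>lborel \<partial>lborel)"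
    by (rule nn_integral_swap) measurable
  also have "\<dots> = (\<integral>\<^sup>+r. \<integral>\<^sup>+t. ?m r * indicator {0..} r * (H t * indicator {x - r..x + r} t) \<partial>lborel \<partial>lborel)"
    by (intro nn_integral_cong) (auto simp: indicator_def)
  also have "\<dots> = (\<integral>\<^sup>+r. ?m r * indicator {0..} r * (\<integral>\<^sup>+t. H t * indicator {x - r..x + r} t \<partial>lborel) \<partial>lborel)"
    by (intro nn_integral_cong nn_integral_cmult) measurable
  finally show ?thesis .
qed

lemma poisson_average_le:
  assumes y: "y > 0" and [measurable]: "H \<in> borel_measurable borel"
    and W: "\<And>r. r > 0 \<Longrightarrow> (\<integral>\<^sup>+t. H t * indicator {x - r..x + r} t \<partial>lborel) \<le> A * ennreal (2 * r)"
  shows "(\<integral>\<^sup>+t. ennreal (poisson_kernel y (x - t)) * H t \<partial>lborel) \<le> A"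
proof -
  let ?m = "\<lambda>r. ennreal (2 * y * r / (pi * (r\<^sup>2 + y\<^sup>2)\<^sup>2))"
  have one: "(\<integral>\<^sup>+t. ennreal (poisson_kernel y (x - t)) * 1 \<partial>lborel) = 1"
    using nn_integral_reflect_shift[of "\<lambda>t. ennreal (poisson_kernel y t)" x]
      nn_integral_poisson_kernel[OF y] by simp
  have "(\<integral>\<^sup>+t. ennreal (poisson_kernel y (x - t)) * H t \<partial>lborel) =
    (\<integral>\<^sup>+r. ?m r * indicator {0..} r * (\<integral>\<^sup>+t. H t * indicator {x - r..x + r} t \<partial>lborel) \<partial>lborel)"
    by (rule nn_integral_poisson_layer[OF y]) measurable
  also have "\<dots> \<le> (\<integral>\<^sup>+r. A * (?m r * indicator {0..} r * ennreal (2 * r)) \<partial>lborel)"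
  proof (rule nn_integral_mono)
    fix r :: real
    show "?m r * indicator {0..} r * (\<integral>\<^sup>+t. H t * indicator {x - r..x + r} t \<partial>lborel)
       \<le> A * (?m r * indicator {0..} r * ennreal (2 * r))"
    proof (cases "r > 0")
      case True
      then show ?thesis using mult_left_mono[OF W[OF True], of "?m r * indicator {0..} r"]
        by (simp add: mult_ac)
    qed (cases "r = 0"; simp)
  qed
  also have "\<dots> = A * (\<integral>\<^sup>+r. ?m r * indicator {0..} r * ennreal (2 * r) \<partial>lborel)"
    by (rule nn_integral_cmult) measurable
  also have "(\<integral>\<^sup>+r. ?m r * indicator {0..} r * ennreal (2 * r) \<partial>lborel)
     = (\<integral>\<^sup>+r. ?m r * indicator {0..} r * (\<integral>\<^sup>+t. 1 * indicator {x - r..x + r} t \<partial>lborel) \<partial>lborel)"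
  proof (intro nn_integral_cong)
    fix r :: real
    have "(\<integral>\<^sup>+t. 1 * indicator {x - r..x + r} t \<partial>lborel) = ennreal (2 * r)" if "r \<ge> 0"
      using that by simp
    then show "?m r * indicator {0..} r * ennreal (2 * r) =
        ?m r * indicator {0..} r * (\<integral>\<^sup>+t. 1 * indicator {x - r..x + r} t \<partial>lborel)"
      by (cases "r \<ge> 0") (simp_all only: indicator_simps atLeast_iff mult_zero_right mult_zero_left not_le)
  qed
  also have "\<dots> = 1"
    by (subst nn_integral_poisson_layer[OF y, symmetric]) (use one in auto)
  finally show ?thesis by simp
qed

text \<open>
  One-sided Lebesgue differentiation; applied to \<open>h\<close> and to its reflection it
  controls centred averages.
\<close>

lemma right_average_limit:
  fixes h :: "real \<Rightarrow> real"
  assumes h: "\<And>a b. h integrable_on {a..b}"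
  shows "AE x in lborel. \<forall>e>0. \<exists>d>0. \<forall>r. 0 < r \<and> r < d \<longrightarrow> \<bar>integral {x..x + r} h / r - h x\<bar> < e"
proof (rule integrable_ccontinuous_explicit[of h])
  show "h integrable_on cbox a b" for a b using h by simp
  fix N assume N: "negligible N"
    and *: "\<And>x e. x \<notin> N \<Longrightarrow> 0 < e \<Longrightarrow> \<exists>d>0. \<forall>r. 0 < r \<and> r < d \<longrightarrow>
        norm (integral (cbox x (x + r *\<^sub>R One)) h /\<^sub>R r ^ DIM(real) - h x) < e"
  have "N \<in> null_sets lebesgue" using N by (simp add: negligible_iff_null_sets)
  then have "AE x in lebesgue. x \<notin> N" by (rule AE_not_in)
  then have "AE x in lborel. x \<notin> N" by (simp add: AE_completion_iff)
  have eq: "norm (integral (cbox x (x + r *\<^sub>R One)) h /\<^sub>R r ^ DIM(real) - h x) = \<bar>integral {x..x + r} h / r - h x\<bar>" for x r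
    by (simp add: divide_inverse_commute)
  have lim: "\<And>x e. x \<notin> N \<Longrightarrow> 0 < e \<Longrightarrow> \<exists>d>0. \<forall>r. 0 < r \<and> r < d \<longrightarrow> \<bar>integral {x..x + r} h / r - h x\<bar> < e"
    using * unfolding eq .
  from \<open>AE x in lborel. x \<notin> N\<close> show ?thesis
  proof eventually_elim
    case (elim x)
    show ?case
    proof (intro allI impI)
      fix e :: real assume "e > 0"
      then show "\<exists>d>0. \<forall>r. 0 < r \<and> r < d \<longrightarrow> \<bar>integral {x..x + r} h / r - h x\<bar> < e"
        by (rule lim[OF elim])
    qed
  qed
qed

text \<open>
  Upper bounds suffice, since this is applied to \<open>\<bar>g - c\<bar>\<close> for constants
  \<open>c\<close>. Within a small distance \<open>d\<close> of \<open>x\<close> all interval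
  averages are close to \<open>h x\<close>; the part of the integral beyond \<open>d\<close> is
  \<open>O(y)\<close>.
\<close>

lemma poisson_upper_limit_AE:
  fixes h :: "real \<Rightarrow> real"
  assumes [measurable]: "h \<in> borel_measurable borel" and h0: "\<And>t. h t \<ge> 0"
    and int: "integrable lborel (\<lambda>t. h t / (1 + t\<^sup>2))"
  shows "AE x in lborel. \<forall>e>0. \<forall>\<^sub>F y in at_right 0.
    (\<integral>\<^sup>+t. ennreal (poisson_kernel y (x - t) * h t) \<partial>lborel) \<le> ennreal (h x + e)"
proof -
  have loc: "set_integrable lborel {a..b} h" for a b
  proof -
    have "integrable lborel (\<lambda>t. (1 + (max \<bar>a\<bar> \<bar>b\<bar>)\<^sup>2) * (h t / (1 + t\<^sup>2)))"
      by (intro integrable_mult_right int)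
    then show ?thesis unfolding set_integrable_def
    proof (rule Bochner_Integration.integrable_bound, measurable, intro AE_I2)
      fix t
      show "norm (indicator {a..b} t *\<^sub>R h t) \<le> norm ((1 + (max \<bar>a\<bar> \<bar>b\<bar>)\<^sup>2) * (h t / (1 + t\<^sup>2)))"
      proof (cases "t \<in> {a..b}")
        case True
        then have "\<bar>t\<bar> \<le> max \<bar>a\<bar> \<bar>b\<bar>" by auto
        then have "\<bar>t\<bar>\<^sup>2 \<le> (max \<bar>a\<bar> \<bar>b\<bar>)\<^sup>2" by (rule power_mono) simp
        then have "h t * (1 + t\<^sup>2) \<le> h t * (1 + (max \<bar>a\<bar> \<bar>b\<bar>)\<^sup>2)"
          by (intro mult_left_mono h0) auto
        moreover have "1 + t\<^sup>2 > 0" by (smt (verit) zero_le_power2)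
        ultimately have "h t \<le> (1 + (max \<bar>a\<bar> \<bar>b\<bar>)\<^sup>2) * (h t / (1 + t\<^sup>2))"
          by (simp add: field_simps)
        then show ?thesis using True h0[of t] by simp
      qed auto
    qed
  qed
  have loc': "set_integrable lborel {a..b} (\<lambda>t. h (- t))" for a b
  proof -
    have "integrable lborel (\<lambda>t. indicator {-b..-a} (0 + (-1) * t) *\<^sub>R h (0 + (-1) * t))"
      using loc[of "-b" "-a"] unfolding set_integrable_def by (rule lborel_integrable_real_affine) simp
    then show ?thesis unfolding set_integrable_def
      by (rule Bochner_Integration.integrable_bound) (auto simp: indicator_def)
  qed
  have hk: "f integrable_on cbox a b" if "\<And>a b. set_integrable lborel {a..b} f" for f :: "real \<Rightarrow> real" and a b
    using set_borel_integral_eq_integral(1)[OF that[of a b]] by simp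
  let ?R = "\<lambda>f x. \<forall>e>0. \<exists>d>0. \<forall>r. 0 < r \<and> r < d \<longrightarrow> \<bar>integral {x..x + r} f / r - f x\<bar> < (e::real)"
  have AE1: "AE x in lborel. ?R h x"
    by (rule right_average_limit) (use hk[OF loc] in simp)
  have AE2': "AE x in lborel. ?R (\<lambda>t. h (- t)) x"
    by (rule right_average_limit) (use hk[OF loc'] in simp)
  have AE2: "AE x in lborel. ?R (\<lambda>t. h (- t)) (- x)"
  proof -
    have "AE x in distr lborel borel uminus. ?R (\<lambda>t. h (- t)) x"
      using AE2' by (simp only: lborel_distr_uminus)
    then show ?thesis
      by (rule AE_distrD[rotated]) simp
  qed
  have nn: "(\<integral>\<^sup>+t. ennreal (f t) * indicator {a..b} t \<partial>lborel) = ennreal (integral {a..b} f)"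
    if si: "set_integrable lborel {a..b} f" and "\<And>t. f t \<ge> 0" for f :: "real \<Rightarrow> real" and a b
  proof -
    have "(\<integral>\<^sup>+t. ennreal (f t) * indicator {a..b} t \<partial>lborel) = (\<integral>\<^sup>+t. ennreal (indicator {a..b} t *\<^sub>R f t) \<partial>lborel)"
      by (intro nn_integral_cong) (auto simp: indicator_def)
    also have "\<dots> = ennreal (LINT t:{a..b}|lborel. f t)"
      unfolding set_lebesgue_integral_def using si that(2)
      by (intro nn_integral_eq_integral) (auto simp: set_integrable_def)
    also have "(LINT t:{a..b}|lborel. f t) = integral {a..b} f"
      by (rule set_borel_integral_eq_integral(2)[OF si])
    finally show ?thesis .
  qed
  have key: "\<forall>\<^sub>F y in at_right 0. (\<integral>\<^sup>+t. ennreal (poisson_kernel y (x - t) * h t) \<partial>lborel) \<le> ennreal (h x + e)"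
    if x: "?R h x" "?R (\<lambda>t. h (- t)) (- x)" and e: "e > 0" for x e
  proof -
    have e2: "e / 2 > 0" using e by simp
    obtain d1 where d1: "d1 > 0" "\<forall>r. 0 < r \<and> r < d1 \<longrightarrow> \<bar>integral {x..x + r} h / r - h x\<bar> < e / 2"
      using x(1)[rule_format, OF e2] by blast
    obtain d2 where d2: "d2 > 0" "\<forall>r. 0 < r \<and> r < d2 \<longrightarrow>
        \<bar>integral {- x.. - x + r} (\<lambda>t. h (- t)) / r - h (- (- x))\<bar> < e / 2"
      using x(2)[rule_format, OF e2] by blast
    define d where "d = min d1 d2 / 2"
    have d: "d > 0" "d < d1" "d < d2" using d1 d2 by (auto simp: d_def)
    have W: "(\<integral>\<^sup>+t. ennreal (h t) * indicator {x - r..x + r} t \<partial>lborel) \<le> ennreal (h x + e / 2) * ennreal (2 * r)"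
      if r: "r > 0" "r \<le> d" for r
    proof -
      have i1: "integral {x..x + r} h \<le> (h x + e / 2) * r"
      proof -
        have "\<bar>integral {x..x + r} h / r - h x\<bar> < e / 2" using d1(2) r d by auto
        then have "integral {x..x + r} h / r < h x + e / 2" by linarith
        then show ?thesis using r by (simp add: pos_divide_less_eq)
      qed
      have i2: "integral {- x.. - x + r} (\<lambda>t. h (- t)) \<le> (h x + e / 2) * r"
      proof -
        have "\<bar>integral {- x..- x + r} (\<lambda>t. h (- t)) / r - h (- (- x))\<bar> < e / 2" using d2(2) r d by auto
        then have "integral {- x..- x + r} (\<lambda>t. h (- t)) / r < h x + e / 2"
          unfolding minus_minus by linarith
        then show ?thesis using r by (simp add: pos_divide_less_eq)
      qed
      have "(\<integral>\<^sup>+t. ennreal (h t) * indicator {x - r..x + r} t \<partial>lborel)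
         \<le> (\<integral>\<^sup>+t. ennreal (h t) * indicator {x..x + r} t + ennreal (h t) * indicator {x - r..x} t \<partial>lborel)"
        by (intro nn_integral_mono) (auto simp: indicator_def)
      also have "\<dots> = (\<integral>\<^sup>+t. ennreal (h t) * indicator {x..x + r} t \<partial>lborel) + (\<integral>\<^sup>+t. ennreal (h t) * indicator {x - r..x} t \<partial>lborel)"
        by (rule nn_integral_add) measurable
      also have "(\<integral>\<^sup>+t. ennreal (h t) * indicator {x - r..x} t \<partial>lborel)
          = (\<integral>\<^sup>+t. ennreal (h (- t)) * indicator {- x.. - x + r} t \<partial>lborel)"
        using nn_integral_real_affine[of "\<lambda>t. ennreal (h t) * indicator {x - r..x} t" "-1" 0]
        by (auto intro!: nn_integral_cong simp: indicator_def)
      also have "(\<integral>\<^sup>+t. ennreal (h t) * indicator {x..x + r} t \<partial>lborel) + \<dots>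
         = ennreal (integral {x..x + r} h) + ennreal (integral {- x.. - x + r} (\<lambda>t. h (- t)))"
        using nn[OF loc h0] nn[OF loc' h0] by simp
      also have "\<dots> \<le> ennreal ((h x + e / 2) * r) + ennreal ((h x + e / 2) * r)"
        using i1 i2 by (intro add_mono ennreal_leI)
      also have "\<dots> = ennreal ((h x + e / 2) * r + (h x + e / 2) * r)"
        using r e h0[of x] by (intro ennreal_plus[symmetric]) auto
      also have "(h x + e / 2) * r + (h x + e / 2) * r = (h x + e / 2) * (2 * r)" by simp
      finally show ?thesis using r e h0[of x] by (simp add: ennreal_mult)
    qed
    let ?H = "\<lambda>t. ennreal (h t) * indicator {x - d..x + d} t"
    have near: "(\<integral>\<^sup>+t. ennreal (poisson_kernel y (x - t)) * ?H t \<partial>lborel) \<le> ennreal (h x + e / 2)"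
      if y: "y > 0" for y
    proof (rule poisson_average_le[OF y])
      fix r :: real assume r: "r > 0"
      have "(\<integral>\<^sup>+t. ?H t * indicator {x - r..x + r} t \<partial>lborel)
         \<le> (\<integral>\<^sup>+t. ennreal (h t) * indicator {x - min r d..x + min r d} t \<partial>lborel)"
        by (intro nn_integral_mono) (auto simp: indicator_def)
      also have "\<dots> \<le> ennreal (h x + e / 2) * ennreal (2 * min r d)"
        by (rule W) (use r d in auto)
      also have "\<dots> \<le> ennreal (h x + e / 2) * ennreal (2 * r)"
        by (intro mult_left_mono ennreal_leI) auto
      finally show "(\<integral>\<^sup>+t. ?H t * indicator {x - r..x + r} t \<partial>lborel) \<le> ennreal (h x + e / 2) * ennreal (2 * r)" .
    qed measurable
    define C where "C = (2 * x\<^sup>2 + 1) / d\<^sup>2 + 2"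
    have C: "C \<ge> 0" using d by (simp add: C_def)
    define I where "I = (LINT t|lborel. h t / (1 + t\<^sup>2))"
    have I0: "I \<ge> 0" unfolding I_def using h0 by (intro integral_nonneg_AE) auto
    have far: "(\<integral>\<^sup>+t. ennreal (poisson_kernel y (x - t) * h t) * indicator (- {x - d..x + d}) t \<partial>lborel) \<le> ennreal (y * C / pi * I)"
      if y: "y > 0" for y
    proof -
      have "(\<integral>\<^sup>+t. ennreal (poisson_kernel y (x - t) * h t) * indicator (- {x - d..x + d}) t \<partial>lborel)
         \<le> (\<integral>\<^sup>+t. ennreal (y * C / pi * (h t / (1 + t\<^sup>2))) \<partial>lborel)"
      proof (intro nn_integral_mono)
        fix t
        show "ennreal (poisson_kernel y (x - t) * h t) * indicator (- {x - d..x + d}) t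
           \<le> ennreal (y * C / pi * (h t / (1 + t\<^sup>2)))"
        proof (cases "t \<in> {x - d..x + d}")
          case False
          then have "\<bar>x - t\<bar> \<ge> d" by auto
          then have "\<bar>x - t\<bar>\<^sup>2 \<ge> d\<^sup>2" using d by (intro power_mono) auto
          then have dd: "(x - t)\<^sup>2 \<ge> d\<^sup>2" by simp
          have pos: "(x - t)\<^sup>2 > 0" using dd d by (smt (verit) zero_less_power2)
          have t1: "1 + t\<^sup>2 > 0" by (smt (verit) zero_le_power2)
          have "t\<^sup>2 \<le> 2 * x\<^sup>2 + 2 * (x - t)\<^sup>2"
            by (smt (verit, best) power2_diff sum_squares_bound power2_sum zero_le_power2)
          then have "1 + t\<^sup>2 \<le> (2 * x\<^sup>2 + 1) * 1 + 2 * (x - t)\<^sup>2" by simp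
          also have "\<dots> \<le> (2 * x\<^sup>2 + 1) * ((x - t)\<^sup>2 / d\<^sup>2) + 2 * (x - t)\<^sup>2"
            using dd d by (intro add_right_mono mult_left_mono) (auto simp: field_simps)
          also have "\<dots> = C * (x - t)\<^sup>2" by (simp add: C_def algebra_simps)
          finally have "1 + t\<^sup>2 \<le> C * (x - t)\<^sup>2" .
          then have q: "1 / (x - t)\<^sup>2 \<le> C / (1 + t\<^sup>2)" using pos t1 by (simp add: field_simps)
          have "poisson_kernel y (x - t) \<le> y / (pi * (x - t)\<^sup>2)"
            unfolding poisson_kernel_def using y pos
            by (intro divide_left_mono mult_left_mono mult_pos_pos) (auto intro: add_pos_nonneg)
          also have "\<dots> = y / pi * (1 / (x - t)\<^sup>2)" by simp
          also have "\<dots> \<le> y / pi * (C / (1 + t\<^sup>2))" using q y by (intro mult_left_mono) auto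
          finally have "poisson_kernel y (x - t) * h t \<le> y / pi * (C / (1 + t\<^sup>2)) * h t"
            by (rule mult_right_mono) (rule h0)
          then have "poisson_kernel y (x - t) * h t \<le> y * C / pi * (h t / (1 + t\<^sup>2))"
            by (simp add: field_simps)
          then show ?thesis using False by (simp add: ennreal_leI)
        qed auto
      qed
      also have "\<dots> = ennreal (LINT t|lborel. y * C / pi * (h t / (1 + t\<^sup>2)))"
        using y C h0 int by (intro nn_integral_eq_integral integrable_mult_right AE_I2 mult_nonneg_nonneg divide_nonneg_nonneg) auto
      finally show ?thesis unfolding I_def by (subst (asm) integral_mult_right_zero)
    qed
    have tend: "((\<lambda>y. y * C / pi * I) \<longlongrightarrow> 0 * C / pi * I) (at_right 0)"
      by (intro tendsto_intros) auto
    have "\<forall>\<^sub>F y in at_right 0. y * C / pi * I < e / 2"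
      using order_tendstoD(2)[OF tend, of "e / 2"] e by simp
    moreover have "\<forall>\<^sub>F y::real in at_right 0. y > 0" by (simp add: eventually_at_right_less)
    ultimately show ?thesis
    proof eventually_elim
      case (elim y)
      have "(\<integral>\<^sup>+t. ennreal (poisson_kernel y (x - t) * h t) \<partial>lborel)
        = (\<integral>\<^sup>+t. ennreal (poisson_kernel y (x - t)) * ?H t + ennreal (poisson_kernel y (x - t) * h t) * indicator (- {x - d..x + d}) t \<partial>lborel)"
        using elim h0 by (intro nn_integral_cong) (auto simp: indicator_def ennreal_mult)
      also have "\<dots> = (\<integral>\<^sup>+t. ennreal (poisson_kernel y (x - t)) * ?H t \<partial>lborel) + (\<integral>\<^sup>+t. ennreal (poisson_kernel y (x - t) * h t) * indicator (- {x - d..x + d}) t \<partial>lborel)"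
        by (rule nn_integral_add) measurable
      also have "\<dots> \<le> ennreal (h x + e / 2) + ennreal (y * C / pi * I)"
        by (intro add_mono near far elim)
      also have "\<dots> \<le> ennreal (h x + e / 2) + ennreal (e / 2)"
        using elim by (intro add_left_mono ennreal_leI) auto
      also have "\<dots> = ennreal (h x + e)" using h0[of x] e by (simp flip: ennreal_plus)
      finally show ?case .
    qed
  qed
  from AE1 AE2 show ?thesis
  proof eventually_elim
    case (elim x)
    then show ?case using key by blast
  qed
qed

text \<open>
  Lebesgue points, with Poisson means in place of means over intervals.
\<close>

definition poisson_point :: "(real \<Rightarrow> complex) \<Rightarrow> real \<Rightarrow> bool" where
  "poisson_point g x \<longleftrightarrow> (\<forall>e>0. \<forall>\<^sub>F y in at_right 0.
    (\<integral>\<^sup>+t. ennreal (poisson_kernel y (x - t) * norm (g t - g x)) \<partial>lborel) \<le> ennreal e)"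

text \<open>
  By the triangle inequality it suffices to treat \<open>\<bar>g - c\<bar>\<close> for
  \<open>c\<close> in a countable dense set.
\<close>

lemma poisson_point_AE:
  assumes g: "tame g"
  shows "AE x in lborel. poisson_point g x"
proof -
  note [measurable] = tame_measurable[OF g]
  obtain D :: "complex set" where D: "countable D" "\<And>X. open X \<Longrightarrow> X \<noteq> {} \<Longrightarrow> \<exists>d\<in>D. d \<in> X"
    by (rule countable_dense_setE) blast
  have "AE x in lborel. \<forall>e>0. \<forall>\<^sub>F y in at_right 0.
    (\<integral>\<^sup>+t. ennreal (poisson_kernel y (x - t) * norm (g t - c)) \<partial>lborel) \<le> ennreal (norm (g x - c) + e)" for c
  proof (rule poisson_upper_limit_AE)
    have "integrable lborel (\<lambda>t. 2 * (norm (g t) / (1 + \<bar>t\<bar>)) + norm c * inverse (1 + t\<^sup>2))"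
      using g by (intro Bochner_Integration.integrable_add integrable_mult_right inverse_1_plus_square) (auto simp: tame_def)
    then show "integrable lborel (\<lambda>t. norm (g t - c) / (1 + t\<^sup>2))"
    proof (rule Bochner_Integration.integrable_bound, measurable, intro AE_I2)
      fix t :: real
      have t1: "1 + t\<^sup>2 > 0" by (smt (verit) zero_le_power2)
      have "\<bar>t\<bar> \<le> 1 + t\<^sup>2" using sum_squares_bound[of 1 "\<bar>t\<bar>"] by simp
      then have "1 + \<bar>t\<bar> \<le> 2 * (1 + t\<^sup>2)" by (smt (verit) zero_le_power2)
      then have "1 / (1 + t\<^sup>2) \<le> 2 / (1 + \<bar>t\<bar>)" using t1 by (simp add: field_simps)
      then have a: "norm (g t) * (1 / (1 + t\<^sup>2)) \<le> norm (g t) * (2 / (1 + \<bar>t\<bar>))" by (rule mult_left_mono) simp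
      have "norm (g t - c) / (1 + t\<^sup>2) \<le> (norm (g t) + norm c) / (1 + t\<^sup>2)"
        using t1 by (intro divide_right_mono norm_triangle_ineq4) auto
      also have "\<dots> \<le> 2 * (norm (g t) / (1 + \<bar>t\<bar>)) + norm c * inverse (1 + t\<^sup>2)"
        using a by (simp add: add_divide_distrib divide_inverse mult_ac distrib_right)
      finally show "norm (norm (g t - c) / (1 + t\<^sup>2)) \<le> norm (2 * (norm (g t) / (1 + \<bar>t\<bar>)) + norm c * inverse (1 + t\<^sup>2))"
        using t1 by (auto intro: order_trans[OF _ abs_ge_self])
    qed
  qed auto
  then have "AE x in lborel. \<forall>c\<in>D. \<forall>e>0. \<forall>\<^sub>F y in at_right 0.
    (\<integral>\<^sup>+t. ennreal (poisson_kernel y (x - t) * norm (g t - c)) \<partial>lborel) \<le> ennreal (norm (g x - c) + e)"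
    using D(1) by (simp add: AE_ball_countable)
  then show ?thesis
  proof eventually_elim
    case (elim x)
    show ?case unfolding poisson_point_def
    proof (intro allI impI)
      fix e :: real assume e: "e > 0"
      then obtain c where c: "c \<in> D" "c \<in> ball (g x) (e / 3)"
        using D(2)[of "ball (g x) (e / 3)"] by auto
      then have gc: "norm (g x - c) < e / 3" by (simp add: dist_norm)
      have e3: "e / 3 > 0" using e by simp
      have "\<forall>\<^sub>F y in at_right 0. (\<integral>\<^sup>+t. ennreal (poisson_kernel y (x - t) * norm (g t - c)) \<partial>lborel) \<le> ennreal (norm (g x - c) + e / 3)"
        using elim c(1) e3 by blast
      moreover have "\<forall>\<^sub>F y::real in at_right 0. y > 0" by (simp add: eventually_at_right_less)
      ultimately show "\<forall>\<^sub>F y in at_right 0. (\<integral>\<^sup>+t. ennreal (poisson_kernel y (x - t) * norm (g t - g x)) \<partial>lborel) \<le> ennreal e"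
      proof eventually_elim
        case (elim y)
        have "(\<integral>\<^sup>+t. ennreal (poisson_kernel y (x - t) * norm (g t - g x)) \<partial>lborel)
           \<le> (\<integral>\<^sup>+t. ennreal (poisson_kernel y (x - t) * norm (g t - c)) + ennreal (norm (g x - c)) * ennreal (poisson_kernel y (x - t)) \<partial>lborel)"
        proof (rule nn_integral_mono)
          fix t
          have "norm (g t - g x) \<le> norm (g t - c) + norm (g x - c)"
            using norm_triangle_ineq4[of "g t - c" "g x - c"] by simp
          then have "poisson_kernel y (x - t) * norm (g t - g x) \<le> poisson_kernel y (x - t) * (norm (g t - c) + norm (g x - c))"
            using elim by (intro mult_left_mono) auto
          then have "ennreal (poisson_kernel y (x - t) * norm (g t - g x))
              \<le> ennreal (poisson_kernel y (x - t) * norm (g t - c) + norm (g x - c) * poisson_kernel y (x - t))"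
            by (intro ennreal_leI) (simp add: algebra_simps)
          then show "ennreal (poisson_kernel y (x - t) * norm (g t - g x)) \<le> ennreal (poisson_kernel y (x - t) * norm (g t - c)) + ennreal (norm (g x - c)) * ennreal (poisson_kernel y (x - t))"
            using elim by (simp add: ennreal_mult)
        qed
        also have "\<dots> = (\<integral>\<^sup>+t. ennreal (poisson_kernel y (x - t) * norm (g t - c)) \<partial>lborel) + (\<integral>\<^sup>+t. ennreal (norm (g x - c)) * ennreal (poisson_kernel y (x - t)) \<partial>lborel)"
          by (rule nn_integral_add) measurable
        also have "(\<integral>\<^sup>+t. ennreal (norm (g x - c)) * ennreal (poisson_kernel y (x - t)) \<partial>lborel) = ennreal (norm (g x - c))"
          using elim nn_integral_reflect_shift[of "\<lambda>t. ennreal (poisson_kernel y t)" x] nn_integral_poisson_kernel[of y]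
          by (subst nn_integral_cmult) auto
        also have "(\<integral>\<^sup>+t. ennreal (poisson_kernel y (x - t) * norm (g t - c)) \<partial>lborel) + ennreal (norm (g x - c))
           \<le> ennreal (norm (g x - c) + e / 3) + ennreal (norm (g x - c))"
          by (rule add_right_mono[OF elim(1)])
        also have "\<dots> = ennreal (norm (g x - c) + e / 3 + norm (g x - c))" using e by (intro ennreal_plus[symmetric]) auto
        also have "\<dots> \<le> ennreal e" using gc by (intro ennreal_leI) auto
        finally show ?case .
      qed
    qed
  qed
qed

lemma poisson_point_tendsto:
  fixes F :: "real \<Rightarrow> complex"
  assumes x: "poisson_point g x"
    and F: "\<And>y. y > 0 \<Longrightarrow> ennreal (norm (F y)) \<le> (\<integral>\<^sup>+t. ennreal (poisson_kernel y (x - t) * norm (g t - g x)) \<partial>lborel)"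
  shows "(F \<longlongrightarrow> 0) (at_right 0)"
proof (rule tendstoI)
  fix e :: real assume e: "e > 0"
  then have "\<forall>\<^sub>F y in at_right 0. (\<integral>\<^sup>+t. ennreal (poisson_kernel y (x - t) * norm (g t - g x)) \<partial>lborel) \<le> ennreal (e / 2)"
    using x unfolding poisson_point_def by (meson half_gt_zero)
  moreover have "\<forall>\<^sub>F y::real in at_right 0. y > 0" by (simp add: eventually_at_right_less)
  ultimately show "\<forall>\<^sub>F y in at_right 0. dist (F y) 0 < e"
  proof eventually_elim
    case (elim y)
    from F[OF elim(2)] elim(1) have "ennreal (norm (F y)) \<le> ennreal (e / 2)" by (rule order_trans)
    then show ?case using e by simp
  qed
qed

text \<open>
  A kernel dominated by the Poisson kernel acts at a Poisson point like multiplication by its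
  total mass.
\<close>

lemma poisson_point_bound:
  fixes k :: "real \<Rightarrow> real"
  assumes g: "tame g" and y: "y > 0" and k: "\<And>u. \<bar>k u\<bar> \<le> poisson_kernel y u" and [measurable]: "k \<in> borel_measurable borel"
  shows "integrable lborel (\<lambda>t. of_real (k (x - t)) * g t)"
    "ennreal (norm ((LINT t|lborel. of_real (k (x - t)) * g t) - of_real (LINT t|lborel. k (x - t)) * g x))
      \<le> (\<integral>\<^sup>+t. ennreal (poisson_kernel y (x - t) * norm (g t - g x)) \<partial>lborel)"
proof -
  note [measurable] = tame_measurable[OF g]
  show 1: "integrable lborel (\<lambda>t. of_real (k (x - t)) * g t)"
  proof (rule Bochner_Integration.integrable_bound[OF integrable_poisson_kernel_norm[OF g y, of x]])
    show "AE t in lborel. norm (of_real (k (x - t)) * g t) \<le> norm (poisson_kernel y (x - t) * norm (g t))"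
      using k y by (intro AE_I2) (auto simp: norm_mult intro!: mult_right_mono)
  qed measurable
  have 2: "integrable lborel (\<lambda>t. k (x - t))"
    by (rule Bochner_Integration.integrable_bound[OF integrable_poisson_kernel_shift(1)[OF y, of x]])
       (use k y in auto)
  then have 3: "integrable lborel (\<lambda>t. of_real (k (x - t)) * g x)" by auto
  have "(LINT t|lborel. of_real (k (x - t)) * g t) - of_real (LINT t|lborel. k (x - t)) * g x
      = (LINT t|lborel. of_real (k (x - t)) * (g t - g x))"
    using 1 3 by (simp add: right_diff_distrib flip: integral_complex_of_real)
  also have "ennreal (norm \<dots>) \<le> (\<integral>\<^sup>+t. norm (of_real (k (x - t)) * (g t - g x)) \<partial>lborel)"
    using 1 3 by (intro integral_norm_bound_ennreal) (auto simp: right_diff_distrib)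
  also have "\<dots> \<le> (\<integral>\<^sup>+t. ennreal (poisson_kernel y (x - t) * norm (g t - g x)) \<partial>lborel)"
    using k by (intro nn_integral_mono ennreal_leI) (auto simp: norm_mult intro!: mult_right_mono)
  finally show "ennreal (norm ((LINT t|lborel. of_real (k (x - t)) * g t) - of_real (LINT t|lborel. k (x - t)) * g x))
      \<le> (\<integral>\<^sup>+t. ennreal (poisson_kernel y (x - t) * norm (g t - g x)) \<partial>lborel)" .
qed

lemma poisson_tendsto_boundary:
  assumes g: "tame g" and x: "poisson_point g x"
  shows "((\<lambda>y. poisson g (Complex x y)) \<longlongrightarrow> g x) (at_right 0)"
proof -
  have "((\<lambda>y. poisson g (Complex x y) - g x) \<longlongrightarrow> 0) (at_right 0)"
  proof (rule poisson_point_tendsto[OF x])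
    fix y :: real assume y: "y > 0"
    show "ennreal (norm (poisson g (Complex x y) - g x)) \<le> (\<integral>\<^sup>+t. ennreal (poisson_kernel y (x - t) * norm (g t - g x)) \<partial>lborel)"
      using poisson_point_bound(2)[OF g y, of "poisson_kernel y" x] y
      by (simp add: poisson_eq[OF g] integrable_poisson_kernel_shift(2)[OF y])
  qed
  then show ?thesis by (simp add: LIM_zero_iff)
qed

definition trunc_kernel :: "real \<Rightarrow> real \<Rightarrow> real" where
  "trunc_kernel y u = (if \<bar>u\<bar> > y then 1 / u else 0) / pi"

definition conj_kernel :: "real \<Rightarrow> real \<Rightarrow> real" where
  "conj_kernel y u = u / (pi * (u\<^sup>2 + y\<^sup>2))"

lemma kernel_measurable [measurable]:
  "trunc_kernel y \<in> borel_measurable borel" "conj_kernel y \<in> borel_measurable borel"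
  unfolding trunc_kernel_def[abs_def] conj_kernel_def[abs_def] by measurable

text \<open>
  This is why the truncated integrals and the conjugate Poisson integrals have the same boundary
  limits: the difference of their kernels is dominated by an approximate identity.
\<close>

lemma kernel_difference_bound:
  assumes y: "y > 0"
  shows "\<bar>conj_kernel y u - trunc_kernel y u\<bar> \<le> poisson_kernel y u"
proof (cases "\<bar>u\<bar> > y")
  case True
  then have u: "u \<noteq> 0" using y by auto
  have pos: "u\<^sup>2 + y\<^sup>2 > 0" using y by (simp add: sum_power2_gt_zero_iff)
  have "conj_kernel y u - trunc_kernel y u = - (y\<^sup>2 / (u * (pi * (u\<^sup>2 + y\<^sup>2))))"
    unfolding conj_kernel_def trunc_kernel_def using True pos u
    by (simp add: divide_simps) (simp add: algebra_simps power2_eq_square)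
  then have "\<bar>conj_kernel y u - trunc_kernel y u\<bar> = (y / \<bar>u\<bar>) * poisson_kernel y u"
    using pos y by (simp add: poisson_kernel_def abs_mult power2_eq_square)
  also have "\<dots> \<le> 1 * poisson_kernel y u"
    using True y by (intro mult_right_mono) auto
  finally show ?thesis by simp
next
  case False
  have pos: "u\<^sup>2 + y\<^sup>2 > 0" using y by (simp add: sum_power2_gt_zero_iff)
  have "\<bar>u\<bar> / (pi * (u\<^sup>2 + y\<^sup>2)) \<le> y / (pi * (u\<^sup>2 + y\<^sup>2))"
    using False pos by (intro divide_right_mono) auto
  then show ?thesis using False pos by (simp add: conj_kernel_def trunc_kernel_def poisson_kernel_def abs_mult)
qed

lemma conj_poisson_eq:
  "conj_poisson g (Complex x y) = (LINT t|lborel. of_real (conj_kernel y (x - t)) * g t)"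
  by (simp add: conj_poisson_def conj_kernel_def)

lemma integrable_conj_kernel_tame:
  assumes "tame g" "y > 0"
  shows "integrable lborel (\<lambda>t. of_real (conj_kernel y (x - t)) * g t)"
  using integrable_poisson_kernel_mult(2)[OF assms(1), of "Complex x y"] assms(2)
  by (simp add: conj_kernel_def)

lemma integrable_trunc_kernel_tame:
  assumes g: "tame g" and y: "y > 0"
  shows "integrable lborel (\<lambda>t. of_real (trunc_kernel y (x - t)) * g t)"
proof -
  have "integrable lborel (\<lambda>t. of_real (conj_kernel y (x - t)) * g t
      - of_real (conj_kernel y (x - t) - trunc_kernel y (x - t)) * g t)"
    by (intro Bochner_Integration.integrable_diff integrable_conj_kernel_tame
        poisson_point_bound(1)[OF g y, of "\<lambda>u. conj_kernel y u - trunc_kernel y u"] g y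
        kernel_difference_bound) measurable
  then show ?thesis by (simp add: algebra_simps)
qed

lemma hilbert_trunc_eq:
  assumes g: "tame g" and y: "y > 0"
  shows "hilbert_trunc g x y = (LINT t|lborel. of_real (trunc_kernel y (x - t)) * g t)"
proof -
  note [measurable] = tame_measurable[OF g]
  define J where "J = (\<lambda>s. of_real (trunc_kernel y (x - s)) * g s)"
  have [measurable]: "J \<in> borel_measurable borel" unfolding J_def by measurable
  have iJ: "integrable lborel J" unfolding J_def by (rule integrable_trunc_kernel_tame[OF g y])
  define J1 where "J1 = (\<lambda>s. indicator {x<..} s *\<^sub>R J s)"
  define J2 where "J2 = (\<lambda>s. indicator {..x} s *\<^sub>R J s)"
  have i1: "integrable lborel J1" and i2: "integrable lborel J2"
    unfolding J1_def J2_def using iJ by (auto intro!: integrable_mult_indicator)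
  have i1': "integrable lborel (\<lambda>t. J1 (x + 1 * t))" by (rule lborel_integrable_real_affine[OF i1]) simp
  have i2': "integrable lborel (\<lambda>t. J2 (x + (-1) * t))" by (rule lborel_integrable_real_affine[OF i2]) simp
  have "(LINT s|lborel. J s) = (LINT s|lborel. J1 s + J2 s)"
    by (intro Bochner_Integration.integral_cong) (auto simp: J1_def J2_def indicator_def)
  also have "\<dots> = (LINT s|lborel. J1 s) + (LINT s|lborel. J2 s)" using i1 i2 by simp
  also have "(LINT s|lborel. J1 s) = (LINT t|lborel. J1 (x + 1 * t))"
    using lborel_integral_real_affine[of 1 J1 x] by simp
  also have "(LINT s|lborel. J2 s) = (LINT t|lborel. J2 (x + (-1) * t))"
    using lborel_integral_real_affine[of "-1" J2 x] by simp
  also have "(LINT t|lborel. J1 (x + 1 * t)) + (LINT t|lborel. J2 (x + (-1) * t))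
     = (LINT t|lborel. J1 (x + 1 * t) + J2 (x + (-1) * t))" using i1' i2' by simp
  also have "\<dots> = (LINT t|lborel. - (1 / of_real pi) * (indicator {y<..} t *\<^sub>R ((g (x + t) - g (x - t)) / of_real t)))"
    by (intro Bochner_Integration.integral_cong)
       (use y in \<open>auto simp: J1_def J2_def J_def trunc_kernel_def indicator_def field_simps\<close>)
  also have "\<dots> = - (1 / of_real pi) * (LINT t|lborel. indicator {y<..} t *\<^sub>R ((g (x + t) - g (x - t)) / of_real t))"
    by (rule integral_mult_right_zero)
  also have "\<dots> = hilbert_trunc g x y"
    unfolding hilbert_trunc_def set_lebesgue_integral_def
    by (subst integral_completion) auto
  finally show ?thesis unfolding J_def by simp
qed

text \<open>
  The difference of the two kernels is odd, hence has total mass 0.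
\<close>

lemma conj_poisson_hilbert_trunc_tendsto:
  assumes g: "tame g" and x: "poisson_point g x"
  shows "((\<lambda>y. conj_poisson g (Complex x y) - hilbert_trunc g x y) \<longlongrightarrow> 0) (at_right 0)"
proof (rule poisson_point_tendsto[OF x])
  fix y :: real assume y: "y > 0"
  let ?k = "\<lambda>u. conj_kernel y u - trunc_kernel y u"
  have [measurable]: "?k \<in> borel_measurable borel" by measurable
  have odd: "?k (- u) = - ?k u" for u by (auto simp: conj_kernel_def trunc_kernel_def)
  have "(LINT u|lborel. ?k u) = (LINT u|lborel. ?k (- u))"
    using lborel_integral_real_affine[of "-1" ?k 0] by simp
  also have "\<dots> = (LINT u|lborel. - ?k u)" by (simp only: odd)
  also have "\<dots> = - (LINT u|lborel. ?k u)" by (rule integral_minus)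
  finally have "(LINT u|lborel. ?k u) = 0" by simp
  moreover have "(LINT t|lborel. ?k (x - t)) = (LINT u|lborel. ?k u)"
    using lborel_integral_real_affine[of "-1" ?k x] by simp
  ultimately have zero: "(LINT t|lborel. ?k (x - t)) = 0" by simp
  have "conj_poisson g (Complex x y) - hilbert_trunc g x y = (LINT t|lborel. of_real (?k (x - t)) * g t)"
    unfolding conj_poisson_eq hilbert_trunc_eq[OF g y]
    using integrable_conj_kernel_tame[OF g y, of x] integrable_trunc_kernel_tame[OF g y, of x]
    by (simp add: left_diff_distrib)
  then show "ennreal (norm (conj_poisson g (Complex x y) - hilbert_trunc g x y)) \<le>
     (\<integral>\<^sup>+t. ennreal (poisson_kernel y (x - t) * norm (g t - g x)) \<partial>lborel)"
    using poisson_point_bound(2)[OF g y, of ?k x] kernel_difference_bound[OF y] zero by simp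
qed

section \<open>A maximum principle in the half-plane\<close>

text \<open>
  Subharmonicity enters as touching from below: near every point some real part of a holomorphic
  function lies below \<open>w\<close> and agrees with it at the point. After subtracting a
  small multiple of \<open>ln \<bar>z + 2 \<i>\<bar>\<close> a positive maximum would be
  attained on a compact set; at a maximum point with least imaginary part the touching function
  is constant by the maximum modulus principle, so that \<open>w\<close> attains its maximum
  also at lower points.
\<close>

lemma half_plane_maximum_principle:
  fixes w :: "complex \<Rightarrow> real"
  assumes cont: "continuous_on {z. Im z \<ge> 0} w"
    and bdd: "\<And>z. Im z \<ge> 0 \<Longrightarrow> w z \<le> M"
    and bdry: "\<And>z. Im z = 0 \<Longrightarrow> w z \<le> 0"
    and touch: "\<And>z. Im z > 0 \<Longrightarrow> \<exists>r>0. \<exists>Q. Q holomorphic_on ball z r \<and> Re (Q z) = w z \<and>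
        (\<forall>v\<in>ball z r. Re (Q v) \<le> w v)"
    and z1: "Im z1 > 0"
  shows "w z1 \<le> 0"
proof (rule ccontr)
  assume "\<not> w z1 \<le> 0"
  then have pos: "w z1 > 0" by simp
  define L where "L = (\<lambda>z. ln (norm (z + 2 * \<i>)))"
  have n2: "norm (z + 2 * \<i>) \<ge> 2" if "Im z \<ge> 0" for z
    using abs_Im_le_cmod[of "z + 2 * \<i>"] that by simp
  have Lpos: "L z > 0" if "Im z \<ge> 0" for z
    using n2[OF that] unfolding L_def by (intro ln_gt_zero) linarith
  \<comment> \<open>This choice of \<open>e\<close> keeps the penalised function positive at
    \<open>z1\<close>.\<close>
  define e where "e = w z1 / (2 * L z1)"
  have e: "e > 0" using pos Lpos[of z1] z1 by (simp add: e_def)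
  define v where "v = (\<lambda>z. w z - e * L z)"
  have vz1: "v z1 > 0" using pos Lpos[of z1] z1 by (simp add: v_def e_def)
  define R where "R = max (norm (z1 + 2 * \<i>)) (exp (M / e))"
  define K where "K = {z. Im z \<ge> 0} \<inter> {z. norm (z + 2 * \<i>) \<le> R}"
  have out: "v z \<le> 0" if "Im z \<ge> 0" "z \<notin> K" for z
  proof -
    have "norm (z + 2 * \<i>) > exp (M / e)" using that by (auto simp: K_def R_def)
    then have "L z \<ge> M / e" unfolding L_def
      using n2[OF that(1)] by (subst ln_ge_iff) auto
    then have "e * L z \<ge> M" using e by (simp add: field_simps)
    then show ?thesis using bdd[OF that(1)] by (simp add: v_def)
  qed
  have "closed K" unfolding K_def
    by (intro closed_Int closed_halfspace_Im_ge closed_Collect_le continuous_intros)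
  moreover have "bounded K"
  proof (rule boundedI)
    fix z assume "z \<in> K"
    then show "norm z \<le> R + 2" using norm_triangle_ineq4[of "z + 2 * \<i>" "2 * \<i>"]
      by (auto simp: K_def norm_mult)
  qed
  ultimately have "compact K" by (simp add: compact_eq_bounded_closed)
  have z1K: "z1 \<in> K" using z1 by (auto simp: K_def R_def)
  have contv: "continuous_on K v" unfolding v_def L_def
    by (intro continuous_intros continuous_on_subset[OF cont]) (use n2 in \<open>force simp: K_def\<close>)+
  obtain z2 where z2: "z2 \<in> K" "\<And>z. z \<in> K \<Longrightarrow> v z \<le> v z2"
    using continuous_attains_sup[OF \<open>compact K\<close> _ contv] z1K by blast
  define m where "m = v z2"
  have m: "m > 0" using z2(2)[OF z1K] vz1 by (simp add: m_def)
  have le_m: "v z \<le> m" if "Im z \<ge> 0" for z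
    using z2(2)[of z] out[OF that] m by (cases "z \<in> K") (auto simp: m_def)
  define S where "S = {z \<in> K. v z = m}"
  have "compact S"
  proof -
    have "closedin (top_of_set K) (K \<inter> v -` {m})"
      by (intro continuous_closedin_preimage contv) auto
    moreover have "K \<inter> v -` {m} = S" by (auto simp: S_def)
    ultimately show ?thesis using \<open>compact K\<close> closedin_compact by metis
  qed
  moreover have "z2 \<in> S" using z2 by (simp add: S_def m_def)
  ultimately obtain z0 where z0: "z0 \<in> S" "\<And>z. z \<in> S \<Longrightarrow> Im z0 \<le> Im z"
    using continuous_attains_inf[OF \<open>compact S\<close> _ continuous_on_Im[OF continuous_on_id]] by blast
  have im0: "Im z0 > 0"
  proof (rule ccontr)
    assume "\<not> Im z0 > 0"
    then have "Im z0 = 0" using z0(1) by (auto simp: S_def K_def)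
    then have "v z0 \<le> 0" using bdry[of z0] Lpos[of z0] e by (simp add: v_def) (smt (verit) mult_pos_pos)
    then show False using z0(1) m by (simp add: S_def)
  qed
  from touch[OF im0] obtain r Q where r: "r > 0" and Q: "Q holomorphic_on ball z0 r" "Re (Q z0) = w z0"
    "\<And>u. u \<in> ball z0 r \<Longrightarrow> Re (Q u) \<le> w u" by blast
  define d where "d = min r (Im z0)"
  have d: "d > 0" "d \<le> r" "d \<le> Im z0" using r im0 by (auto simp: d_def)
  have imb: "Im u > 0" if "u \<in> ball z0 d" for u
    using that abs_Im_le_cmod[of "z0 - u"] d by (auto simp: dist_norm)
  define E where "E = (\<lambda>u. exp (Q u - of_real e * Ln (u + 2 * \<i>)))"
  have holE: "E holomorphic_on ball z0 d" unfolding E_def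
  proof (intro holomorphic_intros holomorphic_on_subset[OF Q(1)])
    show "ball z0 d \<subseteq> ball z0 r" using d by auto
    fix u assume "u \<in> ball z0 d"
    then show "u + 2 * \<i> \<notin> \<real>\<^sub>\<le>\<^sub>0" using imb[of u] by (auto simp: complex_nonpos_Reals_iff)
  qed
  have nE: "norm (E u) = exp (Re (Q u) - e * L u)" if "u \<in> ball z0 d" for u
  proof -
    have "u + 2 * \<i> \<noteq> 0" using n2[of u] imb[OF that] by force
    then show ?thesis by (simp add: E_def L_def)
  qed
  have z0b: "z0 \<in> ball z0 d" using d by simp
  have nE0: "norm (E z0) = exp m"
    unfolding nE[OF z0b] using z0(1) Q(2) by (simp add: S_def v_def)
  \<comment> \<open>\<open>\<bar>E\<bar>\<close> is the exponential of a function that lies below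
    \<open>v\<close> and touches it at \<open>z0\<close>.\<close>
  have "E constant_on ball z0 d"
  proof (rule maximum_modulus_principle[OF holE])
    fix u assume u: "u \<in> ball z0 d"
    have "Re (Q u) - e * L u \<le> v u" using Q(3)[of u] u d by (simp add: v_def)
    also have "\<dots> \<le> m" using imb[OF u] by (intro le_m) simp
    finally show "norm (E u) \<le> norm (E z0)" unfolding nE0 nE[OF u] by simp
  qed (use z0b in auto)
  define z' where "z' = z0 - \<i> * of_real (d / 2)"
  have z'b: "z' \<in> ball z0 d" using d by (simp add: z'_def dist_norm norm_mult)
  have "E z' = E z0" using \<open>E constant_on ball z0 d\<close> z'b z0b by (auto simp: constant_on_def)
  then have "Re (Q z') - e * L z' = m" using nE[OF z'b] nE0 by simp
  then have "v z' \<ge> m" using Q(3)[of z'] z'b d by (simp add: v_def)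
  then have "v z' = m" using le_m[of z'] imb[OF z'b] by simp
  then have "z' \<in> S" using out[of z'] imb[OF z'b] m by (auto simp: S_def)
  then have "Im z0 \<le> Im z'" by (rule z0(2))
  then show False using d by (simp add: z'_def)
qed

lemma half_plane_uniqueness:
  fixes w :: "complex \<Rightarrow> real"
  assumes cont: "continuous_on {z. Im z \<ge> 0} w"
    and bdd: "\<And>z. Im z \<ge> 0 \<Longrightarrow> \<bar>w z\<bar> \<le> M"
    and bdry: "\<And>z. Im z = 0 \<Longrightarrow> w z = 0"
    and Q: "Q holomorphic_on upper_half_plane" "\<And>z. Im z > 0 \<Longrightarrow> w z = Re (Q z)"
    and z: "Im z > 0"
  shows "w z = 0"
proof -
  have loc: "\<exists>r>0. ball z r \<subseteq> upper_half_plane" if "Im z > 0" for z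
    using open_upper_half_plane that by (auto simp: open_contains_ball upper_half_plane_def)
  have "w z \<le> 0"
  proof (rule half_plane_maximum_principle[OF cont _ _ _ z])
    show "w z \<le> M" if "Im z \<ge> 0" for z using bdd[OF that] by linarith
    show "w z \<le> 0" if "Im z = 0" for z using bdry[OF that] by simp
    fix z assume z: "Im z > 0"
    then obtain r where r: "r > 0" "ball z r \<subseteq> upper_half_plane" using loc by blast
    show "\<exists>r>0. \<exists>Q. Q holomorphic_on ball z r \<and> Re (Q z) = w z \<and> (\<forall>v\<in>ball z r. Re (Q v) \<le> w v)"
      using r Q z holomorphic_on_subset[OF Q(1) r(2)]
      by (intro exI[of _ r] conjI exI[of _ Q]) (auto simp: upper_half_plane_def)
  qed
  moreover have "- w z \<le> 0"
  proof (rule half_plane_maximum_principle[OF _ _ _ _ z, where w = "\<lambda>z. - w z"])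
    show "continuous_on {z. Im z \<ge> 0} (\<lambda>z. - w z)" by (intro continuous_intros cont)
    show "- w z \<le> M" if "Im z \<ge> 0" for z using bdd[OF that] by linarith
    show "- w z \<le> 0" if "Im z = 0" for z using bdry[OF that] by simp
    fix z assume z: "Im z > 0"
    then obtain r where r: "r > 0" "ball z r \<subseteq> upper_half_plane" using loc by blast
    have "(\<lambda>z. - Q z) holomorphic_on ball z r"
      by (intro holomorphic_intros holomorphic_on_subset[OF Q(1) r(2)])
    then show "\<exists>r>0. \<exists>Q. Q holomorphic_on ball z r \<and> Re (Q z) = - w z \<and> (\<forall>v\<in>ball z r. Re (Q v) \<le> - w v)"
      using r Q(2) z
      by (intro exI[of _ r] conjI exI[of _ "\<lambda>z. - Q z"]) (auto simp: upper_half_plane_def)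
  qed
  ultimately show ?thesis by simp
qed

section \<open>Poisson integrals of bounded continuous functions\<close>

text \<open>
  After the substitution \<open>t = Re z + Im z \<tau>\<close> the Poisson integral makes sense
  for \<open>Im z = 0\<close> too, and its continuity up to the boundary is dominated
  convergence.
\<close>

lemma poisson_continuous_extension:
  fixes h :: "real \<Rightarrow> complex"
  assumes cont: "continuous_on UNIV h" and M: "\<And>t. norm (h t) \<le> M"
  obtains P where "continuous_on UNIV P" "\<And>z. Im z > 0 \<Longrightarrow> P z = poisson h z"
    "\<And>z. Im z = 0 \<Longrightarrow> P z = h (Re z)" "\<And>z. norm (P z) \<le> M"
proof
  have [measurable]: "h \<in> borel_measurable borel" using cont by (rule borel_measurable_continuous_onI)
  let ?k = "\<lambda>t::real. 1 / pi * inverse (1 + t\<^sup>2)"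
  have ik: "integrable lborel ?k" by (intro integrable_mult_right inverse_1_plus_square)
  have k1: "(LINT t|lborel. ?k t) = 1"
    by (subst integral_mult_right_zero) (simp add: inverse_1_plus_square)
  have k0: "?k t \<ge> 0" for t by simp
  define P where "P = (\<lambda>z. LINT t|lborel. of_real (?k t) * h (Re z + Im z * t))"
  have ikM: "integrable lborel (\<lambda>t. ?k t * M)" using ik by (rule integrable_mult_left)
  have dom: "norm (of_real (?k t) * h s) \<le> ?k t * M" for t s
    unfolding norm_mult norm_of_real abs_of_nonneg[OF k0] by (intro mult_left_mono M k0)
  have int: "integrable lborel (\<lambda>t. of_real (?k t) * h (a + b * t))" for a b
  proof (rule Bochner_Integration.integrable_bound[OF ikM], measurable, intro AE_I2)
    fix t
    show "norm (of_real (?k t) * h (a + b * t)) \<le> norm (?k t * M)"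
      unfolding real_norm_def using dom[of t "a + b * t"] abs_ge_self[of "?k t * M"] by linarith
  qed
  show "continuous_on UNIV P"
    unfolding continuous_on_sequentially
  proof (intro allI ballI impI)
    fix X :: "nat \<Rightarrow> complex" and a
    assume "(\<forall>n. X n \<in> UNIV) \<and> X \<longlonglongrightarrow> a"
    then have X: "X \<longlonglongrightarrow> a" by simp
    show "(P \<circ> X) \<longlonglongrightarrow> P a"
      unfolding o_def P_def
    proof (rule integral_dominated_convergence[OF _ _ ikM])
      show "AE t in lborel. (\<lambda>n. of_real (?k t) * h (Re (X n) + Im (X n) * t)) \<longlonglongrightarrow> of_real (?k t) * h (Re a + Im a * t)"
      proof (intro AE_I2 tendsto_mult tendsto_const)
        fix t
        have "isCont h (Re a + Im a * t)" using cont by (simp add: continuous_on_eq_continuous_at)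
        then show "(\<lambda>n. h (Re (X n) + Im (X n) * t)) \<longlonglongrightarrow> h (Re a + Im a * t)"
          by (rule isCont_tendsto_compose) (intro tendsto_intros X)
      qed
    qed (use dom in auto)
  qed
  show "P z = poisson h z" if z: "Im z > 0" for z
  proof -
    have "poisson h z = (LINT t|lborel. of_real (poisson_kernel (Im z) (Re z - t)) * h t)"
      by (simp add: poisson_borel poisson_kernel_def)
    also have "\<dots> = \<bar>Im z\<bar> *\<^sub>R (LINT t|lborel. of_real (poisson_kernel (Im z) (Re z - (Re z + Im z * t))) * h (Re z + Im z * t))"
      using z by (intro lborel_integral_real_affine) auto
    also have "\<dots> = (LINT t|lborel. \<bar>Im z\<bar> *\<^sub>R (of_real (poisson_kernel (Im z) (Re z - (Re z + Im z * t))) * h (Re z + Im z * t)))"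
      by simp
    also have "\<dots> = P z"
      unfolding P_def
    proof (intro Bochner_Integration.integral_cong refl)
      fix t
      have "Im z * poisson_kernel (Im z) (Re z - (Re z + Im z * t)) = ?k t"
        using poisson_kernel_scale[OF z, of t] by simp
      then have "of_real (Im z * poisson_kernel (Im z) (Re z - (Re z + Im z * t))) * h (Re z + Im z * t)
         = of_real (?k t) * h (Re z + Im z * t)" by (simp only:)
      then show "\<bar>Im z\<bar> *\<^sub>R (of_real (poisson_kernel (Im z) (Re z - (Re z + Im z * t))) * h (Re z + Im z * t))
         = of_real (?k t) * h (Re z + Im z * t)"
        by (simp only: scaleR_conv_of_real of_real_mult mult.assoc abs_of_pos[OF z])
    qed
    finally show ?thesis by simp
  qed
  show "P z = h (Re z)" if "Im z = 0" for z
  proof -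
    have "P z = (LINT t|lborel. of_real (?k t) * h (Re z))" unfolding P_def using that by simp
    also have "\<dots> = of_real (LINT t|lborel. ?k t) * h (Re z)"
      by (subst integral_mult_left_zero) (simp only: integral_complex_of_real)
    finally show ?thesis using k1 by simp
  qed
  show "norm (P z) \<le> M" for z
  proof -
    have "norm (P z) \<le> (LINT t|lborel. ?k t * M)"
      unfolding P_def by (intro Bochner_Integration.integral_norm_bound_integral int ikM dom)
    also have "\<dots> = (LINT t|lborel. ?k t) * M" by (rule integral_mult_left_zero)
    finally show ?thesis using k1 by simp
  qed
qed

lemma cauchy_transform_real:
  fixes h :: "real \<Rightarrow> real"
  assumes h: "tame (\<lambda>t. of_real (h t))" and z: "Im z \<noteq> 0"
  shows "poisson (\<lambda>t. of_real (h t)) z = of_real (Re (cauchy_transform (\<lambda>t. of_real (h t)) z / (pi * \<i>)))"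
    and "conj_poisson (\<lambda>t. of_real (h t)) z = of_real (Im (cauchy_transform (\<lambda>t. of_real (h t)) z / (pi * \<i>)))"
proof -
  let ?K = "cauchy_transform (\<lambda>t. of_real (h t))"
  have "?K (cnj z) = (LINT t|lborel. cnj (of_real (h t) / (of_real t - z)))"
    unfolding cauchy_transform_def by simp
  then have c: "?K (cnj z) = cnj (?K z)"
    unfolding cauchy_transform_def by (simp only: Bochner_Integration.integral_cnj)
  show "poisson (\<lambda>t. of_real (h t)) z = of_real (Re (?K z / (pi * \<i>)))"
    unfolding poisson_cauchy[OF h z] c by (simp add: complex_eq_iff Re_divide Im_divide power2_eq_square)
  show "conj_poisson (\<lambda>t. of_real (h t)) z = of_real (Im (?K z / (pi * \<i>)))"
    unfolding integrable_poisson_kernel_mult(4)[OF h z] c by (simp add: complex_eq_iff Re_divide Im_divide power2_eq_square)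
qed

section \<open>Harmonic functions as real parts of holomorphic functions\<close>

lemma horizontal_derivative:
  fixes u :: "complex \<Rightarrow> real"
  assumes "(u has_derivative (\<lambda>h. Re h * a + Im h * b)) (at (w + of_real s))"
  shows "((\<lambda>s. u (w + of_real s)) has_real_derivative a) (at s)"
proof -
  have "((\<lambda>s. w + of_real s) has_derivative (\<lambda>h. of_real h)) (at s)"
    by (auto intro!: derivative_eq_intros)
  from has_derivative_compose[OF this assms] show ?thesis
    by (simp add: has_field_derivative_def mult.commute[of a] mult_commute_abs)
qed

lemma vertical_derivative:
  fixes u :: "complex \<Rightarrow> real"
  assumes "(u has_derivative (\<lambda>h. Re h * a + Im h * b)) (at (w + \<i> * of_real s))"
  shows "((\<lambda>s. u (w + \<i> * of_real s)) has_real_derivative b) (at s)"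
proof -
  have "((\<lambda>s. w + \<i> * of_real s) has_derivative (\<lambda>h. \<i> * of_real h)) (at s)"
    by (auto intro!: derivative_eq_intros)
  from has_derivative_compose[OF this assms] show ?thesis
    by (simp add: has_field_derivative_def mult_commute_abs)
qed

text \<open>
  The second difference of \<open>u\<close> over a small square, divided by the area, equals by
  two applications of the mean value theorem a value of either mixed derivative near
  \<open>z\<close>.
\<close>

lemma mixed_partials_eq:
  fixes u ux uy uxx uxy uyx uyy :: "complex \<Rightarrow> real"
  assumes S: "open S" "z \<in> S"
    and u: "\<And>z. z \<in> S \<Longrightarrow> (u has_derivative (\<lambda>h. Re h * ux z + Im h * uy z)) (at z)"
    and ux: "\<And>z. z \<in> S \<Longrightarrow> (ux has_derivative (\<lambda>h. Re h * uxx z + Im h * uxy z)) (at z)"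
    and uy: "\<And>z. z \<in> S \<Longrightarrow> (uy has_derivative (\<lambda>h. Re h * uyx z + Im h * uyy z)) (at z)"
    and cont: "continuous_on S uxy" "continuous_on S uyx"
  shows "uxy z = uyx z"
proof (rule ccontr)
  assume ne: "uxy z \<noteq> uyx z"
  define e where "e = \<bar>uxy z - uyx z\<bar> / 2"
  have e: "e > 0" using ne by (simp add: e_def)
  have c1: "isCont uxy z" and c2: "isCont uyx z"
    using cont S by (auto simp: continuous_on_eq_continuous_at)
  obtain d1 where d1: "d1 > 0" "\<And>w. dist w z < d1 \<Longrightarrow> dist (uxy w) (uxy z) < e"
    using c1 e unfolding continuous_at_eps_delta dist_norm by (metis (mono_tags))
  obtain d2 where d2: "d2 > 0" "\<And>w. dist w z < d2 \<Longrightarrow> dist (uyx w) (uyx z) < e"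
    using c2 e unfolding continuous_at_eps_delta dist_norm by (metis (mono_tags))
  obtain d3 where d3: "d3 > 0" "ball z d3 \<subseteq> S" using S by (auto simp: open_contains_ball)
  define d where "d = min d1 (min d2 d3) / 4"
  have d: "d > 0" "4 * d \<le> d1" "4 * d \<le> d2" "4 * d \<le> d3" using d1 d2 d3 by (auto simp: d_def)
  have dist: "dist (z + of_real s + \<i> * of_real k) z < 4 * d" if "0 \<le> s" "s \<le> d" "0 \<le> k" "k \<le> d" for s k
    using norm_triangle_ineq[of "of_real s" "\<i> * of_real k"] that d by (simp add: dist_norm norm_mult add.assoc)
  have inS: "z + of_real s + \<i> * of_real k \<in> S" if "0 \<le> s" "s \<le> d" "0 \<le> k" "k \<le> d" for s k
    using dist[OF that] d d3 by (auto simp: dist_commute subset_iff)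
  have inS': "z + \<i> * of_real k + of_real s \<in> S" if "0 \<le> s" "s \<le> d" "0 \<le> k" "k \<le> d" for s k
    using inS[OF that] by (simp add: add_ac)
  define D where "D = u (z + of_real d + \<i> * of_real d) - u (z + of_real d) - u (z + \<i> * of_real d) + u z"
  have "\<exists>s k. 0 \<le> s \<and> s \<le> d \<and> 0 \<le> k \<and> k \<le> d \<and> D = d * (d * uxy (z + of_real s + \<i> * of_real k))"
  proof -
    have der: "((\<lambda>s. u (z + \<i> * of_real d + of_real s) - u (z + of_real s)) has_real_derivative
        ux (z + \<i> * of_real d + of_real s) - ux (z + of_real s)) (at s)" if "0 \<le> s" "s \<le> d" for s
    proof -
      have a: "z + \<i> * of_real d + of_real s \<in> S" using inS'[of s d] that d by simp
      have b: "z + of_real s \<in> S" using inS[of s 0] that d by simp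
      show ?thesis by (rule DERIV_diff[OF horizontal_derivative[OF u[OF a]] horizontal_derivative[OF u[OF b]]])
    qed
    obtain s where s: "0 < s" "s < d" and D1: "D = d * (ux (z + \<i> * of_real d + of_real s) - ux (z + of_real s))"
      using MVT2[OF d(1), of "\<lambda>s. u (z + \<i> * of_real d + of_real s) - u (z + of_real s)"
          "\<lambda>s. ux (z + \<i> * of_real d + of_real s) - ux (z + of_real s)"] der
      by (auto simp: D_def add_ac)
    have der2: "((\<lambda>k. ux (z + of_real s + \<i> * of_real k)) has_real_derivative uxy (z + of_real s + \<i> * of_real k)) (at k)"
      if "0 \<le> k" "k \<le> d" for k
    proof -
      have a: "z + of_real s + \<i> * of_real k \<in> S" using inS[of s k] that s by simp
      show ?thesis by (rule vertical_derivative[OF ux[OF a]])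
    qed
    obtain k where k: "0 < k" "k < d" "ux (z + of_real s + \<i> * of_real d) - ux (z + of_real s + \<i> * of_real 0)
        = (d - 0) * uxy (z + of_real s + \<i> * of_real k)"
      using MVT2[OF d(1), of "\<lambda>k. ux (z + of_real s + \<i> * of_real k)"
          "\<lambda>k. uxy (z + of_real s + \<i> * of_real k)", OF der2] by blast
    then have "D = d * (d * uxy (z + of_real s + \<i> * of_real k))" using D1 by (simp add: add_ac)
    then show ?thesis using s k by (intro exI[of _ s] exI[of _ k]) auto
  qed
  then obtain s k where sk: "0 \<le> s" "s \<le> d" "0 \<le> k" "k \<le> d" "D = d * (d * uxy (z + of_real s + \<i> * of_real k))" by blast
  have "\<exists>s k. 0 \<le> s \<and> s \<le> d \<and> 0 \<le> k \<and> k \<le> d \<and> D = d * (d * uyx (z + of_real s + \<i> * of_real k))"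
  proof -
    have der: "((\<lambda>k. u (z + of_real d + \<i> * of_real k) - u (z + \<i> * of_real k)) has_real_derivative
        uy (z + of_real d + \<i> * of_real k) - uy (z + \<i> * of_real k)) (at k)" if "0 \<le> k" "k \<le> d" for k
    proof -
      have a: "z + of_real d + \<i> * of_real k \<in> S" using inS[of d k] that d by simp
      have b: "z + \<i> * of_real k \<in> S" using inS[of 0 k] that d by simp
      show ?thesis by (rule DERIV_diff[OF vertical_derivative[OF u[OF a]] vertical_derivative[OF u[OF b]]])
    qed
    obtain k where k: "0 < k" "k < d" and D1: "D = d * (uy (z + of_real d + \<i> * of_real k) - uy (z + \<i> * of_real k))"
      using MVT2[OF d(1), of "\<lambda>k. u (z + of_real d + \<i> * of_real k) - u (z + \<i> * of_real k)"
          "\<lambda>k. uy (z + of_real d + \<i> * of_real k) - uy (z + \<i> * of_real k)"] der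
      by (auto simp: D_def add_ac)
    have der2: "((\<lambda>s. uy (z + \<i> * of_real k + of_real s)) has_real_derivative uyx (z + \<i> * of_real k + of_real s)) (at s)"
      if "0 \<le> s" "s \<le> d" for s
    proof -
      have a: "z + \<i> * of_real k + of_real s \<in> S" using inS'[of s k] that k by simp
      show ?thesis by (rule horizontal_derivative[OF uy[OF a]])
    qed
    obtain s where s: "0 < s" "s < d" "uy (z + \<i> * of_real k + of_real d) - uy (z + \<i> * of_real k + of_real 0)
        = (d - 0) * uyx (z + \<i> * of_real k + of_real s)"
      using MVT2[OF d(1), of "\<lambda>s. uy (z + \<i> * of_real k + of_real s)"
          "\<lambda>s. uyx (z + \<i> * of_real k + of_real s)", OF der2] by blast
    then have "D = d * (d * uyx (z + of_real s + \<i> * of_real k))" using D1 by (simp add: add_ac)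
    then show ?thesis using s k by (intro exI[of _ s] exI[of _ k]) auto
  qed
  then obtain s' k' where sk': "0 \<le> s'" "s' \<le> d" "0 \<le> k'" "k' \<le> d" "D = d * (d * uyx (z + of_real s' + \<i> * of_real k'))" by blast
  have "uxy (z + of_real s + \<i> * of_real k) = uyx (z + of_real s' + \<i> * of_real k')"
    using sk(5) sk'(5) d(1) by simp
  moreover have "dist (uxy (z + of_real s + \<i> * of_real k)) (uxy z) < e"
    using dist[OF sk(1-4)] d by (intro d1) auto
  moreover have "dist (uyx (z + of_real s' + \<i> * of_real k')) (uyx z) < e"
    using dist[OF sk'(1-4)] d by (intro d2) auto
  ultimately show False unfolding e_def dist_real_def by (simp add: abs_if split: if_splits)
qed

lemma has_derivative_Re_partials:
  assumes "(f has_derivative (\<lambda>h. Re h *\<^sub>R a + Im h *\<^sub>R b)) (at z)"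
  shows "((\<lambda>z. Re (f z)) has_derivative (\<lambda>h. Re h * Re a + Im h * Re b)) (at z)"
  using has_derivative_Re[OF assms] by simp

text \<open>
  For \<open>u = Re f\<close>, harmonicity and the symmetry of second derivatives are the
  Cauchy-Riemann equations for \<open>u\<^sub>x - \<i> u\<^sub>y\<close>, whose primitive on the
  convex half-plane has real part \<open>u\<close> up to a constant.
\<close>

lemma harmonic_Re_holomorphic:
  assumes f: "harmonic_on f upper_half_plane"
  obtains F where "F holomorphic_on upper_half_plane" "\<And>z. z \<in> upper_half_plane \<Longrightarrow> Re (f z) = Re (F z)"
proof -
  from f obtain fx fy fxx fxy fyx fyy where h:
    "has_continuous_partials_on f fx fy upper_half_plane" "has_continuous_partials_on fx fxx fxy upper_half_plane"
    "has_continuous_partials_on fy fyx fyy upper_half_plane" "\<forall>z\<in>upper_half_plane. fxx z + fyy z = 0"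
    unfolding harmonic_on_def by (elim exE conjE)
  note H = h[unfolded has_continuous_partials_on_def]
  have du: "((\<lambda>z. Re (f z)) has_derivative (\<lambda>h. Re h * Re (fx z) + Im h * Re (fy z))) (at z)" if "z \<in> upper_half_plane" for z
    using H(1) that by (intro has_derivative_Re_partials) blast
  have dux: "((\<lambda>z. Re (fx z)) has_derivative (\<lambda>h. Re h * Re (fxx z) + Im h * Re (fxy z))) (at z)" if "z \<in> upper_half_plane" for z
    using H(2) that by (intro has_derivative_Re_partials) blast
  have duy: "((\<lambda>z. Re (fy z)) has_derivative (\<lambda>h. Re h * Re (fyx z) + Im h * Re (fyy z))) (at z)" if "z \<in> upper_half_plane" for z
    using H(3) that by (intro has_derivative_Re_partials) blast
  have c1: "continuous_on upper_half_plane (\<lambda>z. Re (fxy z))" using H(2) by (intro continuous_intros) blast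
  have c2: "continuous_on upper_half_plane (\<lambda>z. Re (fyx z))" using H(3) by (intro continuous_intros) blast
  have mixed: "Re (fxy z) = Re (fyx z)" if "z \<in> upper_half_plane" for z
    by (rule mixed_partials_eq[OF open_upper_half_plane that du dux duy c1 c2])
  define G where "G = (\<lambda>z. of_real (Re (fx z)) - \<i> * of_real (Re (fy z)))"
  have dG: "(G has_field_derivative (of_real (Re (fxx z)) - \<i> * of_real (Re (fxy z)))) (at z)" if z: "z \<in> upper_half_plane" for z
  proof -
    have yy: "Re (fyy z) = - Re (fxx z)" using h(4) z by (metis eq_neg_iff_add_eq_0 add.commute uminus_complex.sel(1))
    have "(G has_derivative (\<lambda>h. of_real (Re h * Re (fxx z) + Im h * Re (fxy z)) - \<i> * of_real (Re h * Re (fyx z) + Im h * Re (fyy z)))) (at z)"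
      unfolding G_def by (intro derivative_intros dux duy z)
    moreover have "(\<lambda>h. of_real (Re h * Re (fxx z) + Im h * Re (fxy z)) - \<i> * of_real (Re h * Re (fyx z) + Im h * Re (fyy z)))
       = (*) (of_real (Re (fxx z)) - \<i> * of_real (Re (fxy z)))"
      using mixed[OF z] yy by (auto simp: fun_eq_iff complex_eq_iff algebra_simps)
    ultimately show ?thesis by (simp add: has_field_derivative_def)
  qed
  have "G holomorphic_on upper_half_plane"
    unfolding holomorphic_on_open[OF open_upper_half_plane] using dG by blast
  then obtain F where F: "\<And>z. z \<in> upper_half_plane \<Longrightarrow> (F has_field_derivative G z) (at z within upper_half_plane)"
    using holomorphic_convex_primitive'[OF convex_upper_half_plane open_upper_half_plane] by blast
  have F': "(F has_field_derivative G z) (at z)" if "z \<in> upper_half_plane" for z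
    using F[OF that] at_within_open[OF that open_upper_half_plane] by simp
  have "\<exists>c. \<forall>z\<in>upper_half_plane. Re (f z) - Re (F z) = c"
  proof (rule has_derivative_zero_constant[OF convex_upper_half_plane])
    fix z assume z: "z \<in> upper_half_plane"
    have "((\<lambda>z. Re (F z)) has_derivative (\<lambda>h. Re (G z * h))) (at z)"
      using F'[OF z] unfolding has_field_derivative_def by (rule has_derivative_Re)
    from has_derivative_diff[OF du[OF z] this]
    have "((\<lambda>z. Re (f z) - Re (F z)) has_derivative (\<lambda>h. 0)) (at z)"
      by (simp add: G_def)
    then show "((\<lambda>z. Re (f z) - Re (F z)) has_derivative (\<lambda>h. 0)) (at z within upper_half_plane)"
      by (rule has_derivative_at_withinI)
  qed
  then obtain c where c: "\<And>z. z \<in> upper_half_plane \<Longrightarrow> Re (f z) - Re (F z) = c" by blast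
  show ?thesis
  proof (rule that[of "\<lambda>z. F z + of_real c"])
    show "(\<lambda>z. F z + of_real c) holomorphic_on upper_half_plane"
      using F by (intro holomorphic_intros) (auto simp: holomorphic_on_def field_differentiable_def)
    show "Re (f z) = Re (F z + of_real c)" if "z \<in> upper_half_plane" for z using c[OF that] by simp
  qed
qed

lemma harmonic_on_cmult:
  assumes "harmonic_on f S"
  shows "harmonic_on (\<lambda>z. c * f z) S"
proof -
  from assms obtain fx fy fxx fxy fyx fyy where h:
    "has_continuous_partials_on f fx fy S" "has_continuous_partials_on fx fxx fxy S"
    "has_continuous_partials_on fy fyx fyy S" "\<forall>z\<in>S. fxx z + fyy z = 0"
    unfolding harmonic_on_def by (elim exE conjE)
  have *: "has_continuous_partials_on (\<lambda>z. c * f z) (\<lambda>z. c * a z) (\<lambda>z. c * b z) S"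
    if ab: "has_continuous_partials_on f a b S" for f a b
    unfolding has_continuous_partials_on_def
  proof (intro conjI ballI)
    show "continuous_on S (\<lambda>z. c * a z)" "continuous_on S (\<lambda>z. c * b z)"
      using ab by (auto simp: has_continuous_partials_on_def intro!: continuous_intros)
    fix z assume z: "z \<in> S"
    then have "(f has_derivative (\<lambda>h. Re h *\<^sub>R a z + Im h *\<^sub>R b z)) (at z)"
      using ab by (auto simp: has_continuous_partials_on_def)
    from has_derivative_mult_right[OF this, of c]
    show "((\<lambda>z. c * f z) has_derivative (\<lambda>h. Re h *\<^sub>R (c * a z) + Im h *\<^sub>R (c * b z))) (at z)"
      by (simp add: distrib_left)
  qed
  show ?thesis
    by (rule harmonic_onI[OF *[OF h(1)] *[OF h(2)] *[OF h(3)]]) (use h(4) in \<open>simp flip: distrib_left\<close>)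
qed

lemma tame_add:
  assumes "tame f" "tame g" shows "tame (\<lambda>t. f t + g t)"
proof -
  note [measurable] = tame_measurable[OF assms(1)] tame_measurable[OF assms(2)]
  have "integrable lborel (\<lambda>t. norm (f t) / (1 + \<bar>t\<bar>) + norm (g t) / (1 + \<bar>t\<bar>))"
    using assms by (auto simp: tame_def)
  then have "integrable lborel (\<lambda>t. norm (f t + g t) / (1 + \<bar>t\<bar>))"
  proof (rule Bochner_Integration.integrable_bound, measurable, intro AE_I2)
    fix t
    have "norm (f t + g t) / (1 + \<bar>t\<bar>) \<le> (norm (f t) + norm (g t)) / (1 + \<bar>t\<bar>)"
      by (intro divide_right_mono norm_triangle_ineq) auto
    then show "norm (norm (f t + g t) / (1 + \<bar>t\<bar>)) \<le> norm (norm (f t) / (1 + \<bar>t\<bar>) + norm (g t) / (1 + \<bar>t\<bar>))"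
      by (simp add: add_divide_distrib)
  qed
  then show ?thesis by (simp add: tame_def)
qed

lemma tame_cmult:
  assumes "tame f" shows "tame (\<lambda>t. c * f t)"
proof -
  note [measurable] = tame_measurable[OF assms(1)]
  have "integrable lborel (\<lambda>t. norm c * (norm (f t) / (1 + \<bar>t\<bar>)))"
    using assms by (intro integrable_mult_right) (auto simp: tame_def)
  then show ?thesis by (simp add: tame_def norm_mult)
qed

lemma tame_diff:
  assumes "tame f" "tame g" shows "tame (\<lambda>t. f t - g t)"
  using tame_add[OF assms(1) tame_cmult[OF assms(2), of "-1"]] by simp

lemma cauchy_transform_add:
  assumes "tame f" "tame g" "Im z \<noteq> 0"
  shows "cauchy_transform (\<lambda>t. f t + g t) z = cauchy_transform f z + cauchy_transform g z"
  unfolding cauchy_transform_def using integrable_cauchy[OF assms(1,3)] integrable_cauchy[OF assms(2,3)]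
  by (simp add: add_divide_distrib)

lemma cauchy_transform_cmult:
  "cauchy_transform (\<lambda>t. c * f t) z = c * cauchy_transform f z"
  unfolding cauchy_transform_def by (simp flip: times_divide_eq_right)

lemma poisson_add:
  assumes "tame f" "tame g" "Im z \<noteq> 0"
  shows "poisson (\<lambda>t. f t + g t) z = poisson f z + poisson g z"
  using assms by (simp add: poisson_cauchy tame_add cauchy_transform_add add_divide_distrib diff_divide_distrib)

lemma poisson_cmult:
  assumes "tame f" "Im z \<noteq> 0"
  shows "poisson (\<lambda>t. c * f t) z = c * poisson f z"
  using assms by (simp add: poisson_cauchy tame_cmult cauchy_transform_cmult algebra_simps diff_divide_distrib)

lemma poisson_diff:
  assumes "tame f" "tame g" "Im z \<noteq> 0"
  shows "poisson (\<lambda>t. f t - g t) z = poisson f z - poisson g z"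
  using poisson_add[OF assms(1) tame_cmult[OF assms(2), of "-1"] assms(3)] poisson_cmult[OF assms(2,3), of "-1"]
  by simp

section \<open>The semigroup property of \<open>p\<close>-bounded harmonic functions\<close>

lemma mass_mono:
  assumes "\<And>x. norm (f x) \<le> norm (g x)" "p \<ge> 0"
  shows "mass p f \<le> mass p g"
  unfolding mass_def using assms by (intro nn_integral_mono ennreal_leI powr_mono2) auto

text \<open>
  Both sides are bounded harmonic functions of \<open>z\<close> with the same continuous
  boundary values.
\<close>

lemma poisson_reproduces_bounded:
  assumes F: "F holomorphic_on upper_half_plane" and s: "s > 0"
    and B: "\<And>x y. y \<ge> s \<Longrightarrow> \<bar>Re (F (Complex x y))\<bar> \<le> B"
    and tame: "tame (\<lambda>t. of_real (Re (F (Complex t s))))"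
    and z: "Im z > 0"
  shows "poisson (\<lambda>t. of_real (Re (F (Complex t s)))) z = of_real (Re (F (z + \<i> * of_real s)))"
proof -
  define h :: "real \<Rightarrow> complex" where "h = (\<lambda>t. of_real (Re (F (Complex t s))))"
  have contF: "continuous_on upper_half_plane F" by (rule holomorphic_on_imp_continuous_on[OF F])
  have "continuous_on UNIV (\<lambda>t. Complex t s)"
    by (simp add: Complex_eq) (intro continuous_intros)
  then have "continuous_on UNIV (\<lambda>t. F (Complex t s))"
    by (rule continuous_on_compose2[OF contF]) (use s in \<open>auto simp: upper_half_plane_def\<close>)
  then have conth: "continuous_on UNIV h" unfolding h_def by (intro continuous_intros)
  have hB: "norm (h t) \<le> B" for t unfolding h_def using B[of s t] by simp
  obtain P where P: "continuous_on UNIV P" "\<And>z. Im z > 0 \<Longrightarrow> P z = poisson h z"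
    "\<And>z. Im z = 0 \<Longrightarrow> P z = h (Re z)" "\<And>z. norm (P z) \<le> B"
    using poisson_continuous_extension[OF conth hB] by blast
  define w where "w = (\<lambda>z. Re (F (z + \<i> * of_real s)) - Re (P z))"
  have shift: "continuous_on {z. Im z \<ge> 0} (\<lambda>z. F (z + \<i> * of_real s))"
    by (rule continuous_on_compose2[OF contF]) (use s in \<open>auto intro!: continuous_intros simp: upper_half_plane_def\<close>)
  have th: "tame h" using tame by (simp add: h_def)
  have "w z = 0"
  proof (rule half_plane_uniqueness[OF _ _ _ _ _ z])
    show "continuous_on {z. Im z \<ge> 0} w" unfolding w_def
      by (intro continuous_intros shift continuous_on_subset[OF P(1)]) auto
    show "\<bar>w z\<bar> \<le> B + B" if "Im z \<ge> 0" for z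
    proof -
      have "\<bar>Re (F (z + \<i> * of_real s))\<bar> \<le> B"
      proof -
        have "z + \<i> * of_real s = Complex (Re z) (Im z + s)" by (simp add: complex_eq_iff)
        then show ?thesis using B[of "Im z + s" "Re z"] that by simp
      qed
      then show ?thesis unfolding w_def using P(4)[of z] abs_Re_le_cmod[of "P z"] by linarith
    qed
    show "w z = 0" if "Im z = 0" for z
    proof -
      have "z + \<i> * of_real s = Complex (Re z) s" using that by (simp add: complex_eq_iff)
      then show ?thesis unfolding w_def P(3)[OF that] h_def by simp
    qed
    have "(\<lambda>z. F (z + \<i> * of_real s)) holomorphic_on upper_half_plane"
      by (rule holomorphic_on_upper_half_plane_shift[OF F]) (use s in simp)
    moreover have "cauchy_transform h holomorphic_on upper_half_plane"
      by (rule holomorphic_cauchy_transform[OF th]) (auto simp: upper_half_plane_def)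
    ultimately show "(\<lambda>z. F (z + \<i> * of_real s) - cauchy_transform h z / (pi * \<i>)) holomorphic_on upper_half_plane"
      by (intro holomorphic_intros) auto
    show "w z = Re (F (z + \<i> * of_real s) - cauchy_transform h z / (pi * \<i>))" if "Im z > 0" for z
      unfolding w_def P(2)[OF that] h_def using that
      by (subst cauchy_transform_real(1)[OF tame]) auto
  qed
  moreover have "P z = of_real (Re (P z))"
    unfolding P(2)[OF z] h_def using z by (subst (1 2) cauchy_transform_real(1)[OF tame]) auto
  ultimately show ?thesis unfolding w_def using P(2)[OF z] by (simp add: h_def)
qed

lemma continuous_on_horizontal:
  assumes "continuous_on upper_half_plane f" "y > 0"
  shows "continuous_on UNIV (\<lambda>t. f (Complex t y))"
proof -
  have "continuous_on UNIV (\<lambda>t. Complex t y)"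
    by (simp add: Complex_eq) (intro continuous_intros)
  then show ?thesis
    by (rule continuous_on_compose2[OF assms(1)]) (use assms(2) in \<open>auto simp: upper_half_plane_def\<close>)
qed

text \<open>
  Averages over horizontal segments of length \<open>d\<close> are difference quotients of a
  primitive, hence harmonic, and bounded by Jensen. So they are reproduced by the Poisson
  kernel, which bounds them at height \<open>s + r\<close> by the \<open>p\<close>-norm at
  height \<open>s\<close> with a constant that depends on \<open>r\<close> but not on
  \<open>d\<close>; then \<open>d\<close> tends to 0.
\<close>

lemma half_plane_pointwise_bound:
  assumes p: "p > 1" and F: "F holomorphic_on upper_half_plane" and M: "M \<ge> 0"
    and mass: "\<And>y. y > 0 \<Longrightarrow> mass p (\<lambda>x. of_real (Re (F (Complex x y)))) \<le> ennreal M"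
    and s: "s > 0" and r: "r > 0"
  shows "\<bar>Re (F (Complex x (s + r)))\<bar> \<le> (M / (pi * r)) powr (1 / p)"
proof -
  obtain PF where PF: "\<And>z. z \<in> upper_half_plane \<Longrightarrow> (PF has_field_derivative F z) (at z within upper_half_plane)"
    using holomorphic_convex_primitive'[OF convex_upper_half_plane open_upper_half_plane F] by blast
  have PF': "(PF has_field_derivative F z) (at z)" if "z \<in> upper_half_plane" for z
    using PF[OF that] at_within_open[OF that open_upper_half_plane] by simp
  have holPF: "PF holomorphic_on upper_half_plane"
    using PF by (auto simp: holomorphic_on_def field_differentiable_def)
  have contF: "continuous_on upper_half_plane F" by (rule holomorphic_on_imp_continuous_on[OF F])
  define A where "A = (\<lambda>d z. (PF (z + of_real d) - PF z) / of_real d)"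
  have bound: "\<bar>Re (A d (Complex x (s + r)))\<bar> \<le> (M / (pi * r)) powr (1 / p)" if d: "d > 0" for d
  proof -
    define k where "k = (\<lambda>t. indicator {-d..0} t / d)"
    have [measurable]: "k \<in> borel_measurable borel" unfolding k_def by measurable
    have k0: "k t \<ge> 0" for t using d by (simp add: k_def)
    have k1: "(\<integral>\<^sup>+t. ennreal (k t) \<partial>lborel) = 1"
    proof -
      have "(\<integral>\<^sup>+t. ennreal (k t) \<partial>lborel) = (\<integral>\<^sup>+t. ennreal (1 / d) * indicator {-d..0} t \<partial>lborel)"
        using d by (intro nn_integral_cong) (auto simp: k_def indicator_def)
      also have "\<dots> = ennreal (1 / d) * ennreal d"
        using d by (subst nn_integral_cmult_indicator) auto
      also have "\<dots> = 1" using d by (simp flip: ennreal_mult)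
      finally show ?thesis .
    qed
    define g where "g = (\<lambda>y t. Re (F (Complex t y)))"
    have contg: "continuous_on UNIV (g y)" if "y > 0" for y
      unfolding g_def by (intro continuous_intros continuous_on_horizontal[OF contF that])
    have mg: "g y \<in> borel_measurable borel" if "y > 0" for y
      by (rule borel_measurable_continuous_onI[OF contg[OF that]])
    have kx: "k (x - t) = indicator {x..x + d} t / d" for x t by (auto simp: k_def indicator_def)
    have intk: "integrable lborel (\<lambda>t. k (x - t) * q t)" if "continuous_on UNIV q" for x and q :: "real \<Rightarrow> real"
    proof -
      have "set_integrable lborel {x..x + d} q"
        by (rule borel_integrable_atLeastAtMost') (rule continuous_on_subset[OF that], simp)
      then have "integrable lborel (\<lambda>t. (indicator {x..x + d} t *\<^sub>R q t) / d)"
        unfolding set_integrable_def by (rule integrable_divide)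
      then show ?thesis by (simp add: kx)
    qed
    have ReA: "Re (A d (Complex x y)) = (LINT t|lborel. k (x - t) * g y t)" if y: "y > 0" for x y
    proof -
      have "((\<lambda>t. Re (PF (Complex t y))) has_real_derivative g y t) (at t)" for t
      proof -
        have c: "(PF has_derivative (\<lambda>h. F (Complex t y) * h)) (at (\<i> * of_real y + of_real t))"
          using PF'[of "Complex t y"] y by (simp add: upper_half_plane_def has_field_derivative_def Complex_eq add.commute)
        have "((\<lambda>z. Re (PF z)) has_derivative (\<lambda>h. Re h * Re (F (Complex t y)) + Im h * (- Im (F (Complex t y))))) (at (\<i> * of_real y + of_real t))"
          using has_derivative_Re[OF c] by (simp add: algebra_simps)
        from horizontal_derivative[OF this] show ?thesis by (simp add: Complex_eq g_def add.commute)
      qed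
      then have derv: "((\<lambda>t. Re (PF (Complex t y))) has_vector_derivative g y t) (at t within {x..x + d})" for t
        using has_real_derivative_iff_has_vector_derivative has_field_derivative_at_within by blast
      have "(LINT t|lborel. indicator {x..x + d} t *\<^sub>R g y t) = Re (PF (Complex (x + d) y)) - Re (PF (Complex x y))"
        by (rule integral_FTC_atLeastAtMost[OF _ derv continuous_on_subset[OF contg[OF y]]]) (use d in auto)
      moreover have "(LINT t|lborel. k (x - t) * g y t) = (LINT t|lborel. (indicator {x..x + d} t *\<^sub>R g y t) / d)"
        by (simp add: kx)
      moreover have "\<dots> = (LINT t|lborel. indicator {x..x + d} t *\<^sub>R g y t) / d"
        by (rule integral_divide_zero)
      moreover have "Complex x y + of_real d = Complex (x + d) y" by (simp add: complex_eq_iff)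
      ultimately show ?thesis unfolding A_def by (simp add: Re_divide_of_real)
    qed
    have absA: "\<bar>Re (A d (Complex x y))\<bar> \<le> (LINT t|lborel. k (x - t) * norm (of_real (g y t) :: complex))" if y: "y > 0" for x y
    proof -
      have "\<bar>Re (A d (Complex x y))\<bar> \<le> (LINT t|lborel. norm (k (x - t) * g y t))"
        unfolding ReA[OF y] by (metis integral_norm_bound real_norm_def)
      then show ?thesis using k0 by (simp add: abs_mult)
    qed
    have intn: "integrable lborel (\<lambda>t. k (x - t) * norm (of_real (g y t) :: complex))" if y: "y > 0" for x y
      by (intro intk continuous_intros contg[OF y])
    have massA: "mass p (\<lambda>x. of_real (Re (A d (Complex x y)))) \<le> ennreal M" if y: "y > 0" for y
    proof -
      note [measurable] = mg[OF y]
      have "mass p (\<lambda>x. of_real (Re (A d (Complex x y)))) \<le> mass p (\<lambda>t. of_real (g y t))"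
        by (rule mass_convolution_le[OF p _ _ k0 k1 intn[OF y]]) (use absA[OF y] in auto)
      then show ?thesis using mass[OF y] by (auto simp: g_def)
    qed
    define B where "B = (M / d) powr (1 / p)"
    have bddA: "\<bar>Re (A d (Complex x y))\<bar> \<le> B" if y: "y > 0" for x y
    proof -
      note [measurable] = mg[OF y]
      have "ennreal (\<bar>Re (A d (Complex x y))\<bar> powr p) \<le> ennreal ((LINT t|lborel. k (x - t) * norm (of_real (g y t) :: complex)) powr p)"
        using absA[OF y] p by (intro ennreal_leI powr_mono2) auto
      also have "\<dots> \<le> (\<integral>\<^sup>+t. ennreal (k (x - t)) * ennreal (norm (of_real (g y t) :: complex) powr p) \<partial>lborel)"
        using k0 k1 intn[OF y]
        by (intro jensen_kernel p) (auto simp: nn_integral_reflect_shift[of "\<lambda>t. ennreal (k t)"])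
      also have "\<dots> \<le> (\<integral>\<^sup>+t. ennreal (1 / d) * ennreal (norm (of_real (g y t) :: complex) powr p) \<partial>lborel)"
        using d by (intro nn_integral_mono mult_right_mono ennreal_leI) (auto simp: kx indicator_def)
      also have "\<dots> = ennreal (1 / d) * mass p (\<lambda>t. of_real (g y t))"
        unfolding mass_def by (rule nn_integral_cmult) measurable
      also have "\<dots> \<le> ennreal (1 / d) * ennreal M"
        using mass[OF y] by (intro mult_left_mono) (auto simp: g_def)
      also have "\<dots> = ennreal (M / d)" using d M by (simp flip: ennreal_mult)
      finally have "\<bar>Re (A d (Complex x y))\<bar> powr p \<le> M / d" using d M by (simp add: ennreal_le_iff)
      then show ?thesis unfolding B_def using p by (intro powr_le_imp_le_root) auto
    qed
    have holA: "A d holomorphic_on upper_half_plane"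
      unfolding A_def using d by (intro holomorphic_intros holPF holomorphic_on_upper_half_plane_shift) auto
    have contA: "continuous_on UNIV (\<lambda>t. of_real (Re (A d (Complex t s))) :: complex)"
      by (intro continuous_intros continuous_on_horizontal[OF holomorphic_on_imp_continuous_on[OF holA] s])
    have tameA: "tame (\<lambda>t. of_real (Re (A d (Complex t s))))"
      using massA[OF s] by (intro mass_finite_tame[OF p] borel_measurable_continuous_onI[OF contA])
        (auto intro: le_less_trans)
    have z: "Im (Complex x r) > 0" using r by simp
    have eq: "poisson (\<lambda>t. of_real (Re (A d (Complex t s)))) (Complex x r) = of_real (Re (A d (Complex x (s + r))))"
    proof -
      have "Complex x r + \<i> * of_real s = Complex x (s + r)" by (simp add: complex_eq_iff)
      then show ?thesis
        using poisson_reproduces_bounded[OF holA s _ tameA z, of B] bddA s by auto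
    qed
    have "ennreal (\<bar>Re (A d (Complex x (s + r)))\<bar> powr p) \<le> ennreal (1 / (pi * r)) * ennreal M"
      using norm_poisson_powr_le[OF p tameA r, of x] massA[OF s]
      unfolding eq by (simp add: order_trans[OF _ mult_left_mono])
    also have "\<dots> = ennreal (M / (pi * r))" using r M by (simp flip: ennreal_mult)
    finally have "\<bar>Re (A d (Complex x (s + r)))\<bar> powr p \<le> M / (pi * r)" using r M by (simp add: ennreal_le_iff)
    then show ?thesis using p by (intro powr_le_imp_le_root) auto
  qed
  define z where "z = Complex x (s + r)"
  have zH: "z \<in> upper_half_plane" using s r by (simp add: z_def upper_half_plane_def)
  have "((\<lambda>h. (PF (z + h) - PF z) / h) \<longlongrightarrow> F z) (at 0)"
    using PF'[OF zH] by (simp add: DERIV_def)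
  moreover have "filterlim (\<lambda>d::real. complex_of_real d) (at 0) (at_right 0)"
    unfolding filterlim_at
    by (auto simp: eventually_at_filter intro!: tendsto_eq_intros)
  ultimately have "((\<lambda>d. A d z) \<longlongrightarrow> F z) (at_right 0)"
    unfolding A_def by (rule filterlim_compose)
  then have "((\<lambda>d. \<bar>Re (A d z)\<bar>) \<longlongrightarrow> \<bar>Re (F z)\<bar>) (at_right 0)" by (intro tendsto_intros)
  then show ?thesis
    unfolding z_def
    by (rule tendsto_upperbound) (auto simp: eventually_at_filter intro!: bound always_eventually)
qed

lemma semigroup_Re:
  assumes p: "p > 1" and F: "F holomorphic_on upper_half_plane" and M: "M \<ge> 0"
    and mass: "\<And>y. y > 0 \<Longrightarrow> mass p (\<lambda>x. of_real (Re (F (Complex x y)))) \<le> ennreal M"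
    and s: "s > 0" and r: "r > 0"
  shows "tame (\<lambda>t. of_real (Re (F (Complex t s))))"
    and "poisson (\<lambda>t. of_real (Re (F (Complex t s)))) (Complex x r) = of_real (Re (F (Complex x (s + r))))"
proof -
  have "continuous_on UNIV (\<lambda>t. of_real (Re (F (Complex t s))) :: complex)"
    by (intro continuous_intros continuous_on_horizontal[OF holomorphic_on_imp_continuous_on[OF F] s])
  then show tame: "tame (\<lambda>t. of_real (Re (F (Complex t s))))"
    using mass[OF s] by (intro mass_finite_tame[OF p] borel_measurable_continuous_onI)
      (auto intro: le_less_trans)
  have B: "\<bar>Re (F (Complex x y))\<bar> \<le> (M / (pi * (s / 2))) powr (1 / p)" if y: "y \<ge> s" for x y
  proof -
    have "\<bar>Re (F (Complex x (y / 2 + y / 2)))\<bar> \<le> (M / (pi * (y / 2))) powr (1 / p)"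
      by (rule half_plane_pointwise_bound[OF p F M mass]) (use y s in auto)
    also have "\<dots> \<le> (M / (pi * (s / 2))) powr (1 / p)"
      using y s p M by (intro powr_mono2 divide_left_mono) auto
    finally show ?thesis by simp
  qed
  have "Complex x r + \<i> * of_real s = Complex x (s + r)" by (simp add: complex_eq_iff)
  then show "poisson (\<lambda>t. of_real (Re (F (Complex t s)))) (Complex x r) = of_real (Re (F (Complex x (s + r))))"
    using poisson_reproduces_bounded[OF F s B tame, of "Complex x r"] r by simp
qed

lemma harmonic_on_continuous:
  assumes "harmonic_on f S"
  shows "continuous_on S f"
proof -
  from assms obtain fx fy where "has_continuous_partials_on f fx fy S"
    unfolding harmonic_on_def by (elim exE conjE)
  then have "\<And>z. z \<in> S \<Longrightarrow> isCont f z"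
    unfolding has_continuous_partials_on_def by (meson has_derivative_continuous)
  then show ?thesis by (simp add: continuous_at_imp_continuous_on)
qed

lemma semigroup_harmonic:
  assumes p: "p > 1" and f: "harmonic_on f upper_half_plane" and M: "M \<ge> 0"
    and mass: "\<And>y. y > 0 \<Longrightarrow> mass p (\<lambda>x. f (Complex x y)) \<le> ennreal M"
    and s: "s > 0" and r: "r > 0"
  shows "poisson (\<lambda>t. f (Complex t s)) (Complex x r) = f (Complex x (s + r))"
proof -
  obtain F where F: "F holomorphic_on upper_half_plane" "\<And>z. z \<in> upper_half_plane \<Longrightarrow> Re (f z) = Re (F z)"
    using harmonic_Re_holomorphic[OF f] by blast
  obtain G where G: "G holomorphic_on upper_half_plane" "\<And>z. z \<in> upper_half_plane \<Longrightarrow> Re (- \<i> * f z) = Re (G z)"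
    using harmonic_Re_holomorphic[OF harmonic_on_cmult[OF f, of "- \<i>"]] by blast
  have eqF: "Re (F (Complex t y)) = Re (f (Complex t y))" and eqG: "Re (G (Complex t y)) = Im (f (Complex t y))" if "y > 0" for t y
    using F(2)[of "Complex t y"] G(2)[of "Complex t y"] that by (auto simp: upper_half_plane_def)
  have mF: "mass p (\<lambda>x. of_real (Re (F (Complex x y)))) \<le> ennreal M" if "y > 0" for y
    using p by (intro order_trans[OF mass_mono mass[OF that]]) (auto simp: eqF[OF that] abs_Re_le_cmod)
  have mG: "mass p (\<lambda>x. of_real (Re (G (Complex x y)))) \<le> ennreal M" if "y > 0" for y
    using p by (intro order_trans[OF mass_mono mass[OF that]]) (auto simp: eqG[OF that] abs_Im_le_cmod)
  note SF = semigroup_Re[OF p F(1) M mF s r]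
  note SG = semigroup_Re[OF p G(1) M mG s r]
  have "poisson (\<lambda>t. of_real (Re (F (Complex t s))) + \<i> * of_real (Re (G (Complex t s)))) (Complex x r)
    = of_real (Re (F (Complex x (s + r)))) + \<i> * of_real (Re (G (Complex x (s + r))))"
    using r by (subst poisson_add) (auto simp: poisson_cmult SF SG intro!: tame_cmult SF(1) SG(1))
  moreover have "of_real (Re (F (Complex t y))) + \<i> * of_real (Re (G (Complex t y))) = f (Complex t y)" if "y > 0" for t y
    unfolding eqF[OF that] eqG[OF that] by (rule complex_eq[symmetric])
  ultimately show ?thesis using s r by simp
qed

section \<open>Uniform convexity\<close>

text \<open>
  Strict convexity of the power function: for \<open>x > 0\<close> by the mean value theorem,
  for \<open>x = 0\<close> by direct computation.
\<close>

lemma powr_tangent_strict: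
  fixes x m p :: real
  assumes p: "p > 1" and m: "m > 0" and x: "x \<ge> 0" "x \<noteq> m"
  shows "x powr p > m powr p + p * m powr (p - 1) * (x - m)"
proof -
  have der: "((\<lambda>x. x powr p) has_real_derivative p * y powr (p - 1)) (at y)" if "y > 0" for y
    using that by (auto intro!: derivative_eq_intros)
  consider "x = 0" | "x > m" | "0 < x" "x < m" using x by linarith
  then show ?thesis
  proof cases
    case 1
    have "m powr (p - 1) * m = m powr p"
      using m by (simp add: powr_mult_base mult.commute[of _ m])
    then have "- (p * (m powr (p - 1) * m)) = - (p * m powr p)" by (simp only:)
    moreover have "p * m powr (p - 1) * (x - m) = - (p * (m powr (p - 1) * m))"
      using 1 by simp
    ultimately have eq: "p * m powr (p - 1) * (x - m) = - (p * m powr p)" by (simp only:)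
    have "p * m powr p > m powr p" using p m by simp
    moreover have "x powr p = 0" using 1 by simp
    ultimately show ?thesis unfolding eq by linarith
  next
    case 2
    obtain c where c: "m < c" "c < x" "x powr p - m powr p = (x - m) * (p * c powr (p - 1))"
      using MVT2[OF 2, of "\<lambda>x. x powr p" "\<lambda>y. p * y powr (p - 1)"] der m by auto
    have "(x - m) * (p * c powr (p - 1)) > (x - m) * (p * m powr (p - 1))"
      using c 2 p m by (intro mult_strict_left_mono powr_less_mono2) auto
    then show ?thesis using c by (simp add: mult_ac)
  next
    case 3
    obtain c where c: "x < c" "c < m" "m powr p - x powr p = (m - x) * (p * c powr (p - 1))"
      using MVT2[OF 3(2), of "\<lambda>x. x powr p" "\<lambda>y. p * y powr (p - 1)"] der 3 by auto
    have "(m - x) * (p * c powr (p - 1)) < (m - x) * (p * m powr (p - 1))"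
      using c 3 p m by (intro mult_strict_left_mono powr_less_mono2) auto
    then have "m powr p - x powr p < (m - x) * (p * m powr (p - 1))" using c by simp
    then show ?thesis by (simp add: algebra_simps)
  qed
qed

lemma powr_midpoint_strict:
  fixes x y p :: real
  assumes p: "p > 1" and "x \<ge> 0" "y \<ge> 0" "x \<noteq> y"
  shows "((x + y) / 2) powr p < (x powr p + y powr p) / 2"
proof -
  define m where "m = (x + y) / 2"
  have m: "m > 0" "x \<noteq> m" "y \<noteq> m" using assms by (auto simp: m_def)
  have "x powr p > m powr p + p * m powr (p - 1) * (x - m)"
    "y powr p > m powr p + p * m powr (p - 1) * (y - m)"
    using assms m by (auto intro!: powr_tangent_strict)
  moreover have "p * m powr (p - 1) * (x - m) + p * m powr (p - 1) * (y - m) = 0"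
    by (simp add: m_def flip: distrib_left)
  moreover have "P < (X + Y) / 2" if "X > P + A" "Y > P + B" "A + B = 0" for P A B X Y :: real
  proof -
    have "(P + A) + (P + B) < X + Y" using that by (intro add_strict_mono)
    moreover have "(P + A) + (P + B) = (P + P) + (A + B)" by (simp only: add_ac)
    ultimately show ?thesis using that(3) by simp
  qed
  ultimately show ?thesis unfolding m_def[symmetric] by blast
qed

lemma norm_powr_midpoint:
  fixes a b :: complex
  assumes p: "p > 1"
  shows "norm ((a + b) / 2) powr p \<le> (norm a powr p + norm b powr p) / 2"
    and "a \<noteq> b \<Longrightarrow> norm ((a + b) / 2) powr p < (norm a powr p + norm b powr p) / 2"
proof -
  have le: "norm ((a + b) / 2) \<le> (norm a + norm b) / 2"
    using norm_triangle_ineq[of a b] by (simp add: norm_divide)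
  have le': "norm ((a + b) / 2) powr p \<le> ((norm a + norm b) / 2) powr p"
    using le p by (intro powr_mono2) auto
  show strict: "norm ((a + b) / 2) powr p < (norm a powr p + norm b powr p) / 2" if "a \<noteq> b"
  proof (cases "norm a = norm b")
    case False
    then show ?thesis using le' powr_midpoint_strict[OF p _ _ False] by simp
  next
    case True
    have "norm (a + b) \<noteq> norm a + norm b"
    proof
      assume "norm (a + b) = norm a + norm b"
      then have "norm a *\<^sub>R b = norm b *\<^sub>R a" by (simp add: norm_triangle_eq)
      then show False using True that by (cases "norm a = 0") auto
    qed
    then have "norm (a + b) < norm a + norm b" using norm_triangle_ineq[of a b] by simp
    then have "norm ((a + b) / 2) < norm b" using True by (simp add: norm_divide)
    then have "norm ((a + b) / 2) powr p < norm b powr p" using p by (intro powr_less_mono2) auto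
    then show ?thesis using True by simp
  qed
  show "norm ((a + b) / 2) powr p \<le> (norm a powr p + norm b powr p) / 2"
    using strict by (cases "a = b") auto
qed

text \<open>
  By homogeneity assume \<open>\<bar>a\<bar>\<^sup>p + \<bar>b\<bar>\<^sup>p = 1\<close>. Where
  \<open>\<bar>a - b\<bar>\<^sup>p < e\<close> the first summand suffices; the rest of the
  sphere is compact, and by strict convexity the defect in the midpoint inequality has a
  positive minimum there.
\<close>

lemma uniform_convexity:
  assumes p: "p > 1" and e: "e > 0"
  obtains C where "C \<ge> 0" "\<And>a b :: complex. norm (a - b) powr p \<le> e * (norm a powr p + norm b powr p)
     + C * ((norm a powr p + norm b powr p) / 2 - norm ((a + b) / 2) powr p)"
proof -
  define N where "N = (\<lambda>(a :: complex, b :: complex). norm a powr p + norm b powr p)"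
  define D where "D = (\<lambda>(a :: complex, b :: complex). norm (a - b) powr p)"
  define G where "G = (\<lambda>(a :: complex, b :: complex). (norm a powr p + norm b powr p) / 2 - norm ((a + b) / 2) powr p)"
  define S where "S = {x. N x = 1 \<and> D x \<ge> e}"
  have cont: "continuous_on UNIV N" "continuous_on UNIV D" "continuous_on UNIV G"
    unfolding N_def D_def G_def split_beta using p by (auto intro!: continuous_intros continuous_on_powr')
  have "closed S" unfolding S_def
    by (intro closed_Collect_conj closed_Collect_eq closed_Collect_le cont continuous_on_const)
  moreover have norm1: "norm a \<le> 1" if "norm a powr p \<le> 1" for a :: complex
  proof (rule ccontr)
    assume "\<not> norm a \<le> 1"
    then have "1 powr p < norm a powr p" using p by (intro powr_less_mono2) auto
    then show False using that by simp
  qed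
  have "bounded S"
  proof (rule boundedI)
    fix x assume "x \<in> S"
    then obtain a b where x: "x = (a, b)" "norm a powr p + norm b powr p = 1" by (cases x) (auto simp: S_def N_def)
    have "norm a \<le> 1" "norm b \<le> 1"
      using x(2) by (auto intro!: norm1 simp: add_increasing2) (smt (verit) powr_ge_zero)+
    then show "norm x \<le> 2" unfolding x(1) using norm_Pair_le[of a b] by linarith
  qed
  ultimately have "compact S" by (simp add: compact_eq_bounded_closed)
  have Gpos: "G x > 0" if "x \<in> S" for x
  proof -
    obtain a b where x: "x = (a, b)" by (cases x)
    have "a \<noteq> b" using that e p by (auto simp: S_def D_def x)
    then show ?thesis using norm_powr_midpoint(2)[OF p] by (simp add: G_def x)
  qed
  have G0: "G x \<ge> 0" for x using norm_powr_midpoint(1)[OF p] by (auto simp: G_def split: prod.split)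
  have D2: "D x \<le> 2 powr p" if "N x = 1" for x
  proof -
    obtain a b where x: "x = (a, b)" by (cases x)
    have "norm a \<le> 1" "norm b \<le> 1"
      using that unfolding x N_def by (auto intro!: norm1) (smt (verit) powr_ge_zero)+
    then have "norm (a - b) \<le> 2" using norm_triangle_ineq4[of a b] by linarith
    then show ?thesis using p by (auto simp: D_def x intro!: powr_mono2)
  qed
  have "\<exists>C\<ge>0. \<forall>x. N x = 1 \<longrightarrow> D x \<le> e + C * G x"
  proof (cases "S = {}")
    case True
    then show ?thesis by (intro exI[of _ 0]) (force simp: S_def)
  next
    case False
    obtain x0 where x0: "x0 \<in> S" "\<And>x. x \<in> S \<Longrightarrow> G x0 \<le> G x"
      using continuous_attains_inf[OF \<open>compact S\<close> False continuous_on_subset[OF cont(3)]] by auto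
    define C where "C = 2 powr p / G x0"
    have C: "C \<ge> 0" using Gpos[OF x0(1)] by (simp add: C_def)
    have "D x \<le> e + C * G x" if "N x = 1" for x
    proof (cases "D x \<ge> e")
      case True
      then have "x \<in> S" using that by (simp add: S_def)
      have "D x \<le> 2 powr p" by (rule D2[OF that])
      also have "\<dots> = C * G x0" using Gpos[OF x0(1)] by (simp add: C_def)
      also have "\<dots> \<le> C * G x" using x0(2)[OF \<open>x \<in> S\<close>] C by (rule mult_left_mono)
      finally show ?thesis using e by simp
    next
      case False
      then show ?thesis using C G0[of x] by (smt (verit) mult_nonneg_nonneg)
    qed
    then show ?thesis using C by blast
  qed
  then obtain C where C: "C \<ge> 0" "\<And>x. N x = 1 \<Longrightarrow> D x \<le> e + C * G x" by blast
  have "D (a, b) \<le> e * N (a, b) + C * G (a, b)" for a b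
  proof (cases "N (a, b) = 0")
    case True
    then have "norm a powr p = 0" "norm b powr p = 0"
      unfolding N_def by (auto simp: add_nonneg_eq_0_iff)
    then show ?thesis by (simp add: N_def D_def G_def)
  next
    case False
    define l where "l = N (a, b) powr (1 / p)"
    have N0: "N (a, b) > 0" using False unfolding N_def by (auto simp: less_le)
    have l: "l > 0" using N0 by (simp add: l_def)
    have lp: "l powr p = N (a, b)" using N0 p by (simp add: l_def powr_powr)
    have sc: "norm (c / of_real l) powr p = norm c powr p / N (a, b)" for c :: complex
      using l by (simp add: norm_divide powr_divide lp)
    let ?x = "(a / of_real l, b / of_real l)"
    have "N ?x = 1" using N0 sc unfolding N_def by (simp flip: add_divide_distrib)
    then have "D ?x \<le> e + C * G ?x" by (rule C(2))
    moreover have "D ?x = D (a, b) / N (a, b)"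
      unfolding D_def using sc[of "a - b"] by (simp add: diff_divide_distrib)
    moreover have "G ?x = G (a, b) / N (a, b)"
    proof -
      have eq: "(a / of_real l + b / of_real l) / 2 = ((a + b) / 2) / of_real l"
        by (simp add: add_divide_distrib mult.commute[of 2])
      have e: "norm ((a / of_real l + b / of_real l) / 2) powr p = norm ((a + b) / 2) powr p / N (a, b)"
        unfolding eq by (rule sc)
      have "(x / n + y / n) / 2 - w / n = ((x + y) / 2 - w) / n" for x y w n :: real
        by (simp add: diff_divide_distrib add_divide_distrib mult.commute[of 2])
      then show ?thesis unfolding G_def prod.case e sc .
    qed
    ultimately have "D (a, b) / N (a, b) \<le> (e * N (a, b) + C * G (a, b)) / N (a, b)"
      using N0 by (simp add: add_divide_distrib)
    then show ?thesis using N0 by (simp add: divide_le_cancel)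
  qed
  then show ?thesis using C(1) by (intro that[of C]) (auto simp: N_def D_def G_def)
qed

section \<open>Representation of \<open>p\<close>-bounded harmonic functions\<close>

lemma fatou_mass:
  assumes [measurable]: "\<And>n. F n \<in> borel_measurable borel"
    and lim: "AE x in lborel. (\<lambda>n. F n x) \<longlonglongrightarrow> G x" and p: "p > 0"
    and le: "\<And>n. mass p (F n) \<le> A"
  shows "mass p G \<le> A"
proof -
  have "mass p G \<le> (\<integral>\<^sup>+x. liminf (\<lambda>n. ennreal (norm (F n x) powr p)) \<partial>lborel)"
    unfolding mass_def
  proof (rule nn_integral_mono_AE, use lim in eventually_elim)
    case (elim x)
    then have "(\<lambda>n. ennreal (norm (F n x) powr p)) \<longlonglongrightarrow> ennreal (norm (G x) powr p)"
      using p by (intro tendsto_ennrealI tendsto_powr2 tendsto_norm tendsto_const) auto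
    then have "liminf (\<lambda>n. ennreal (norm (F n x) powr p)) = ennreal (norm (G x) powr p)"
      by (intro lim_imp_Liminf) auto
    then show ?case by simp
  qed
  also have "\<dots> \<le> liminf (\<lambda>n. \<integral>\<^sup>+x. ennreal (norm (F n x) powr p) \<partial>lborel)"
    by (rule nn_integral_liminf) measurable
  also have "\<dots> \<le> liminf (\<lambda>n. A)"
    using le by (intro Liminf_mono always_eventually allI) (simp add: mass_def)
  also have "\<dots> = A" by (simp add: Liminf_const)
  finally show ?thesis .
qed

lemma mass_integral:
  assumes "integrable lborel (\<lambda>x. norm (g x) powr p)"
  shows "mass p g = ennreal (LINT x|lborel. norm (g x) powr p)"
  unfolding mass_def by (rule nn_integral_eq_integral[OF assms]) auto

text \<open>
  Let \<open>u y\<close> be the trace of \<open>f\<close> at height \<open>y\<close>.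
  Convolution with the Poisson kernel maps the midpoint of \<open>u s\<close> and \<open>u
  t\<close> to that of \<open>u (s + r)\<close> and \<open>u (t + r)\<close>, which tends to
  \<open>u r\<close> as \<open>s\<close> and \<open>t\<close> tend to 0. So by Fatou the
  \<open>p\<close>-norms of these midpoints approach the supremum of the norms of all traces,
  and uniform convexity makes the traces Cauchy in \<open>L\<^sup>p\<close>. A fast subsequence
  converges almost everywhere; its limit \<open>g\<close> satisfies \<open>u r = P[g]\<close> at
  height \<open>r\<close> by the semigroup property.
\<close>

theorem poisson_representation:
  assumes p: "p > 1" and f: "harmonic_on f upper_half_plane" and M: "M \<ge> 0"
    and mass: "\<And>y. y > 0 \<Longrightarrow> mass p (\<lambda>x. f (Complex x y)) \<le> ennreal M"
  obtains g where "g \<in> borel_measurable borel" "mass p g \<le> ennreal M"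
    "\<And>z. Im z > 0 \<Longrightarrow> f z = poisson g z"
proof -
  define u where "u = (\<lambda>y x. f (Complex x y))"
  have contf: "continuous_on upper_half_plane f" by (rule harmonic_on_continuous[OF f])
  have mu: "u y \<in> borel_measurable borel" if "y > 0" for y
    unfolding u_def by (rule borel_measurable_continuous_onI[OF continuous_on_horizontal[OF contf that]])
  have massu: "mass p (u y) \<le> ennreal M" if "y > 0" for y
    using mass[OF that] by (simp add: u_def)
  have fin: "mass p (u y) < \<infinity>" if "y > 0" for y
    using massu[OF that] by (auto intro: le_less_trans)
  have tu: "tame (u y)" if "y > 0" for y
    by (rule mass_finite_tame[OF p mu[OF that] fin[OF that]])
  have semi: "poisson (u s) (Complex x r) = u (s + r) x" if "s > 0" "r > 0" for s r x
    using semigroup_harmonic[OF p f M mass that] by (simp add: u_def)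
  have iu: "integrable lborel (\<lambda>x. norm (u y x) powr p)" if "y > 0" for y
    by (rule mass_finite_integrable[OF mu[OF that] fin[OF that]])
  have contu: "(\<lambda>n. u (s n + r) x) \<longlonglongrightarrow> u r x" if "\<And>n. s n > 0" "s \<longlonglongrightarrow> 0" "r > 0" for s :: "nat \<Rightarrow> real" and r x
  proof -
    have "isCont f (Complex x r)"
      using contf open_upper_half_plane \<open>r > 0\<close> by (auto simp: continuous_on_eq_continuous_at upper_half_plane_def)
    moreover have "(\<lambda>n. Complex x (s n + r)) \<longlonglongrightarrow> Complex x r"
      using tendsto_Complex[OF tendsto_const tendsto_add[OF that(2) tendsto_const]] by simp
    ultimately show ?thesis unfolding u_def by (rule isCont_tendsto_compose)
  qed
  define N where "N = (\<lambda>y. LINT x|lborel. norm (u y x) powr p)"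
  have massN: "mass p (u y) = ennreal (N y)" if "y > 0" for y
    unfolding N_def by (rule mass_integral[OF iu[OF that]])
  have N0: "N y \<ge> 0" for y unfolding N_def by (intro integral_nonneg_AE) auto
  have NM: "N y \<le> M" if "y > 0" for y using massu[OF that] M by (simp add: massN[OF that] ennreal_le_iff)
  define S where "S = (SUP y\<in>{0<..}. N y)"
  have bddN: "bdd_above (N ` {0<..})" using NM by (intro bdd_aboveI[of _ M]) auto
  have NS: "N y \<le> S" if "y > 0" for y unfolding S_def using that by (intro cSUP_upper bddN) auto
  define mid where "mid = (\<lambda>s t x. (u s x + u t x) / 2)"
  define R where "R = (\<lambda>s t. LINT x|lborel. norm (mid s t x) powr p)"
  have mmid: "mid s t \<in> borel_measurable borel" if "s > 0" "t > 0" for s t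
    unfolding mid_def using mu[OF that(1)] mu[OF that(2)] by measurable
  have imid: "integrable lborel (\<lambda>x. norm (mid s t x) powr p)" if st: "s > 0" "t > 0" for s t
  proof -
    have "integrable lborel (\<lambda>x. (norm (u s x) powr p + norm (u t x) powr p) / 2)"
      using iu st by auto
    moreover have "(\<lambda>x. norm (mid s t x) powr p) \<in> borel_measurable lborel"
      using mmid[OF st] by measurable
    moreover have "norm (norm (mid s t x) powr p) \<le> norm ((norm (u s x) powr p + norm (u t x) powr p) / 2)" for x
      using norm_powr_midpoint(1)[OF p, of "u s x" "u t x"] by (simp add: mid_def)
    ultimately show ?thesis
      by (intro Bochner_Integration.integrable_bound[where g="\<lambda>x. norm (mid s t x) powr p"] AE_I2)
  qed
  have R0: "R s t \<ge> 0" for s t unfolding R_def by (intro integral_nonneg_AE) auto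
  have massR: "mass p (mid s t) = ennreal (R s t)" if "s > 0" "t > 0" for s t
    unfolding R_def by (rule mass_integral[OF imid[OF that]])
  have tmid: "tame (mid s t)" if "s > 0" "t > 0" for s t
    using tame_cmult[OF tame_add[OF tu[OF that(1)] tu[OF that(2)]], of "1 / 2"] by (simp add: mid_def)
  have pmid: "poisson (mid s t) (Complex x r) = mid (s + r) (t + r) x" if "s > 0" "t > 0" "r > 0" for s t r x
  proof -
    have "poisson (\<lambda>x. (1 / 2) * (u s x + u t x)) (Complex x r) = (1 / 2) * (u (s + r) x + u (t + r) x)"
      using that by (subst poisson_cmult) (auto simp: poisson_add tu tame_add semi)
    then show ?thesis by (simp add: mid_def)
  qed
  have step1: "N r \<le> c" if r: "r > 0" and s: "\<And>n. s n > 0" "s \<longlonglongrightarrow> 0" and t: "\<And>n. t n > 0" "t \<longlonglongrightarrow> 0"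
    and c: "\<And>n. R (s n) (t n) \<le> c" for r c and s t :: "nat \<Rightarrow> real"
  proof -
    have c0: "c \<ge> 0" using R0 c order_trans by blast
    have "mass p (u r) \<le> ennreal c"
    proof (rule fatou_mass[of "\<lambda>n. mid (s n + r) (t n + r)"])
      show "mid (s n + r) (t n + r) \<in> borel_measurable borel" for n
        using s(1)[of n] t(1)[of n] r by (intro mmid) auto
      show "AE x in lborel. (\<lambda>n. mid (s n + r) (t n + r) x) \<longlonglongrightarrow> u r x"
      proof (rule AE_I2)
        fix x
        have "(\<lambda>n. (u (s n + r) x + u (t n + r) x) / 2) \<longlonglongrightarrow> (u r x + u r x) / 2"
          by (intro tendsto_intros contu s t r) auto
        then show "(\<lambda>n. mid (s n + r) (t n + r) x) \<longlonglongrightarrow> u r x" by (simp add: mid_def)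
      qed
      show "mass p (mid (s n + r) (t n + r)) \<le> ennreal c" for n
      proof -
        have "mass p (\<lambda>x. poisson (mid (s n) (t n)) (Complex x r)) \<le> mass p (mid (s n) (t n))"
          by (rule mass_poisson_le[OF p tmid[OF s(1) t(1)] r])
        also have "\<dots> \<le> ennreal c" unfolding massR[OF s(1) t(1)] using c by (rule ennreal_leI)
        finally show ?thesis by (simp add: pmid[OF s(1) t(1) r])
      qed
    qed (use p in auto)
    then show ?thesis using c0 by (simp add: massN[OF r] ennreal_le_iff)
  qed
  define D where "D = (\<lambda>s t. LINT x|lborel. norm (u s x - u t x) powr p)"
  have idif: "integrable lborel (\<lambda>x. norm (u s x - u t x) powr p)" if st: "s > 0" "t > 0" for s t
  proof -
    obtain C where C: "C \<ge> 0" "\<And>a b :: complex. norm (a - b) powr p \<le> 1 * (norm a powr p + norm b powr p)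
     + C * ((norm a powr p + norm b powr p) / 2 - norm ((a + b) / 2) powr p)"
      using uniform_convexity[OF p zero_less_one] by blast
    have "integrable lborel (\<lambda>x. 1 * (norm (u s x) powr p + norm (u t x) powr p)
        + C * ((norm (u s x) powr p + norm (u t x) powr p) / 2 - norm (mid s t x) powr p))"
      using iu[OF st(1)] iu[OF st(2)] imid[OF st]
      by (intro Bochner_Integration.integrable_add integrable_mult_right Bochner_Integration.integrable_diff integrable_divide) auto
    moreover have "(\<lambda>x. norm (u s x - u t x) powr p) \<in> borel_measurable lborel"
      using mu[OF st(1)] mu[OF st(2)] by measurable
    moreover have "norm (norm (u s x - u t x) powr p) \<le> norm (1 * (norm (u s x) powr p + norm (u t x) powr p)
        + C * ((norm (u s x) powr p + norm (u t x) powr p) / 2 - norm (mid s t x) powr p))" for x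
      unfolding real_norm_def mid_def using C(2)[of "u s x" "u t x"]
      by (intro order_trans[OF _ abs_ge_self]) simp
    ultimately show ?thesis
      by (intro Bochner_Integration.integrable_bound[where g="\<lambda>x. norm (u s x - u t x) powr p"] AE_I2)
  qed
  have massD: "mass p (\<lambda>x. u s x - u t x) = ennreal (D s t)" if "s > 0" "t > 0" for s t
    unfolding D_def by (rule mass_integral[OF idif[OF that]])
  have cauchy: "\<exists>d>0. \<forall>s t. 0 < s \<and> s < d \<and> 0 < t \<and> t < d \<longrightarrow> D s t \<le> e" if e: "e > 0" for e
  proof (rule ccontr)
    assume neg: "\<not> ?thesis"
    have "\<exists>s t. 0 < s \<and> s < inverse (real (Suc n)) \<and> 0 < t \<and> t < inverse (real (Suc n)) \<and> D s t > e" for n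
    proof -
      have "inverse (real (Suc n)) > 0" by simp
      then show ?thesis using neg by (meson not_le)
    qed
    then obtain s t where st: "\<And>n. 0 < s n" "\<And>n. s n < inverse (real (Suc n))" "\<And>n. 0 < t n"
      "\<And>n. t n < inverse (real (Suc n))" "\<And>n. D (s n) (t n) > e" by metis
    have null: "r \<longlonglongrightarrow> 0" if "\<And>n. 0 < r n" "\<And>n. r n < inverse (real (Suc n))" for r :: "nat \<Rightarrow> real"
      using that by (intro tendsto_sandwich[OF _ _ tendsto_const LIMSEQ_inverse_real_of_nat] always_eventually allI)
        (auto intro: less_imp_le simp del: of_nat_Suc)
    have lim: "s \<longlonglongrightarrow> 0" "t \<longlonglongrightarrow> 0"
      by (rule null[OF st(1,2)], rule null[OF st(3,4)])
    define h where "h = e / (4 * (M + 1))"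
    have h: "h > 0" using e M by (simp add: h_def)
    obtain C where C: "C \<ge> 0" "\<And>a b :: complex. norm (a - b) powr p \<le> h * (norm a powr p + norm b powr p)
     + C * ((norm a powr p + norm b powr p) / 2 - norm ((a + b) / 2) powr p)"
      using uniform_convexity[OF p h] by blast
    define k where "k = e / (4 * (C + 1))"
    have k: "k > 0" using e C by (simp add: k_def)
    have "S - k < S" using k by simp
    then obtain r where r: "r > 0" "S - k < N r"
      unfolding S_def using less_cSUP_iff[OF _ bddN] by (metis S_def empty_iff greaterThan_iff lt_ex gt_ex)
    have "\<not> (\<forall>n. R (s n) (t n) \<le> N r - k)"
    proof
      assume "\<forall>n. R (s n) (t n) \<le> N r - k"
      then have "N r \<le> N r - k" by (intro step1[OF r(1) st(1) lim(1) st(3) lim(2)]) auto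
      then show False using k by simp
    qed
    then obtain n where n: "R (s n) (t n) > N r - k" by (auto simp: not_le)
    have sn: "s n > 0" "t n > 0" using st by auto
    have "D (s n) (t n) \<le> (LINT x|lborel. h * (norm (u (s n) x) powr p + norm (u (t n) x) powr p)
        + C * ((norm (u (s n) x) powr p + norm (u (t n) x) powr p) / 2 - norm (mid (s n) (t n) x) powr p))"
      unfolding D_def
    proof (rule integral_mono[OF idif[OF sn]])
      show "integrable lborel (\<lambda>x. h * (norm (u (s n) x) powr p + norm (u (t n) x) powr p)
        + C * ((norm (u (s n) x) powr p + norm (u (t n) x) powr p) / 2 - norm (mid (s n) (t n) x) powr p))"
        using iu[OF sn(1)] iu[OF sn(2)] imid[OF sn]
        by (intro Bochner_Integration.integrable_add integrable_mult_right Bochner_Integration.integrable_diff integrable_divide) auto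
    qed (use C(2) in \<open>auto simp: mid_def\<close>)
    also have "\<dots> = h * (N (s n) + N (t n)) + C * ((N (s n) + N (t n)) / 2 - R (s n) (t n))"
      unfolding N_def R_def using iu[OF sn(1)] iu[OF sn(2)] imid[OF sn] by simp
    also have "\<dots> \<le> h * (2 * M) + C * (2 * k)"
    proof (intro add_mono mult_left_mono)
      show "N (s n) + N (t n) \<le> 2 * M" using NM[OF sn(1)] NM[OF sn(2)] by simp
      show "(N (s n) + N (t n)) / 2 - R (s n) (t n) \<le> 2 * k"
      proof -
        have "N (s n) + N (t n) \<le> S * 2" using NS[OF sn(1)] NS[OF sn(2)] by simp
        then have "(N (s n) + N (t n)) / 2 \<le> S" by (simp only: pos_divide_le_eq zero_less_numeral)
        moreover have "R (s n) (t n) > S - 2 * k" using n r(2) by simp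
        moreover have "a - a' \<le> 2 * k" if "a \<le> S" "a' > S - 2 * k" for a a' using that by simp
        ultimately show ?thesis by blast
      qed
    qed (use h C in auto)
    also have "\<dots> \<le> e / 2 + e / 2"
    proof (rule add_mono)
      have "M / (M + 1) \<le> 1" using M by simp
      then have "e / 2 * (M / (M + 1)) \<le> e / 2 * 1" using e by (intro mult_left_mono) auto
      moreover have "h * (2 * M) = e / 2 * (M / (M + 1))" using M by (simp add: h_def field_simps)
      ultimately show "h * (2 * M) \<le> e / 2" by simp
      have "C / (C + 1) \<le> 1" using C by simp
      then have "e / 2 * (C / (C + 1)) \<le> e / 2 * 1" using e by (intro mult_left_mono) auto
      moreover have "C * (2 * k) = e / 2 * (C / (C + 1))" using C by (simp add: k_def field_simps)
      ultimately show "C * (2 * k) \<le> e / 2" by simp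
    qed
    finally show False using st(5)[of n] by simp
  qed
  \<comment> \<open>The weights \<open>c n\<close> make the series of weighted increments below integrable, so
    that almost everywhere the increments are \<open>O(2\<^sup>-\<^sup>n)\<close>.\<close>
  define c where "c = (\<lambda>n::nat. (2 ^ n) powr p :: real)"
  have c: "c n > 0" for n by (simp add: c_def)
  have "\<forall>n::nat. \<exists>d>0. \<forall>s t. 0 < s \<and> s < d \<and> 0 < t \<and> t < d \<longrightarrow> D s t \<le> (1 / 2) ^ n / c n"
    using c by (intro allI cauchy) auto
  then obtain d where d: "\<And>n. d n > 0" "\<And>n s t. 0 < s \<Longrightarrow> s < d n \<Longrightarrow> 0 < t \<Longrightarrow> t < d n \<Longrightarrow> D s t \<le> (1 / 2) ^ n / c n"
    by metis
  define s where "s = (\<lambda>n. Min (d ` {..n}) / real (n + 2))"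
  have Mpos: "Min (d ` {..n}) > 0" for n using d(1) by simp
  have s0: "s n > 0" for n unfolding s_def using Mpos by simp
  have sd: "s n < d m" if "m \<le> n" for m n
  proof -
    have "s n < Min (d ` {..n})" unfolding s_def using Mpos[of n] by (simp add: divide_less_eq)
    also have "\<dots> \<le> d m" using that by (intro Min_le) auto
    finally show ?thesis .
  qed
  have slim: "s \<longlonglongrightarrow> 0"
  proof (rule tendsto_sandwich[OF _ _ tendsto_const])
    show "(\<lambda>n. d 0 * inverse (real (Suc n))) \<longlonglongrightarrow> 0"
      using tendsto_mult_right_zero[OF LIMSEQ_inverse_real_of_nat] .
    have "s n \<le> d 0 * inverse (real (Suc n))" for n
    proof -
      have "Min (d ` {..n}) / real (n + 2) \<le> d 0 / real (Suc n)"
        using d(1)[of 0] by (intro frac_le Min_le) auto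
      then show ?thesis by (simp add: s_def divide_inverse)
    qed
    then show "\<forall>\<^sub>F n in sequentially. s n \<le> d 0 * inverse (real (Suc n))" by simp
    show "\<forall>\<^sub>F n in sequentially. 0 \<le> s n" using s0 by (simp add: less_imp_le)
  qed
  have AEconv: "AE x in lborel. convergent (\<lambda>n. u (s n) x)"
  proof -
    have [measurable]: "u (s n) \<in> borel_measurable borel" for n by (rule mu[OF s0])
    define H where "H = (\<lambda>n x. ennreal (c n * norm (u (s (Suc n)) x - u (s n) x) powr p))"
    have [measurable]: "H n \<in> borel_measurable borel" for n
      unfolding H_def by measurable
    have "(\<integral>\<^sup>+x. H n x \<partial>lborel) \<le> ennreal ((1 / 2) ^ n)" for n
    proof -
      have "(\<integral>\<^sup>+x. H n x \<partial>lborel) = (\<integral>\<^sup>+x. ennreal (c n) * ennreal (norm (u (s (Suc n)) x - u (s n) x) powr p) \<partial>lborel)"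
        unfolding H_def using c by (simp add: ennreal_mult less_imp_le)
      also have "\<dots> = ennreal (c n) * mass p (\<lambda>x. u (s (Suc n)) x - u (s n) x)"
        unfolding mass_def by (intro nn_integral_cmult) measurable
      also have "\<dots> = ennreal (c n * D (s (Suc n)) (s n))"
        using c[of n] by (simp add: massD s0 ennreal_mult')
      also have "\<dots> \<le> ennreal ((1 / 2) ^ n)"
        using d(2)[of "s (Suc n)" n "s n"] s0 sd c[of n] by (intro ennreal_leI) (simp add: field_simps)
      finally show ?thesis .
    qed
    then have "(\<Sum>n. \<integral>\<^sup>+x. H n x \<partial>lborel) \<le> (\<Sum>n. ennreal ((1 / 2) ^ n))"
      by (intro suminf_le summableI) auto
    also have "\<dots> < \<infinity>"
      by (subst suminf_ennreal2) (auto intro!: summable_geometric)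
    finally have "(\<integral>\<^sup>+x. (\<Sum>n. H n x) \<partial>lborel) < \<infinity>" by (subst nn_integral_suminf) auto
    then have "AE x in lborel. (\<Sum>n. H n x) \<noteq> \<infinity>" by (intro nn_integral_PInf_AE) auto
    then show ?thesis
    proof eventually_elim
      case (elim x)
      define B where "B = enn2real (\<Sum>n. H n x)"
      have HB: "H n x \<le> ennreal B" for n
      proof -
        have "H n x \<le> (\<Sum>n. H n x)" using sum_le_suminf[of "\<lambda>n. H n x" "{n}"] by simp
        then show ?thesis using elim by (simp add: B_def ennreal_enn2real_if)
      qed
      have B0: "B \<ge> 0" by (simp add: B_def)
      have le: "norm (u (s (Suc n)) x - u (s n) x) \<le> B powr (1 / p) * (1 / 2) ^ n" for n
      proof -
        have "c n * norm (u (s (Suc n)) x - u (s n) x) powr p \<le> B"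
          using HB[of n] B0 by (simp add: H_def ennreal_le_iff)
        then have "(2 ^ n * norm (u (s (Suc n)) x - u (s n) x)) powr p \<le> B"
          by (simp add: c_def powr_mult)
        then have "2 ^ n * norm (u (s (Suc n)) x - u (s n) x) \<le> B powr (1 / p)"
          using p by (intro powr_le_imp_le_root) auto
        then show ?thesis by (simp add: field_simps)
      qed
      have "summable (\<lambda>n. u (s (Suc n)) x - u (s n) x)"
        by (rule summable_comparison_test'[OF summable_mult[OF summable_geometric]]) (use le in auto)
      then have "convergent (\<lambda>n. \<Sum>i<n. u (s (Suc i)) x - u (s i) x)" by (simp add: summable_iff_convergent)
      then have "convergent (\<lambda>n. u (s n) x - u (s 0) x)" by (simp only: sum_lessThan_telescope[of "\<lambda>i. u (s i) x"])
      then have "convergent (\<lambda>n. (u (s n) x - u (s 0) x) + u (s 0) x)" by (intro convergent_add convergent_const)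
      then show ?case by simp
    qed
  qed
  define g where "g = (\<lambda>x. lim (\<lambda>n. u (s n) x))"
  have mg [measurable]: "g \<in> borel_measurable borel"
    unfolding g_def using mu[OF s0] by (intro borel_measurable_lim_metric) auto
  have limg: "AE x in lborel. (\<lambda>n. u (s n) x) \<longlonglongrightarrow> g x"
    using AEconv by eventually_elim (simp add: g_def convergent_LIMSEQ_iff)
  have massg: "mass p g \<le> ennreal M"
    by (rule fatou_mass[OF mu[OF s0] limg]) (use p massu s0 in auto)
  have tg: "tame g" using massg by (intro mass_finite_tame[OF p mg]) (auto intro: le_less_trans)
  have dg: "mass p (\<lambda>x. g x - u (s n) x) \<le> ennreal ((1 / 2) ^ n / c n)" for n
  proof (rule fatou_mass[of "\<lambda>m x. u (s (m + n)) x - u (s n) x"])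
    show "(\<lambda>x. u (s (m + n)) x - u (s n) x) \<in> borel_measurable borel" for m
      using mu[OF s0[of "m + n"]] mu[OF s0[of n]] by measurable
    show "AE x in lborel. (\<lambda>m. u (s (m + n)) x - u (s n) x) \<longlonglongrightarrow> g x - u (s n) x"
      using limg by eventually_elim (intro tendsto_intros LIMSEQ_ignore_initial_segment)
    show "mass p (\<lambda>x. u (s (m + n)) x - u (s n) x) \<le> ennreal ((1 / 2) ^ n / c n)" for m
      unfolding massD[OF s0 s0] by (intro ennreal_leI d(2) s0 sd) auto
  qed (use p in auto)
  have rep: "f (Complex x r) = poisson g (Complex x r)" if r: "r > 0" for x r
  proof -
    have bd: "norm (poisson g (Complex x r) - u (s n + r) x) \<le> (1 / (pi * r)) powr (1 / p) * ((1 / 2) ^ n) powr (1 / p)" for n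
    proof -
      have e: "poisson (\<lambda>x. g x - u (s n) x) (Complex x r) = poisson g (Complex x r) - u (s n + r) x"
        using r by (simp add: poisson_diff tg tu s0 semi)
      have "ennreal (norm (poisson g (Complex x r) - u (s n + r) x) powr p) \<le> ennreal (1 / (pi * r)) * mass p (\<lambda>x. g x - u (s n) x)"
        unfolding e[symmetric] by (rule norm_poisson_powr_le[OF p tame_diff[OF tg tu[OF s0]] r])
      also have "\<dots> \<le> ennreal (1 / (pi * r)) * ennreal ((1 / 2) ^ n / c n)"
        by (rule mult_left_mono[OF dg]) simp
      also have "\<dots> = ennreal (1 / (pi * r) * ((1 / 2) ^ n / c n))"
        using r c[of n] by (intro ennreal_mult[symmetric]) auto
      finally have "norm (poisson g (Complex x r) - u (s n + r) x) powr p \<le> 1 / (pi * r) * ((1 / 2) ^ n / c n)"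
        using r c[of n] by (subst (asm) ennreal_le_iff) auto
      also have "\<dots> \<le> 1 / (pi * r) * ((1 / 2) ^ n / 1)"
      proof -
        have "c n \<ge> 1" using p by (simp add: c_def ge_one_powr_ge_zero)
        then show ?thesis using r c[of n] by (intro mult_left_mono divide_left_mono) auto
      qed
      finally have "norm (poisson g (Complex x r) - u (s n + r) x) \<le> (1 / (pi * r) * ((1 / 2) ^ n)) powr (1 / p)"
        using p by (intro powr_le_imp_le_root) auto
      also have "(1 / (pi * r) * ((1 / 2) ^ n)) powr (1 / p) = (1 / (pi * r)) powr (1 / p) * ((1 / 2) ^ n) powr (1 / p)"
        by (rule powr_mult)
      finally show ?thesis .
    qed
    have "(\<lambda>n. (1 / (pi * r)) powr (1 / p) * ((1 / 2) ^ n) powr (1 / p)) \<longlonglongrightarrow> (1 / (pi * r)) powr (1 / p) * 0 powr (1 / p)"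
      by (rule tendsto_mult[OF tendsto_const tendsto_powr2[OF LIMSEQ_power_zero tendsto_const]]) (use p in auto)
    then have bl: "(\<lambda>n. (1 / (pi * r)) powr (1 / p) * ((1 / 2) ^ n) powr (1 / p)) \<longlonglongrightarrow> 0" by simp
    have "(\<lambda>n. poisson g (Complex x r) - u (s n + r) x) \<longlonglongrightarrow> 0"
      by (rule Lim_null_comparison[OF always_eventually[OF allI[OF bd]] bl])
    moreover have "(\<lambda>n. poisson g (Complex x r) - u (s n + r) x) \<longlonglongrightarrow> poisson g (Complex x r) - u r x"
      by (intro tendsto_intros contu s0 slim r)
    ultimately have "poisson g (Complex x r) - u r x = 0" by (metis LIMSEQ_unique)
    then show ?thesis by (simp add: u_def)
  qed
  show ?thesis
  proof (rule that[OF mg massg])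
    fix z :: complex assume "Im z > 0"
    then show "f z = poisson g z" using rep[of "Im z" "Re z"] by simp
  qed
qed

section \<open>The pointwise inequality behind the sharp constant\<close>

text \<open>
  The logarithmic derivative is \<open>a (cot (a t) - cot t)\<close>, which is nonnegative as
  \<open>a \<le> 1\<close>.
\<close>

lemma sin_quotient_mono:
  fixes a x y :: real
  assumes a: "0 < a" "a \<le> 1" and xy: "0 < x" "x \<le> y" "y < pi / 2"
  shows "sin (a * x) / sin x powr a \<le> sin (a * y) / sin y powr a"
proof (rule DERIV_nonneg_imp_nondecreasing[OF xy(2)])
  fix t assume t: "x \<le> t" "t \<le> y"
  then have t0: "0 < t" "t < pi / 2" using xy by auto
  have s: "sin t > 0" using t0 by (intro sin_gt_zero) auto
  have "((\<lambda>t. sin (a * t) * sin t powr (- a)) has_real_derivative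
      (cos (a * t) * a) * sin t powr (- a) + (- a * sin t powr (- a - 1) * cos t) * sin (a * t)) (at t)"
    using s by (auto intro!: derivative_eq_intros)
  moreover have "sin t powr (- a) = sin t powr (- a - 1) * sin t"
    using powr_mult_base[of "sin t" "- a - 1"] s by (simp add: mult.commute)
  ultimately have "((\<lambda>t. sin (a * t) * sin t powr (- a)) has_real_derivative
      a * sin t powr (- a - 1) * (sin t * cos (a * t) - cos t * sin (a * t))) (at t)"
    by (simp add: algebra_simps)
  also have "sin t * cos (a * t) - cos t * sin (a * t) = sin ((1 - a) * t)"
    using sin_diff[of t "a * t"] by (simp add: algebra_simps)
  finally have der: "((\<lambda>t. sin (a * t) * sin t powr (- a)) has_real_derivative
      a * sin t powr (- a - 1) * sin ((1 - a) * t)) (at t)" .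
  have "(1 - a) * t \<le> 1 * t" using a t0 by (intro mult_right_mono) auto
  then have "(1 - a) * t \<le> pi" using t0 pi_gt_zero by linarith
  then have "sin ((1 - a) * t) \<ge> 0" using a t0 by (intro sin_ge_zero) auto
  then have "a * sin t powr (- a - 1) * sin ((1 - a) * t) \<ge> 0" using a by simp
  moreover have "(\<lambda>t. sin (a * t) / sin t powr a) = (\<lambda>t. sin (a * t) * sin t powr (- a))"
    by (simp add: powr_minus divide_inverse)
  ultimately show "\<exists>d. ((\<lambda>t. sin (a * t) / sin t powr a) has_real_derivative d) (at t) \<and> d \<ge> 0"
    using der by auto
qed

text \<open>
  After division by \<open>cos x powr p\<close> the difference of the two sides vanishes at
  \<open>x0\<close>, and its derivative has the sign of \<open>D sin ((p - 1) x) - sin x powr (p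
  - 1)\<close>. The constant \<open>D\<close> is the one for which this expression vanishes at
  \<open>x0\<close>; by the monotonicity above it changes sign there, so \<open>x0\<close> is a
  minimum. Both endpoints follow by continuity.
\<close>

lemma pichorides_angle:
  fixes p :: real
  assumes p: "1 < p" "p \<le> 2" and x: "0 \<le> x" "x \<le> pi / 2"
  defines "x0 \<equiv> pi / (2 * p)"
  defines "D \<equiv> sin x0 powr (p - 1) / cos x0"
  shows "sin x powr p \<le> tan x0 powr p * cos x powr p - D * cos (p * x)"
    and "D \<ge> 0"
proof -
  have x0: "0 < x0" "x0 < pi / 2" using p by (auto simp: x0_def field_simps)
  have s0: "sin x0 > 0" using x0 by (intro sin_gt_zero) auto
  have c0: "cos x0 > 0" using x0 by (intro cos_gt_zero) auto
  show D0: "D \<ge> 0" using s0 c0 by (simp add: D_def)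
  have px0: "p * x0 = pi / 2" using p by (simp add: x0_def)
  define W where "W = (\<lambda>t. tan x0 powr p - tan t powr p - D * (cos (p * t) * cos t powr (- p)))"
  define R where "R = (\<lambda>t. D * sin ((p - 1) * t) - sin t powr (p - 1))"
  have dW: "(W has_real_derivative p * cos t powr (- p - 1) * R t) (at t)" if t: "0 < t" "t < pi / 2" for t
  proof -
    have s: "sin t > 0" using t by (intro sin_gt_zero) auto
    have c: "cos t > 0" using t by (intro cos_gt_zero) auto
    have tn: "tan t > 0" using s c by (simp add: tan_def)
    have 1: "(W has_real_derivative
       - (p * tan t powr (p - 1) * inverse ((cos t)\<^sup>2))
       - D * (- (sin (p * t) * p) * cos t powr (- p) + (- p * cos t powr (- p - 1) * (- sin t)) * cos (p * t))) (at t)"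
      unfolding W_def using tn c
      by (auto intro!: derivative_eq_intros)
    have c1: "cos t powr (- p) = cos t powr (- p - 1) * cos t"
      using powr_mult_base[of "cos t" "- p - 1"] c by (simp add: mult.commute)
    have "tan t powr (p - 1) * inverse ((cos t)\<^sup>2) = sin t powr (p - 1) * (cos t powr (- (p - 1)) * cos t powr (- 2))"
    proof -
      have 1: "tan t powr (p - 1) = sin t powr (p - 1) / cos t powr (p - 1)"
        using s c by (simp add: tan_def powr_divide)
      have 2: "inverse ((cos t)\<^sup>2) = cos t powr (- 2)" using c by (simp add: powr_minus)
      have 3: "x / cos t powr (p - 1) = x * cos t powr (- (p - 1))" for x
        by (simp only: powr_minus divide_inverse)
      show ?thesis by (simp only: 1 2 3 mult.assoc)
    qed
    also have "cos t powr (- (p - 1)) * cos t powr (- 2) = cos t powr (- p - 1)"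
      unfolding powr_add[symmetric] by (rule arg_cong[of _ _ "\<lambda>a. cos t powr a"]) simp
    finally have c2: "tan t powr (p - 1) * inverse ((cos t)\<^sup>2) = sin t powr (p - 1) * cos t powr (- p - 1)" .
    have c3: "sin (p * t) * cos t - sin t * cos (p * t) = sin ((p - 1) * t)"
      using sin_diff[of "p * t" t] by (simp add: algebra_simps)
    have "- (p * tan t powr (p - 1) * inverse ((cos t)\<^sup>2))
       - D * (- (sin (p * t) * p) * cos t powr (- p) + (- p * cos t powr (- p - 1) * (- sin t)) * cos (p * t))
      = - (p * (sin t powr (p - 1) * cos t powr (- p - 1))) + D * (p * cos t powr (- p - 1) * (sin (p * t) * cos t - sin t * cos (p * t)))"
      unfolding c1 mult.assoc c2 by (simp add: algebra_simps)
    also have "\<dots> = p * cos t powr (- p - 1) * R t" unfolding c3 R_def by (simp add: algebra_simps)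
    finally show ?thesis using 1 by (simp only:)
  qed
  have q0: "sin ((p - 1) * x0) / sin x0 powr (p - 1) = 1 / D"
  proof -
    have "(p - 1) * x0 = pi / 2 - x0" using px0 by (simp add: algebra_simps)
    then have "sin ((p - 1) * x0) = cos x0" by (simp add: sin_diff)
    then show ?thesis by (simp add: D_def)
  qed
  have Dpos: "D > 0" using s0 c0 by (simp add: D_def)
  have Rle: "R t \<le> 0" if t: "0 < t" "t \<le> x0" for t
  proof -
    have s: "sin t powr (p - 1) > 0" using t x0 sin_gt_zero[of t] by simp
    have "sin ((p - 1) * t) / sin t powr (p - 1) \<le> 1 / D"
      unfolding q0[symmetric] by (rule sin_quotient_mono) (use p t x0 in auto)
    then show ?thesis using s Dpos by (simp add: R_def field_simps)
  qed
  have Rge: "R t \<ge> 0" if t: "x0 \<le> t" "t < pi / 2" for t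
  proof -
    have s: "sin t powr (p - 1) > 0" using t x0 sin_gt_zero[of t] by simp
    have "1 / D \<le> sin ((p - 1) * t) / sin t powr (p - 1)"
      unfolding q0[symmetric] by (rule sin_quotient_mono) (use p t x0 in auto)
    then show ?thesis using s Dpos by (simp add: R_def field_simps)
  qed
  have W0: "W x0 = 0" by (simp add: W_def px0)
  have Wge: "W t \<ge> 0" if t: "0 < t" "t < pi / 2" for t
  proof (cases "t \<le> x0")
    case True
    have "W x0 \<le> W t"
    proof (rule DERIV_nonpos_imp_nonincreasing[OF True])
      fix s assume s: "t \<le> s" "s \<le> x0"
      have "p * cos s powr (- p - 1) * R s \<le> 0" using Rle[of s] s t p by (intro mult_nonneg_nonpos) auto
      then show "\<exists>d. (W has_real_derivative d) (at s) \<and> d \<le> 0" using dW[of s] s t x0 by auto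
    qed
    then show ?thesis using W0 by simp
  next
    case False
    have "W x0 \<le> W t"
    proof (rule DERIV_nonneg_imp_nondecreasing[of x0 t W])
      show "x0 \<le> t" using False by simp
      fix s assume s: "x0 \<le> s" "s \<le> t"
      have "p * cos s powr (- p - 1) * R s \<ge> 0" using Rge[of s] s t p by (intro mult_nonneg_nonneg) auto
      then show "\<exists>d. (W has_real_derivative d) (at s) \<and> d \<ge> 0" using dW[of s] s t x0 by auto
    qed
    then show ?thesis using W0 by simp
  qed
  define H where "H = (\<lambda>t. tan x0 powr p * cos t powr p - D * cos (p * t) - sin t powr p)"
  have Hge: "H t \<ge> 0" if t: "t \<in> {0<..<pi / 2}" for t
  proof -
    have s: "sin t > 0" using t by (intro sin_gt_zero) auto
    have c: "cos t > 0" using t by (intro cos_gt_zero) auto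
    have "tan t powr p * cos t powr p = sin t powr p"
      using s c by (simp add: tan_def powr_divide)
    moreover have "cos t powr (- p) * cos t powr p = 1" using c by (simp flip: powr_add)
    ultimately have "H t = W t * cos t powr p"
      unfolding H_def W_def by (simp add: left_diff_distrib mult.assoc)
    then show ?thesis using Wge[of t] t by simp
  qed
  have cl: "closure {0<..<pi / 2} = {0..pi / 2}" by (rule closure_greaterThanLessThan) simp
  have c1: "continuous_on {0..pi / 2} (\<lambda>t. cos t powr p)"
    by (rule continuous_on_powr'[OF continuous_on_cos[OF continuous_on_id] continuous_on_const])
       (use p in \<open>auto intro!: cos_ge_zero\<close>)
  have c2: "continuous_on {0..pi / 2} (\<lambda>t. sin t powr p)"
    by (rule continuous_on_powr'[OF continuous_on_sin[OF continuous_on_id] continuous_on_const])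
       (use p in \<open>auto intro!: sin_ge_zero\<close>)
  have "continuous_on {0..pi / 2} H" unfolding H_def
    by (intro continuous_on_diff continuous_on_mult continuous_on_const c1 c2 continuous_on_cos continuous_on_id)
  then have "H x \<ge> 0"
    using continuous_ge_on_closure[of "{0<..<pi / 2}" H x 0] x Hge by (simp add: cl)
  then show "sin x powr p \<le> tan x0 powr p * cos x powr p - D * cos (p * x)" by (simp add: H_def)
qed

text \<open>
  For \<open>e = 0\<close> this is the subharmonic function in the inequality of Pichorides. A
  shift \<open>e > 0\<close> keeps the base away from 0, where the power is not holomorphic.
\<close>

definition folded_power :: "real \<Rightarrow> real \<Rightarrow> complex \<Rightarrow> real" where
  "folded_power p e w = Re (Complex (\<bar>Re w\<bar> + e) (Im w) powr of_real p)"

lemma Re_powr_polar: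
  fixes w :: complex
  assumes "w \<noteq> 0"
  shows "Re (w powr of_real p) = norm w powr p * cos (p * Im (Ln w))"
  using assms by (simp add: powr_def Re_exp)

lemma folded_power_bound:
  assumes p: "0 < p" and e: "e \<ge> 0"
  shows "\<bar>folded_power p e w\<bar> \<le> (norm w + e) powr p"
proof -
  have "norm (Complex (\<bar>Re w\<bar> + e) (Im w)) \<le> norm (Complex \<bar>Re w\<bar> (Im w)) + norm (of_real e :: complex)"
    by (metis complex_of_real_def norm_triangle_ineq complex_add add.right_neutral)
  also have "norm (Complex \<bar>Re w\<bar> (Im w)) = norm w" by (simp add: cmod_def)
  finally have le: "norm (Complex (\<bar>Re w\<bar> + e) (Im w)) \<le> norm w + e" using e by simp
  have "\<bar>folded_power p e w\<bar> \<le> norm (Complex (\<bar>Re w\<bar> + e) (Im w) powr of_real p)"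
    unfolding folded_power_def by (rule abs_Re_le_cmod)
  also have "\<dots> = norm (Complex (\<bar>Re w\<bar> + e) (Im w)) powr p" by (simp add: norm_powr_real_powr')
  also have "\<dots> \<le> (norm w + e) powr p" using le p by (intro powr_mono2) auto
  finally show ?thesis .
qed

text \<open>
  The previous inequality in polar coordinates.
\<close>

lemma pichorides_inequality:
  assumes p: "1 < p" "p \<le> 2"
  obtains D where "D \<ge> 0"
    "\<And>w. \<bar>Im w\<bar> powr p \<le> tan (pi / (2 * p)) powr p * \<bar>Re w\<bar> powr p - D * folded_power p 0 w"
proof -
  define x0 where "x0 = pi / (2 * p)"
  define D where "D = sin x0 powr (p - 1) / cos x0"
  have D0: "D \<ge> 0" using pichorides_angle(2)[OF p, of 0] by (simp add: D_def x0_def)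
  have "\<bar>Im w\<bar> powr p \<le> tan x0 powr p * \<bar>Re w\<bar> powr p - D * folded_power p 0 w" for w
  proof (cases "w = 0")
    case True
    then show ?thesis using p by (simp add: folded_power_def flip: zero_complex.code)
  next
    case False
    define v where "v = Complex \<bar>Re w\<bar> (Im w)"
    have v0: "v \<noteq> 0" using False by (auto simp: v_def complex_eq_iff)
    define t where "t = Im (Ln v)"
    have t: "\<bar>t\<bar> \<le> pi / 2" unfolding t_def using Re_Ln_pos_le[OF v0] by (simp add: v_def)
    have "v = of_real (norm v) * exp (\<i> * of_real t)"
    proof -
      have "exp (Ln v) = exp (of_real (Re (Ln v))) * exp (\<i> * of_real (Im (Ln v)))"
        by (metis complex_eq exp_add)
      then show ?thesis using v0 by (simp add: t_def exp_of_real)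
    qed
    then have v: "v = of_real (norm v) * cis t" by (simp only: cis_conv_exp)
    have "Re v = norm v * cos t" "Im v = norm v * sin t" by (subst v, simp)+
    then have re: "\<bar>Re w\<bar> = norm v * cos t" and im: "Im w = norm v * sin t" by (simp_all add: v_def)
    have sa: "\<bar>sin t\<bar> = sin \<bar>t\<bar>"
    proof (cases "t \<ge> 0")
      case True
      then have "sin t \<ge> 0" using t by (intro sin_ge_zero) auto
      then show ?thesis using True by simp
    next
      case False
      then have "sin (- t) \<ge> 0" using t by (intro sin_ge_zero) auto
      then show ?thesis using False by simp
    qed
    have ca: "cos \<bar>t\<bar> = cos t" "cos (p * \<bar>t\<bar>) = cos (p * t)" by (auto simp: abs_if)
    have cge: "cos t \<ge> 0" using t by (intro cos_ge_zero) auto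
    have "sin \<bar>t\<bar> powr p \<le> tan x0 powr p * cos \<bar>t\<bar> powr p - D * cos (p * \<bar>t\<bar>)"
      unfolding D_def x0_def using t by (intro pichorides_angle p) auto
    then have "norm v powr p * (sin \<bar>t\<bar> powr p) \<le> norm v powr p * (tan x0 powr p * cos t powr p - D * cos (p * t))"
      unfolding ca by (intro mult_left_mono) auto
    moreover have "norm v powr p * (sin \<bar>t\<bar> powr p) = \<bar>Im w\<bar> powr p"
      unfolding im abs_mult sa by (simp add: powr_mult)
    moreover have "norm v powr p * cos t powr p = \<bar>Re w\<bar> powr p"
      unfolding re by (simp add: powr_mult)
    moreover have "folded_power p 0 w = norm v powr p * cos (p * t)"
      unfolding folded_power_def t_def by (simp add: Re_powr_polar v0 flip: v_def)
    moreover have "N * (T * c - D * d) = T * (N * c) - D * (N * d)" for N T c d :: real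
      by (simp add: algebra_simps)
    ultimately show ?thesis by metis
  qed
  then show ?thesis using D0 that[of D] by (simp add: x0_def)
qed

section \<open>Subharmonicity of the folded power\<close>

text \<open>
  The derivative in the horizontal direction is \<open>p Re (w powr (p - 1))\<close>. It is
  nonnegative because the argument of \<open>w\<close> is at most \<open>pi / 2\<close> in
  absolute value and \<open>p - 1 \<le> 1\<close>.
\<close>

lemma Re_powr_mono:
  assumes p: "1 < p" "p \<le> 2" and xy: "0 < x" "x \<le> y"
  shows "Re (Complex x b powr of_real p) \<le> Re (Complex y b powr of_real p)"
proof (rule DERIV_nonneg_imp_nondecreasing[OF xy(2)])
  fix t assume "x \<le> t" "t \<le> y"
  then have t: "t > 0" using xy by simp
  define w where "w = Complex t b"
  have w0: "w \<noteq> 0" "Re w > 0" using t by (auto simp: w_def complex_eq_iff)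
  have "((\<lambda>z. z powr of_real p) has_field_derivative of_real p * w powr (of_real p - 1)) (at w)"
    using w0 by (intro has_field_derivative_powr) (auto simp: complex_nonpos_Reals_iff)
  then have "((\<lambda>z. z powr of_real p) has_derivative (\<lambda>h. (of_real p * w powr (of_real p - 1)) * h)) (at w)"
    by (simp add: has_field_derivative_def)
  from has_derivative_Re[OF this]
  have "((\<lambda>z. Re (z powr of_real p)) has_derivative
     (\<lambda>h. Re h * Re (of_real p * w powr (of_real p - 1)) + Im h * (- Im (of_real p * w powr (of_real p - 1)))))
     (at (\<i> * of_real b + of_real t))"
    by (simp add: w_def Complex_eq algebra_simps)
  from horizontal_derivative[OF this]
  have der: "((\<lambda>t. Re (Complex t b powr of_real p)) has_real_derivative Re (of_real p * w powr (of_real p - 1))) (at t)"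
    by (simp add: Complex_eq add.commute)
  have arg: "\<bar>Im (Ln w)\<bar> \<le> pi / 2" using Re_Ln_pos_le[OF w0(1)] w0(2) by simp
  have "\<bar>(p - 1) * Im (Ln w)\<bar> \<le> 1 * (pi / 2)"
    unfolding abs_mult using p arg by (intro mult_mono) auto
  then have "cos ((p - 1) * Im (Ln w)) \<ge> 0" by (intro cos_ge_zero) auto
  moreover have "Re (w powr (of_real p - 1)) = norm w powr (p - 1) * cos ((p - 1) * Im (Ln w))"
    using Re_powr_polar[OF w0(1), of "p - 1"] by simp
  ultimately have "Re (of_real p * w powr (of_real p - 1)) \<ge> 0" using p by simp
  with der show "\<exists>d. ((\<lambda>t. Re (Complex t b powr of_real p)) has_real_derivative d) (at t) \<and> d \<ge> 0" by blast
qed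

text \<open>
  Near \<open>z\<close> one of \<open>F + e\<close> and \<open>e - F\<close> has positive real
  part, and its \<open>p\<close>-th power is the required holomorphic function: conjugating the
  base does not change the real part of the power, and folding only increases it.
\<close>

lemma folded_power_touch:
  assumes p: "1 < p" "p \<le> 2" and e: "e > 0"
    and F: "F holomorphic_on upper_half_plane" and z: "Im z > 0"
  obtains r Q where "r > 0" "ball z r \<subseteq> upper_half_plane" "Q holomorphic_on ball z r"
    "Re (Q z) = folded_power p e (F z)" "\<And>v. v \<in> ball z r \<Longrightarrow> Re (Q v) \<le> folded_power p e (F v)"
proof -
  have zH: "z \<in> upper_half_plane" using z by (simp add: upper_half_plane_def)
  have contF: "isCont F z"
    using holomorphic_on_imp_continuous_on[OF F] open_upper_half_plane zH by (simp add: continuous_on_eq_continuous_at)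
  obtain r0 where r0: "r0 > 0" "ball z r0 \<subseteq> upper_half_plane"
    using open_upper_half_plane zH by (auto simp: open_contains_ball)
  define \<sigma> :: real where "\<sigma> = (if Re (F z) \<ge> 0 then 1 else -1)"
  have \<sigma>: "\<sigma> = 1 \<or> \<sigma> = -1" "\<sigma> * Re (F z) = \<bar>Re (F z)\<bar>" by (auto simp: \<sigma>_def)
  have "isCont (\<lambda>v. \<sigma> * Re (F v)) z" 
    by (intro isCont_mult continuous_const bounded_linear.isCont[OF bounded_linear_Re contF])
  moreover have "\<sigma> * Re (F z) > - e" using \<sigma>(2) e by simp
  ultimately have "\<forall>\<^sub>F v in at z. \<sigma> * Re (F v) > - e"
    unfolding isCont_def by (rule order_tendstoD(1))
  then obtain r1 where r1: "r1 > 0" "\<And>v. v \<noteq> z \<Longrightarrow> dist v z < r1 \<Longrightarrow> \<sigma> * Re (F v) > - e"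
    unfolding eventually_at by auto
  define r where "r = min r0 r1"
  have r: "r > 0" "ball z r \<subseteq> upper_half_plane" using r0 r1 by (auto simp: r_def)
  have pos: "\<sigma> * Re (F v) + e > 0" if "v \<in> ball z r" for v
  proof (cases "v = z")
    case True
    then show ?thesis using \<sigma>(2) e by (simp add: add_nonneg_pos)
  next
    case False
    then show ?thesis using r1(2)[of v] that by (simp add: r_def dist_commute)
  qed
  define Q where "Q = (\<lambda>v. (of_real \<sigma> * F v + of_real e) powr of_real p)"
  have ReQ: "Re (Q v) = Re (Complex (\<sigma> * Re (F v) + e) (Im (F v)) powr of_real p)" if v: "v \<in> ball z r" for v
  proof (cases "\<sigma> = 1")
    case True
    have "of_real \<sigma> * F v + of_real e = Complex (\<sigma> * Re (F v) + e) (Im (F v))"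
      using True by (simp add: complex_eq_iff)
    then show ?thesis by (simp add: Q_def)
  next
    case False
    then have s: "\<sigma> = -1" using \<sigma>(1) by simp
    have eq: "of_real \<sigma> * F v + of_real e = cnj (Complex (\<sigma> * Re (F v) + e) (Im (F v)))"
      using s by (simp add: complex_eq_iff)
    have "cnj (Complex (\<sigma> * Re (F v) + e) (Im (F v)) powr of_real p) = cnj (Complex (\<sigma> * Re (F v) + e) (Im (F v))) powr cnj (of_real p)"
      using pos[OF v] by (intro cnj_powr) auto
    then have "Q v = cnj (Complex (\<sigma> * Re (F v) + e) (Im (F v)) powr of_real p)"
      unfolding Q_def eq by simp
    then show ?thesis by simp
  qed
  show ?thesis
  proof (rule that[OF r])
    show "Q holomorphic_on ball z r"
      unfolding Q_def
    proof (intro holomorphic_intros holomorphic_on_subset[OF F r(2)])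
      fix v assume "v \<in> ball z r"
      then have "Re (of_real \<sigma> * F v + of_real e) > 0" using pos by simp
      then show "of_real \<sigma> * F v + of_real e \<notin> \<real>\<^sub>\<le>\<^sub>0" by (auto simp: complex_nonpos_Reals_iff)
    qed
    show "Re (Q z) = folded_power p e (F z)"
      using ReQ[of z] r(1) by (simp add: folded_power_def \<sigma>(2))
    show "Re (Q v) \<le> folded_power p e (F v)" if v: "v \<in> ball z r" for v
      unfolding ReQ[OF v] folded_power_def
    proof (rule Re_powr_mono[OF p pos[OF v]])
      show "\<sigma> * Re (F v) + e \<le> \<bar>Re (F v)\<bar> + e" using \<sigma>(1) by auto
    qed
  qed
qed

lemma continuous_on_powr_right_half_plane:
  assumes "p > 0"
  shows "continuous_on {w. Re w \<ge> 0} (\<lambda>w. w powr of_real p)"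
  using assms by (intro continuous_intros) auto

lemma continuous_on_folded_power:
  assumes p: "p > 0" and e: "e \<ge> 0"
  shows "continuous_on UNIV (folded_power p e)"
proof -
  have "continuous_on UNIV (\<lambda>w. Complex (\<bar>Re w\<bar> + e) (Im w))"
    unfolding Complex_eq by (intro continuous_intros)
  then have "continuous_on UNIV (\<lambda>w. Complex (\<bar>Re w\<bar> + e) (Im w) powr of_real p)"
    by (rule continuous_on_compose2[OF continuous_on_powr_right_half_plane[OF p]]) (use e in auto)
  then show ?thesis unfolding folded_power_def[abs_def] by (rule continuous_on_Re)
qed

lemma folded_power_uniform:
  assumes p: "p > 0" and \<eta>: "\<eta> > 0"
  obtains e where "0 < e" "e \<le> 1" "\<And>w. norm w \<le> B \<Longrightarrow> \<bar>folded_power p e w - folded_power p 0 w\<bar> < \<eta>"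
proof -
  define S where "S = {w. Re w \<ge> 0} \<inter> cball 0 (B + 1)"
  have "compact S" unfolding S_def
    by (intro closed_Int_compact closed_halfspace_Re_ge compact_cball)
  moreover have "continuous_on S (\<lambda>w. w powr of_real p)"
    by (rule continuous_on_subset[OF continuous_on_powr_right_half_plane[OF p]]) (auto simp: S_def)
  ultimately have "uniformly_continuous_on S (\<lambda>w. w powr of_real p)" by (rule compact_uniformly_continuous[rotated])
  then obtain d where d: "d > 0" "\<And>w w'. w \<in> S \<Longrightarrow> w' \<in> S \<Longrightarrow> dist w' w < d \<Longrightarrow> dist (w' powr of_real p) (w powr of_real p) < \<eta>"
    using \<eta> unfolding uniformly_continuous_on_def by meson
  define e where "e = min (d / 2) 1"
  have e: "0 < e" "e \<le> 1" "e < d" using d(1) by (auto simp: e_def)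
  show ?thesis
  proof (rule that[OF e(1,2)])
    fix w :: complex assume w: "norm w \<le> B"
    have 1: "norm (Complex \<bar>Re w\<bar> (Im w)) = norm w" by (simp add: cmod_def)
    have 2: "Complex (\<bar>Re w\<bar> + e) (Im w) = Complex \<bar>Re w\<bar> (Im w) + of_real e" by (simp add: complex_eq_iff)
    have "norm (Complex (\<bar>Re w\<bar> + e) (Im w)) \<le> norm w + e"
      unfolding 2 using norm_triangle_ineq[of "Complex \<bar>Re w\<bar> (Im w)" "of_real e"] 1 e by simp
    then have in1: "Complex (\<bar>Re w\<bar> + e) (Im w) \<in> S" using w e by (simp add: S_def)
    have in2: "Complex \<bar>Re w\<bar> (Im w) \<in> S" using w 1 by (simp add: S_def)
    have "dist (Complex (\<bar>Re w\<bar> + e) (Im w)) (Complex \<bar>Re w\<bar> (Im w)) < d"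
      unfolding 2 using e by (simp add: dist_norm)
    from d(2)[OF in2 in1 this]
    have "norm (Complex (\<bar>Re w\<bar> + e) (Im w) powr of_real p - Complex \<bar>Re w\<bar> (Im w) powr of_real p) < \<eta>"
      by (simp add: dist_norm)
    then show "\<bar>folded_power p e w - folded_power p 0 w\<bar> < \<eta>"
      unfolding folded_power_def using abs_Re_le_cmod[of "Complex (\<bar>Re w\<bar> + e) (Im w) powr of_real p - Complex \<bar>Re w\<bar> (Im w) powr of_real p"]
      by simp
  qed
qed

text \<open>
  Write \<open>h0\<close> for the folded power on the line \<open>Im z = s\<close>. The maximum
  principle gives \<open>folded_power p 0 (F (z + \<i> s)) \<le> P[h0] z\<close>. At \<open>z =
  \<i> n\<close>, multiplied by \<open>pi n\<close>, the right-hand side tends to the integral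
  of \<open>h0\<close>, while the left-hand side is at least of order \<open>- n powr (1 -
  p)\<close>.
\<close>

lemma folded_power_integral_nonneg:
  assumes p: "1 < p" "p \<le> 2" and F: "F holomorphic_on upper_half_plane" and s: "s > 0"
    and decay: "\<And>z. Im z \<ge> s \<Longrightarrow> norm (F z) \<le> C / (1 + norm z)"
  shows "integrable lborel (\<lambda>t. folded_power p 0 (F (Complex t s)))"
    and "(LINT t|lborel. folded_power p 0 (F (Complex t s))) \<ge> 0"
proof -
  have C0: "C \<ge> 0"
  proof -
    have "0 \<le> C / (1 + norm (\<i> * of_real s))" using decay[of "\<i> * of_real s"] s by (intro order_trans[OF norm_ge_zero]) auto
    moreover have "1 + norm (\<i> * of_real s) > 0" using s by (simp add: add_pos_nonneg)
    ultimately show ?thesis by (simp add: zero_le_divide_iff)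
  qed
  have decayC: "norm (F z) \<le> C" if "Im z \<ge> s" for z
  proof -
    have "C / (1 + norm z) \<le> C / 1" using C0 by (intro divide_left_mono) (auto intro: add_pos_nonneg)
    then show ?thesis using decay[OF that] by simp
  qed
  have contF: "continuous_on upper_half_plane F" by (rule holomorphic_on_imp_continuous_on[OF F])
  define h0 where "h0 = (\<lambda>t. folded_power p 0 (F (Complex t s)))"
  have conth0: "continuous_on UNIV h0" unfolding h0_def
    by (rule continuous_on_compose2[OF continuous_on_folded_power continuous_on_horizontal[OF contF s]]) (use p in auto)
  have [measurable]: "h0 \<in> borel_measurable borel" by (rule borel_measurable_continuous_onI[OF conth0])
  have h0le: "\<bar>h0 t\<bar> \<le> C powr p * (1 + \<bar>t\<bar>) powr (- p)" for t
  proof -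
    have "\<bar>h0 t\<bar> \<le> norm (F (Complex t s)) powr p" using folded_power_bound[of p 0 "F (Complex t s)"] p by (simp add: h0_def)
    also have "\<dots> \<le> (C / (1 + \<bar>t\<bar>)) powr p"
    proof (rule powr_mono2)
      have "norm (F (Complex t s)) \<le> C / (1 + norm (Complex t s))" using decay[of "Complex t s"] by simp
      also have "\<dots> \<le> C / (1 + \<bar>t\<bar>)"
        using C0 abs_Re_le_cmod[of "Complex t s"] by (intro divide_left_mono) (auto intro: add_pos_nonneg mult_pos_pos)
      finally show "norm (F (Complex t s)) \<le> C / (1 + \<bar>t\<bar>)" .
    qed (use p in auto)
    also have "\<dots> = C powr p / (1 + \<bar>t\<bar>) powr p" using C0 by (simp add: powr_divide)
    also have "\<dots> = C powr p * (1 + \<bar>t\<bar>) powr (- p)" by (simp only: powr_minus divide_inverse)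
    finally show ?thesis .
  qed
  show int: "integrable lborel (\<lambda>t. folded_power p 0 (F (Complex t s)))"
    unfolding h0_def[symmetric]
  proof (rule Bochner_Integration.integrable_bound[OF integrable_mult_right[OF integrable_powr_tail]])
    show "AE t in lborel. norm (h0 t) \<le> norm (C powr p * (1 + \<bar>t\<bar>) powr (- p))"
      using h0le by (intro AE_I2) (simp add: abs_mult)
  qed (use p in auto)
  then have int0: "integrable lborel h0" by (simp add: h0_def)
  have h0B: "\<bar>h0 t\<bar> \<le> C powr p" for t
  proof -
    have "C powr p * (1 + \<bar>t\<bar>) powr (- p) \<le> C powr p * (1 + \<bar>t\<bar>) powr 0"
      using p by (intro mult_left_mono powr_mono) auto
    moreover have "(1 + \<bar>t\<bar>) powr 0 = 1"
    proof -
      have "1 + \<bar>t\<bar> \<noteq> 0" by linarith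
      then show ?thesis by simp
    qed
    ultimately show ?thesis using h0le[of t] by (simp only: mult_1_right)
  qed
  define h :: "real \<Rightarrow> complex" where "h = (\<lambda>t. of_real (h0 t))"
  have conth: "continuous_on UNIV h" unfolding h_def by (intro continuous_intros conth0)
  have tame: "tame (\<lambda>t. of_real (h0 t))"
  proof -
    have "integrable lborel (\<lambda>t. norm (complex_of_real (h0 t)) / (1 + \<bar>t\<bar>))"
    proof (rule Bochner_Integration.integrable_bound[OF int0])
      show "AE t in lborel. norm (norm (complex_of_real (h0 t)) / (1 + \<bar>t\<bar>)) \<le> norm (h0 t)"
      proof (intro AE_I2)
        fix t
        have "\<bar>h0 t\<bar> / (1 + \<bar>t\<bar>) \<le> \<bar>h0 t\<bar> / 1" by (intro divide_left_mono) auto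
        then show "norm (norm (complex_of_real (h0 t)) / (1 + \<bar>t\<bar>)) \<le> norm (h0 t)" by simp
      qed
    qed measurable
    then show ?thesis by (simp add: tame_def)
  qed
  obtain P where P: "continuous_on UNIV P" "\<And>z. Im z > 0 \<Longrightarrow> P z = poisson h z"
    "\<And>z. Im z = 0 \<Longrightarrow> P z = h (Re z)" "\<And>z. norm (P z) \<le> C powr p"
    using poisson_continuous_extension[OF conth, of "C powr p"] h0B by (auto simp: h_def)
  define Fs where "Fs = (\<lambda>z. F (z + \<i> * of_real s))"
  have holFs: "Fs holomorphic_on upper_half_plane"
    unfolding Fs_def by (rule holomorphic_on_upper_half_plane_shift[OF F]) (use s in simp)
  have contFs: "continuous_on {z. Im z \<ge> 0} Fs" unfolding Fs_def
    by (rule continuous_on_compose2[OF contF]) (use s in \<open>auto intro!: continuous_intros simp: upper_half_plane_def\<close>)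
  have FsC: "norm (Fs z) \<le> C" if "Im z \<ge> 0" for z unfolding Fs_def using that by (intro decayC) simp
  have holK: "cauchy_transform h holomorphic_on upper_half_plane"
    unfolding h_def by (rule holomorphic_cauchy_transform[OF tame]) (auto simp: upper_half_plane_def)
  have major: "folded_power p 0 (Fs z) \<le> Re (poisson h z)" if z: "Im z > 0" for z
  proof (rule field_le_epsilon)
    fix \<eta>' :: real assume "\<eta>' > 0"
    define \<eta> where "\<eta> = \<eta>' / 2"
    have \<eta>: "\<eta> > 0" using \<open>\<eta>' > 0\<close> by (simp add: \<eta>_def)
    have p0: "p > 0" using p by simp
    obtain e where e: "0 < e" "e \<le> 1" "\<And>w. norm w \<le> C \<Longrightarrow> \<bar>folded_power p e w - folded_power p 0 w\<bar> < \<eta>"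
      using folded_power_uniform[OF p0 \<eta>, where B = C] by blast
    define w where "w = (\<lambda>z. folded_power p e (Fs z) - \<eta> - Re (P z))"
    have "w z \<le> 0"
    proof (rule half_plane_maximum_principle[OF _ _ _ _ z])
      have "continuous_on {z. Im z \<ge> 0} (\<lambda>z. folded_power p e (Fs z))"
        by (rule continuous_on_compose2[OF continuous_on_folded_power contFs]) (use p e in auto)
      then show "continuous_on {z. Im z \<ge> 0} w" unfolding w_def
        by (intro continuous_intros continuous_on_subset[OF P(1)]) auto
      show "w z \<le> (C + 1) powr p + C powr p" if "Im z \<ge> 0" for z
      proof -
        have "\<bar>folded_power p e (Fs z)\<bar> \<le> (norm (Fs z) + e) powr p" using p e by (intro folded_power_bound) auto
        also have "\<dots> \<le> (C + 1) powr p" using FsC[OF that] e p by (intro powr_mono2) auto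
        finally show ?thesis unfolding w_def using P(4)[of z] abs_Re_le_cmod[of "P z"] \<eta> by linarith
      qed
      show "w z \<le> 0" if "Im z = 0" for z
      proof -
        have "z + \<i> * of_real s = Complex (Re z) s" using that by (simp add: complex_eq_iff)
        then have "Re (P z) = folded_power p 0 (Fs z)" unfolding P(3)[OF that] by (simp add: h_def h0_def Fs_def)
        then show ?thesis unfolding w_def using e(3)[OF FsC[of z]] that by simp
      qed
      fix z assume z: "Im z > 0"
      obtain r Q where r: "r > 0" "ball z r \<subseteq> upper_half_plane" and Q: "Q holomorphic_on ball z r"
        "Re (Q z) = folded_power p e (Fs z)" "\<And>v. v \<in> ball z r \<Longrightarrow> Re (Q v) \<le> folded_power p e (Fs v)"
        using folded_power_touch[OF p e(1) holFs z] by blast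
      define Q' where "Q' = (\<lambda>v. Q v - of_real \<eta> - cauchy_transform h v / (pi * \<i>))"
      have RP: "Re (P v) = Re (cauchy_transform h v / (pi * \<i>))" if "Im v > 0" for v
        unfolding P(2)[OF that] h_def using that by (subst cauchy_transform_real(1)[OF tame]) auto
      have "Q' holomorphic_on ball z r" unfolding Q'_def
        by (intro holomorphic_intros Q(1) holomorphic_on_subset[OF holK r(2)]) auto
      moreover have "Re (Q' z) = w z" unfolding Q'_def w_def using Q(2) RP[OF z] by simp
      moreover have "Re (Q' v) \<le> w v" if v: "v \<in> ball z r" for v
      proof -
        have "Im v > 0" using v r(2) by (auto simp: upper_half_plane_def)
        then show ?thesis unfolding Q'_def w_def using Q(3)[OF v] RP[of v] by simp
      qed
      ultimately show "\<exists>r>0. \<exists>Q. Q holomorphic_on ball z r \<and> Re (Q z) = w z \<and> (\<forall>v\<in>ball z r. Re (Q v) \<le> w v)"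
        using r(1) by blast
    qed
    moreover have "\<bar>folded_power p e (Fs z) - folded_power p 0 (Fs z)\<bar> < \<eta>" using z by (intro e(3) FsC) auto
    ultimately have "folded_power p 0 (Fs z) \<le> Re (poisson h z) + (\<eta> + \<eta>)" unfolding w_def P(2)[OF z] by linarith
    then show "folded_power p 0 (Fs z) \<le> Re (poisson h z) + \<eta>'" by (simp add: \<eta>_def)
  qed
  have lim1: "(\<lambda>n. LINT t|lborel. (real n)\<^sup>2 / (t\<^sup>2 + (real n)\<^sup>2) * h0 t) \<longlonglongrightarrow> (LINT t|lborel. h0 t)"
  proof (rule integral_dominated_convergence[where w = "\<lambda>t. \<bar>h0 t\<bar>"])
    show "AE t in lborel. (\<lambda>n. (real n)\<^sup>2 / (t\<^sup>2 + (real n)\<^sup>2) * h0 t) \<longlonglongrightarrow> h0 t"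
    proof (intro AE_I2)
      fix t :: real
      have "(\<lambda>n. (real n)\<^sup>2 / (t\<^sup>2 + (real n)\<^sup>2)) \<longlonglongrightarrow> 1" by real_asymp
      from tendsto_mult_right[OF this, of "h0 t"] show "(\<lambda>n. (real n)\<^sup>2 / (t\<^sup>2 + (real n)\<^sup>2) * h0 t) \<longlonglongrightarrow> h0 t"
        by (simp add: mult.commute)
    qed
    show "AE t in lborel. norm ((real n)\<^sup>2 / (t\<^sup>2 + (real n)\<^sup>2) * h0 t) \<le> \<bar>h0 t\<bar>" for n
    proof (intro AE_I2)
      fix t :: real
      have "(real n)\<^sup>2 / (t\<^sup>2 + (real n)\<^sup>2) \<le> 1" by (auto simp: divide_le_eq_1 sum_power2_gt_zero_iff)
      then have "(real n)\<^sup>2 / (t\<^sup>2 + (real n)\<^sup>2) * \<bar>h0 t\<bar> \<le> 1 * \<bar>h0 t\<bar>" by (intro mult_right_mono) auto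
      then show "norm ((real n)\<^sup>2 / (t\<^sup>2 + (real n)\<^sup>2) * h0 t) \<le> \<bar>h0 t\<bar>" by (simp add: abs_mult)
    qed
  qed (use int0 in auto)
  have lower: "(LINT t|lborel. (real n)\<^sup>2 / (t\<^sup>2 + (real n)\<^sup>2) * h0 t) \<ge> - (pi * real n * (C powr p * (1 + real n) powr (- p)))"
    if n: "n > 0" for n :: nat
  proof -
    define z where "z = Complex 0 (real n)"
    have z: "Im z > 0" using n by (simp add: z_def)
    have "poisson h z = (LINT t|lborel. of_real (poisson_kernel (real n) (0 - t) * h0 t))"
      unfolding z_def h_def using poisson_eq[OF tame, of 0 "real n"] by simp
    also have "\<dots> = of_real (LINT t|lborel. poisson_kernel (real n) (0 - t) * h0 t)"
      by (rule integral_complex_of_real)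
    finally have "Re (poisson h z) = (LINT t|lborel. poisson_kernel (real n) (0 - t) * h0 t)" by simp
    then have "pi * real n * Re (poisson h z) = (LINT t|lborel. pi * real n * (poisson_kernel (real n) (0 - t) * h0 t))"
      by (simp only: integral_mult_right_zero)
    also have "\<dots> = (LINT t|lborel. (real n)\<^sup>2 / (t\<^sup>2 + (real n)\<^sup>2) * h0 t)"
      by (intro Bochner_Integration.integral_cong) (auto simp: poisson_kernel_def power2_eq_square)
    finally have e1: "pi * real n * Re (poisson h z) = (LINT t|lborel. (real n)\<^sup>2 / (t\<^sup>2 + (real n)\<^sup>2) * h0 t)" .
    have "- (C powr p * (1 + real n) powr (- p)) \<le> folded_power p 0 (Fs z)"
    proof -
      have nz: "norm (z + \<i> * of_real s) \<ge> real n"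
        using abs_Im_le_cmod[of "z + \<i> * of_real s"] s by (simp add: z_def)
      have "\<bar>folded_power p 0 (Fs z)\<bar> \<le> norm (Fs z) powr p" using folded_power_bound[of p 0 "Fs z"] p by simp
      also have "\<dots> \<le> (C / (1 + real n)) powr p"
      proof (rule powr_mono2)
        have "norm (Fs z) \<le> C / (1 + norm (z + \<i> * of_real s))" unfolding Fs_def using z by (intro decay) simp
        also have "\<dots> \<le> C / (1 + real n)" using C0 nz by (intro divide_left_mono mult_pos_pos) auto
        finally show "norm (Fs z) \<le> C / (1 + real n)" .
      qed (use p in auto)
      also have "\<dots> = C powr p / (1 + real n) powr p" using C0 by (simp add: powr_divide)
    also have "\<dots> = C powr p * (1 + real n) powr (- p)" by (simp only: powr_minus divide_inverse)
      finally show ?thesis by linarith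
    qed
    also have "\<dots> \<le> Re (poisson h z)" by (rule major[OF z])
    finally have "pi * real n * (- (C powr p * (1 + real n) powr (- p))) \<le> pi * real n * Re (poisson h z)"
      by (intro mult_left_mono) auto
    then show ?thesis unfolding e1 by simp
  qed
  have lim2: "(\<lambda>n. - (pi * real n * (C powr p * (1 + real n) powr (- p)))) \<longlonglongrightarrow> 0"
  proof -
    have "(\<lambda>n. real n * (1 + real n) powr (- p)) \<longlonglongrightarrow> 0" using p by real_asymp
    from tendsto_mult_right_zero[OF this, of "- (pi * C powr p)"] show ?thesis by (simp add: mult_ac)
  qed
  have "0 \<le> (LINT t|lborel. h0 t)"
    by (rule LIMSEQ_le[OF lim2 lim1]) (use lower in \<open>auto intro!: exI[of _ 1]\<close>)
  then show "(LINT t|lborel. folded_power p 0 (F (Complex t s))) \<ge> 0" by (simp add: h0_def)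
qed

section \<open>The sharp bound for conjugate Poisson integrals\<close>

lemma integrable_indicator_Icc [simp]: "integrable lborel (indicator {a..b} :: real \<Rightarrow> real)"
  using borel_integrable_atLeastAtMost'[of a b "\<lambda>_. 1 :: real"] by (simp add: set_integrable_def)

lemma tame_bounded_support:
  assumes [measurable]: "g \<in> borel_measurable borel"
    and B: "\<And>t. norm (g t) \<le> B" and A: "\<And>t. \<bar>t\<bar> > A \<Longrightarrow> g t = 0"
  shows "tame g"
proof -
  have "integrable lborel (\<lambda>t. B * indicator {-A..A} t)" by (intro integrable_mult_right) simp
  then have "integrable lborel (\<lambda>t. norm (g t) / (1 + \<bar>t\<bar>))"
  proof (rule Bochner_Integration.integrable_bound, measurable, intro AE_I2)
    fix t
    have "norm (g t) / (1 + \<bar>t\<bar>) \<le> norm (g t) / 1" by (intro divide_left_mono) auto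
    also have "\<dots> \<le> \<bar>B * indicator {-A..A} t\<bar>"
    proof (cases "t \<in> {-A..A}")
      case True
      then show ?thesis using B[of t] by simp
    next
      case False
      then have "\<bar>t\<bar> > A" by auto
      then show ?thesis using A[of t] by simp
    qed
    finally show "norm (norm (g t) / (1 + \<bar>t\<bar>)) \<le> norm (B * indicator {-A..A} t)" by simp
  qed
  then show ?thesis by (simp add: tame_def)
qed

lemma kernel_decay:
  assumes t: "\<bar>t\<bar> \<le> A" and s: "s > 0" and z: "Im z \<ge> s"
  shows "1 / norm (of_real t - z) \<le> ((1 + A) / s + 1) / (1 + norm z)"
proof -
  have im: "s \<le> norm (of_real t - z)"
    using abs_Im_le_cmod[of "of_real t - z"] z by simp
  have pos: "norm (of_real t - z) > 0" using im s by linarith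
  have A0: "1 + A \<ge> 0" using t by linarith
  have "norm z \<le> norm (of_real t :: complex) + norm (of_real t - z)"
    using norm_triangle_ineq4[of "of_real t" "of_real t - z"] by simp
  then have "1 + norm z \<le> (1 + A) * 1 + norm (of_real t - z)" using t by simp
  also have "\<dots> \<le> (1 + A) * (norm (of_real t - z) / s) + norm (of_real t - z)"
    using im s A0 by (intro add_right_mono mult_left_mono) auto
  also have "\<dots> = ((1 + A) / s + 1) * norm (of_real t - z)" by (simp add: algebra_simps)
  finally have le: "1 + norm z \<le> ((1 + A) / s + 1) * norm (of_real t - z)" .
  have "0 < 1 + norm z" by (simp add: add_pos_nonneg)
  with le pos show ?thesis by (simp only: pos_le_divide_eq pos_divide_le_eq times_divide_eq_left mult_1)
qed

lemma cauchy_transform_decay: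
  assumes g: "g \<in> borel_measurable borel"
    and B: "\<And>t. norm (g t) \<le> B" and A: "\<And>t. \<bar>t\<bar> > A \<Longrightarrow> g t = 0" and A0: "A \<ge> 0"
    and s: "s > 0" and z: "Im z \<ge> s"
  shows "norm (cauchy_transform g z) \<le> 2 * A * B * ((1 + A) / s + 1) / (1 + norm z)"
proof -
  define c where "c = ((1 + A) / s + 1) / (1 + norm z)"
  have c0: "c \<ge> 0" using A0 s by (simp add: c_def add_nonneg_nonneg)
  have B0: "B \<ge> 0" using B[of 0] norm_ge_zero[of "g 0"] by linarith
  have "norm (cauchy_transform g z) \<le> (LINT t|lborel. B * c * indicator {-A..A} t)"
    unfolding cauchy_transform_def
  proof (rule Bochner_Integration.integral_norm_bound_integral)
    show "integrable lborel (\<lambda>t. g t / (of_real t - z))"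
      using z s by (intro integrable_cauchy tame_bounded_support[OF g B A]) auto
    show "integrable lborel (\<lambda>t. B * c * indicator {-A..A} t)" by (intro integrable_mult_right) simp
    fix t
    show "norm (g t / (of_real t - z)) \<le> B * c * indicator {-A..A} t"
    proof (cases "\<bar>t\<bar> \<le> A")
      case True
      then have "norm (g t) * (1 / norm (of_real t - z)) \<le> B * c"
        unfolding c_def using B0 by (intro mult_mono B kernel_decay s z) auto
      then show ?thesis using True by (auto simp: norm_divide indicator_def)
    next
      case False
      then show ?thesis using A[of t] B0 c0 by simp
    qed
  qed
  also have "\<dots> = B * c * (2 * A)" using A0 by simp
  finally show ?thesis by (simp add: c_def mult_ac)
qed

lemma measurable_conj_poisson:
  assumes "tame g" "s > 0"
  shows "(\<lambda>x. conj_poisson g (Complex x s)) \<in> borel_measurable borel"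
  by (intro borel_measurable_continuous_onI continuous_on_horizontal harmonic_on_continuous harmonic_poisson assms)

lemma integrable_decay_powr:
  fixes f :: "real \<Rightarrow> complex"
  assumes p: "p > 1" and [measurable]: "f \<in> borel_measurable borel"
    and le: "\<And>x. norm (f x) \<le> C / (1 + \<bar>x\<bar>)"
  shows "integrable lborel (\<lambda>x. norm (f x) powr p)"
proof (rule Bochner_Integration.integrable_bound[OF integrable_mult_right[OF integrable_powr_tail[OF p]]])
  have C0: "C \<ge> 0" using order_trans[OF norm_ge_zero le[of 0]] by simp
  have "norm (f x) powr p \<le> C powr p * (1 + \<bar>x\<bar>) powr (- p)" for x
  proof -
    have "norm (f x) powr p \<le> (C / (1 + \<bar>x\<bar>)) powr p" using le p by (intro powr_mono2) auto
    also have "\<dots> = C powr p / (1 + \<bar>x\<bar>) powr p" using C0 by (simp add: powr_divide)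
    also have "\<dots> = C powr p * (1 + \<bar>x\<bar>) powr (- p)" by (simp only: powr_minus divide_inverse)
    finally show ?thesis .
  qed
  then show "AE x in lborel. norm (norm (f x) powr p) \<le> norm (C powr p * (1 + \<bar>x\<bar>) powr (- p))"
    by (intro AE_I2) (simp add: abs_mult)
qed measurable

text \<open>
  The functions for which all integrals in the a priori estimates are finite.
\<close>

definition test_function :: "(real \<Rightarrow> real) \<Rightarrow> bool" where
  "test_function g \<longleftrightarrow> g \<in> borel_measurable borel \<and> (\<exists>B. \<forall>t. \<bar>g t\<bar> \<le> B) \<and> (\<exists>A\<ge>0. \<forall>t. \<bar>t\<bar> > A \<longrightarrow> g t = 0)"

lemma test_function_props:
  assumes g: "test_function g" and s: "s > 0"
  shows "tame (\<lambda>t. of_real (g t))"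
    and "\<exists>C. \<forall>z. Im z \<ge> s \<longrightarrow> norm (cauchy_transform (\<lambda>t. of_real (g t)) z / (pi * \<i>)) \<le> C / (1 + norm z)"
    and "p > 1 \<Longrightarrow> integrable lborel (\<lambda>x. norm (conj_poisson (\<lambda>t. of_real (g t)) (Complex x s)) powr p)"
    and "p > 1 \<Longrightarrow> integrable lborel (\<lambda>x. norm (poisson (\<lambda>t. of_real (g t)) (Complex x s)) powr p)"
    and "p > 1 \<Longrightarrow> integrable lborel (\<lambda>x. \<bar>g x\<bar> powr p)"
proof -
  obtain A B where B: "\<And>t. \<bar>g t\<bar> \<le> B" and A: "A \<ge> 0" "\<And>t. \<bar>t\<bar> > A \<Longrightarrow> g t = 0" and [measurable]: "g \<in> borel_measurable borel"
    using g unfolding test_function_def by blast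
  show tame: "tame (\<lambda>t. of_real (g t))"
    by (rule tame_bounded_support[where A = A and B = B]) (use A B in auto)
  define C where "C = 2 * A * B * ((1 + A) / s + 1) / pi"
  have C: "norm (cauchy_transform (\<lambda>t. of_real (g t)) z / (pi * \<i>)) \<le> C / (1 + norm z)" if "Im z \<ge> s" for z
  proof -
    have "norm (cauchy_transform (\<lambda>t. of_real (g t)) z) \<le> 2 * A * B * ((1 + A) / s + 1) / (1 + norm z)"
      by (rule cauchy_transform_decay) (use A B s that in auto)
    then have "norm (cauchy_transform (\<lambda>t. of_real (g t)) z) / pi \<le> 2 * A * B * ((1 + A) / s + 1) / (1 + norm z) / pi"
      by (rule divide_right_mono) simp
    then show ?thesis by (simp add: C_def norm_divide norm_mult mult.commute[of pi])
  qed
  then show "\<exists>C. \<forall>z. Im z \<ge> s \<longrightarrow> norm (cauchy_transform (\<lambda>t. of_real (g t)) z / (pi * \<i>)) \<le> C / (1 + norm z)" by blast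
  have C0: "C \<ge> 0"
  proof -
    have "0 \<le> C / (1 + norm (\<i> * of_real s))" using C[of "\<i> * of_real s"] s by (intro order_trans[OF norm_ge_zero]) auto
    moreover have "1 + norm (\<i> * of_real s) > 0" using s by (simp add: add_pos_nonneg)
    ultimately show ?thesis by (simp add: zero_le_divide_iff)
  qed
  have Cx: "norm (cauchy_transform (\<lambda>t. of_real (g t)) (Complex x s) / (pi * \<i>)) \<le> C / (1 + \<bar>x\<bar>)" for x
  proof -
    have "norm (cauchy_transform (\<lambda>t. of_real (g t)) (Complex x s) / (pi * \<i>)) \<le> C / (1 + norm (Complex x s))"
      by (rule C) simp
    also have "\<dots> \<le> C / (1 + \<bar>x\<bar>)"
      using C0 abs_Re_le_cmod[of "Complex x s"] by (intro divide_left_mono mult_pos_pos) (auto intro: add_pos_nonneg)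
    finally show ?thesis .
  qed
  have imz: "Im (Complex x s) \<noteq> 0" for x using s by simp
  show "integrable lborel (\<lambda>x. norm (conj_poisson (\<lambda>t. of_real (g t)) (Complex x s)) powr p)" if "p > 1"
  proof (rule integrable_decay_powr[OF that measurable_conj_poisson[OF tame s]])
    fix x
    show "norm (conj_poisson (\<lambda>t. of_real (g t)) (Complex x s)) \<le> C / (1 + \<bar>x\<bar>)"
      unfolding cauchy_transform_real(2)[OF tame imz] norm_of_real
      by (rule order_trans[OF abs_Im_le_cmod Cx])
  qed
  show "integrable lborel (\<lambda>x. norm (poisson (\<lambda>t. of_real (g t)) (Complex x s)) powr p)" if "p > 1"
  proof (rule integrable_decay_powr[OF that])
    show "(\<lambda>x. poisson (\<lambda>t. of_real (g t)) (Complex x s)) \<in> borel_measurable borel"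
      by (intro borel_measurable_continuous_onI continuous_on_horizontal harmonic_on_continuous harmonic_poisson tame s)
    fix x
    show "norm (poisson (\<lambda>t. of_real (g t)) (Complex x s)) \<le> C / (1 + \<bar>x\<bar>)"
      unfolding cauchy_transform_real(1)[OF tame imz] norm_of_real
      by (rule order_trans[OF abs_Re_le_cmod Cx])
  qed
  show "integrable lborel (\<lambda>x. \<bar>g x\<bar> powr p)" if "p > 1"
  proof -
    have "integrable lborel (\<lambda>t. B powr p * indicator {-A..A} t)" by (intro integrable_mult_right) simp
    then show ?thesis
    proof (rule Bochner_Integration.integrable_bound, measurable, intro AE_I2)
      fix t
      show "norm (\<bar>g t\<bar> powr p) \<le> norm (B powr p * indicator {-A..A} t)"
      proof (cases "t \<in> {-A..A}")
        case True
        then show ?thesis using B[of t] that by (auto intro!: powr_mono2)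
      next
        case False
        then have "\<bar>t\<bar> > A" by auto
        then show ?thesis using A(2)[of t] by simp
      qed
    qed
  qed
qed

text \<open>
  Integrate the inequality of Pichorides; the subharmonic term has nonnegative integral.
\<close>

lemma conj_poisson_test_le2:
  assumes p: "1 < p" "p \<le> 2" and g: "test_function g" and s: "s > 0"
  shows "mass p (\<lambda>x. conj_poisson (\<lambda>t. of_real (g t)) (Complex x s))
    \<le> ennreal (tan (pi / (2 * p)) powr p) * mass p (\<lambda>t. of_real (g t))"
proof -
  let ?g = "\<lambda>t. complex_of_real (g t)"
  define T where "T = tan (pi / (2 * p))"
  note tame = test_function_props(1)[OF g s]
  define F where "F = (\<lambda>z. cauchy_transform ?g z / (pi * \<i>))"
  obtain C where C: "\<And>z. Im z \<ge> s \<Longrightarrow> norm (F z) \<le> C / (1 + norm z)"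
    using test_function_props(2)[OF g s] unfolding F_def by blast
  have holF: "F holomorphic_on upper_half_plane" unfolding F_def
    by (intro holomorphic_intros holomorphic_cauchy_transform tame) (auto simp: upper_half_plane_def)
  obtain D where D: "D \<ge> 0" "\<And>w. \<bar>Im w\<bar> powr p \<le> T powr p * \<bar>Re w\<bar> powr p - D * folded_power p 0 w"
    using pichorides_inequality[OF p] unfolding T_def by blast
  note fp = folded_power_integral_nonneg[OF p holF s C]
  have imz: "Im (Complex x s) \<noteq> 0" for x using s by simp
  have cF: "conj_poisson ?g (Complex x s) = of_real (Im (F (Complex x s)))"
    and pF: "poisson ?g (Complex x s) = of_real (Re (F (Complex x s)))" for x
    unfolding F_def using cauchy_transform_real[OF tame imz] by auto
  have iv: "integrable lborel (\<lambda>x. \<bar>Im (F (Complex x s))\<bar> powr p)"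
    using test_function_props(3)[OF g s p(1)] by (simp add: cF)
  have iu: "integrable lborel (\<lambda>x. \<bar>Re (F (Complex x s))\<bar> powr p)"
    using test_function_props(4)[OF g s p(1)] by (simp add: pF)
  have "(LINT x|lborel. \<bar>Im (F (Complex x s))\<bar> powr p)
     \<le> (LINT x|lborel. T powr p * \<bar>Re (F (Complex x s))\<bar> powr p - D * folded_power p 0 (F (Complex x s)))"
    using iv iu fp(1) D(2) by (intro integral_mono) auto
  also have "\<dots> = T powr p * (LINT x|lborel. \<bar>Re (F (Complex x s))\<bar> powr p) - D * (LINT x|lborel. folded_power p 0 (F (Complex x s)))"
    using iu fp(1) by simp
  also have "\<dots> \<le> T powr p * (LINT x|lborel. \<bar>Re (F (Complex x s))\<bar> powr p)"
    using D(1) fp(2) by simp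
  finally have "ennreal (LINT x|lborel. \<bar>Im (F (Complex x s))\<bar> powr p) \<le> ennreal (T powr p) * ennreal (LINT x|lborel. \<bar>Re (F (Complex x s))\<bar> powr p)"
    by (simp add: ennreal_leI flip: ennreal_mult')
  moreover have "mass p (\<lambda>x. conj_poisson ?g (Complex x s)) = ennreal (LINT x|lborel. \<bar>Im (F (Complex x s))\<bar> powr p)"
    using mass_integral[OF test_function_props(3)[OF g s p(1)]] by (simp add: cF)
  moreover have "mass p (\<lambda>x. poisson ?g (Complex x s)) = ennreal (LINT x|lborel. \<bar>Re (F (Complex x s))\<bar> powr p)"
    using mass_integral[OF test_function_props(4)[OF g s p(1)]] by (simp add: pF)
  ultimately have "mass p (\<lambda>x. conj_poisson ?g (Complex x s)) \<le> ennreal (T powr p) * mass p (\<lambda>x. poisson ?g (Complex x s))"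
    by simp
  also have "\<dots> \<le> ennreal (T powr p) * mass p ?g"
    by (intro mult_left_mono mass_poisson_le p(1) tame s) simp
  finally show ?thesis by (simp add: T_def)
qed

text \<open>
  Truncate \<open>g\<close> in height and support, and apply Fatou.
\<close>

lemma conj_poisson_extend:
  fixes g :: "real \<Rightarrow> real"
  assumes p: "p > 1" and s: "s > 0"
    and test: "\<And>g. test_function g \<Longrightarrow> mass p (\<lambda>x. conj_poisson (\<lambda>t. of_real (g t)) (Complex x s)) \<le> c * mass p (\<lambda>t. of_real (g t))"
    and [measurable]: "g \<in> borel_measurable borel" and fin: "mass p (\<lambda>t. of_real (g t)) < \<infinity>"
  shows "mass p (\<lambda>x. conj_poisson (\<lambda>t. of_real (g t)) (Complex x s)) \<le> c * mass p (\<lambda>t. of_real (g t))"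
proof -
  have tame: "tame (\<lambda>t. of_real (g t))" by (rule mass_finite_tame[OF p _ fin]) measurable
  define G where "G = (\<lambda>n t. if \<bar>t\<bar> \<le> real n \<and> \<bar>g t\<bar> \<le> real n then g t else 0)"
  have [measurable]: "G n \<in> borel_measurable borel" for n unfolding G_def by measurable
  have tf: "test_function (G n)" for n
    unfolding test_function_def by (intro conjI exI[of _ "real n"]) (auto simp: G_def)
  have Gle: "\<bar>G n t\<bar> \<le> \<bar>g t\<bar>" for n t by (auto simp: G_def)
  show ?thesis
  proof (rule fatou_mass[of "\<lambda>n x. conj_poisson (\<lambda>t. of_real (G n t)) (Complex x s)"])
    show "(\<lambda>x. conj_poisson (\<lambda>t. of_real (G n t)) (Complex x s)) \<in> borel_measurable borel" for n
      by (intro measurable_conj_poisson test_function_props(1)[OF tf s] s)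
    show "mass p (\<lambda>x. conj_poisson (\<lambda>t. of_real (G n t)) (Complex x s)) \<le> c * mass p (\<lambda>t. of_real (g t))" for n
      using p Gle by (intro order_trans[OF test[OF tf] mult_left_mono] mass_mono) auto
    show "AE x in lborel. (\<lambda>n. conj_poisson (\<lambda>t. of_real (G n t)) (Complex x s)) \<longlonglongrightarrow> conj_poisson (\<lambda>t. of_real (g t)) (Complex x s)"
    proof (intro AE_I2)
      fix x
      show "(\<lambda>n. conj_poisson (\<lambda>t. of_real (G n t)) (Complex x s)) \<longlonglongrightarrow> conj_poisson (\<lambda>t. of_real (g t)) (Complex x s)"
        unfolding conj_poisson_eq
      proof (rule integral_dominated_convergence[OF _ _ integrable_norm[OF integrable_conj_kernel_tame[OF tame s, of x]]])
        show "AE t in lborel. (\<lambda>n. of_real (conj_kernel s (x - t)) * complex_of_real (G n t)) \<longlonglongrightarrow> of_real (conj_kernel s (x - t)) * of_real (g t)"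
        proof (intro AE_I2 tendsto_eventually)
          fix t
          obtain N :: nat where N: "max \<bar>t\<bar> \<bar>g t\<bar> \<le> real N" using real_arch_simple by blast
          have "G n t = g t" if "n \<ge> N" for n
          proof -
            have "real N \<le> real n" using that by simp
            then show ?thesis using N by (auto simp: G_def)
          qed
          then show "\<forall>\<^sub>F n in sequentially. of_real (conj_kernel s (x - t)) * complex_of_real (G n t) = of_real (conj_kernel s (x - t)) * of_real (g t)"
            by (auto simp: eventually_sequentially)
        qed
        show "AE t in lborel. norm (of_real (conj_kernel s (x - t)) * complex_of_real (G n t)) \<le> norm (of_real (conj_kernel s (x - t)) * complex_of_real (g t))" for n
          using Gle by (intro AE_I2) (auto simp: norm_mult intro!: mult_left_mono)
      qed measurable
    qed
  qed (use p in auto)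
qed

text \<open>
  Duality. With \<open>v = Q[g]\<close> and \<open>h = sgn v \<bar>v\<bar> powr (p - 1)\<close>
  the oddness of the conjugate kernel gives \<open>\<integral>\<bar>v\<bar>\<^sup>p =
  \<integral> v h = - \<integral> g Q[h]\<close>. By Young with weight \<open>c\<close> and the
  known bound for \<open>Q[h]\<close> with the exponent \<open>q\<close>, this is at most
  \<open>c\<^sup>p / p\<close> times \<open>\<integral>\<bar>g\<bar>\<^sup>p\<close>, plus
  \<open>1 / q\<close> times \<open>\<integral>\<bar>v\<bar>\<^sup>p\<close>, which is finite
  and can be absorbed.
\<close>

lemma conj_poisson_test_ge2:
  assumes p: "p > 2" and g: "test_function g" and s: "s > 0"
  defines "q \<equiv> p / (p - 1)"
  shows "mass p (\<lambda>x. conj_poisson (\<lambda>t. of_real (g t)) (Complex x s))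
    \<le> ennreal (tan (pi / (2 * q)) powr p) * mass p (\<lambda>t. of_real (g t))"
proof -
  have p1: "p > 1" using p by simp
  have q: "1 < q" "q \<le> 2" "1 / p + 1 / q = 1" using p by (auto simp: q_def field_simps)
  define c where "c = tan (pi / (2 * q))"
  have c: "c > 0" unfolding c_def using q(1) by (intro tan_gt_zero) (auto simp: field_simps)
  obtain A B where B: "\<And>t. \<bar>g t\<bar> \<le> B" and A: "A \<ge> 0" "\<And>t. \<bar>t\<bar> > A \<Longrightarrow> g t = 0" and [measurable]: "g \<in> borel_measurable borel"
    using g unfolding test_function_def by blast
  have B0: "B \<ge> 0" using B[of 0] by linarith
  note tame = test_function_props(1)[OF g s]
  have cr: "conj_poisson (\<lambda>t. of_real (r t)) (Complex x s) = of_real (LINT t|lborel. conj_kernel s (x - t) * r t)" for r x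
    unfolding conj_poisson_eq by (simp flip: of_real_mult)
  define v where "v = (\<lambda>x. LINT t|lborel. conj_kernel s (x - t) * g t)"
  have vc: "conj_poisson (\<lambda>t. of_real (g t)) (Complex x s) = of_real (v x)" for x unfolding v_def by (rule cr)
  have mv [measurable]: "v \<in> borel_measurable borel"
  proof -
    have "(\<lambda>x. Re (conj_poisson (\<lambda>t. of_real (g t)) (Complex x s))) \<in> borel_measurable borel"
      using measurable_conj_poisson[OF tame s] by measurable
    then show ?thesis by (simp add: vc)
  qed
  have iv: "integrable lborel (\<lambda>x. \<bar>v x\<bar> powr p)" using test_function_props(3)[OF g s p1] by (simp add: vc)
  define V where "V = (LINT x|lborel. \<bar>v x\<bar> powr p)"
  have V0: "V \<ge> 0" unfolding V_def by (intro integral_nonneg_AE) auto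
  define h where "h = (\<lambda>x. sgn (v x) * \<bar>v x\<bar> powr (p - 1))"
  have [measurable]: "h \<in> borel_measurable borel" unfolding h_def by measurable
  have habs: "\<bar>h x\<bar> = \<bar>v x\<bar> powr (p - 1)" for x using p by (simp add: h_def abs_mult abs_sgn_eq)
  have hq: "\<bar>h x\<bar> powr q = \<bar>v x\<bar> powr p" for x
    using p unfolding habs by (simp add: powr_powr q_def)
  have vh: "v x * h x = \<bar>v x\<bar> powr p" for x
  proof -
    have "v x * h x = \<bar>v x\<bar> * \<bar>v x\<bar> powr (p - 1)" by (simp add: h_def mult_sgn_abs abs_sgn mult.assoc[symmetric])
    then show ?thesis using p by (cases "v x = 0") (auto simp: powr_mult_base)
  qed
  have massh: "mass q (\<lambda>x. of_real (h x)) = ennreal V"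
    unfolding V_def mass_def using iv by (subst nn_integral_eq_integral[symmetric]) (auto simp: hq)
  have tameh: "tame (\<lambda>x. of_real (h x))" by (rule mass_finite_tame[OF q(1)]) (auto simp: massh)
  define w where "w = (\<lambda>t. LINT x|lborel. conj_kernel s (t - x) * h x)"
  have wc: "conj_poisson (\<lambda>t. of_real (h t)) (Complex x s) = of_real (w x)" for x unfolding w_def by (rule cr)
  have mw [measurable]: "w \<in> borel_measurable borel"
  proof -
    have "(\<lambda>x. Re (conj_poisson (\<lambda>t. of_real (h t)) (Complex x s))) \<in> borel_measurable borel"
      using measurable_conj_poisson[OF tameh s] by measurable
    then show ?thesis by (simp add: wc)
  qed
  have "mass q (\<lambda>x. conj_poisson (\<lambda>t. of_real (h t)) (Complex x s)) \<le> ennreal (c powr q) * mass q (\<lambda>t. of_real (h t))"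
    unfolding c_def by (rule conj_poisson_extend[OF q(1) s conj_poisson_test_le2[OF q(1,2) _ s]]) (auto simp: massh)
  then have massw: "mass q (\<lambda>x. of_real (w x)) \<le> ennreal (c powr q * V)"
    using V0 by (simp add: wc massh ennreal_mult)
  have iw: "integrable lborel (\<lambda>x. \<bar>w x\<bar> powr q)"
    using mass_finite_integrable[of "\<lambda>x. of_real (w x)" q] le_less_trans[OF massw ennreal_less_top] by auto
  have W: "(LINT x|lborel. \<bar>w x\<bar> powr q) \<le> c powr q * V"
    using massw V0 mass_integral[of "\<lambda>x. of_real (w x)" q] iw by (simp add: ennreal_le_iff)
  have dual: "V = - (LINT t|lborel. g t * w t)"
  proof -
    define \<kappa> where "\<kappa> = ((1 + A) / s + 1) / pi"
    have kd: "\<bar>conj_kernel s (x - t)\<bar> \<le> \<kappa> / (1 + \<bar>x\<bar>)" if t: "\<bar>t\<bar> \<le> A" for x t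
    proof -
      define n where "n = norm (of_real t - Complex x s)"
      have n2: "n\<^sup>2 = (x - t)\<^sup>2 + s\<^sup>2" by (simp add: n_def cmod_power2 power2_commute)
      have n0: "n > 0" using s of_real_neq_nonreal[of "Complex x s" t] by (simp add: n_def)
      have "\<bar>x - t\<bar> \<le> n" using abs_Re_le_cmod[of "of_real t - Complex x s"] by (simp add: n_def)
      then have "\<bar>x - t\<bar> / (pi * n\<^sup>2) \<le> n / (pi * n\<^sup>2)" by (intro divide_right_mono) auto
      also have "\<dots> = 1 / n / pi" using n0 by (simp add: power2_eq_square)
      also have "1 / n \<le> ((1 + A) / s + 1) / (1 + norm (Complex x s))"
        unfolding n_def using t s by (intro kernel_decay) auto
      also have "\<dots> \<le> ((1 + A) / s + 1) / (1 + \<bar>x\<bar>)"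
        using A(1) s abs_Re_le_cmod[of "Complex x s"]
        by (intro divide_left_mono mult_pos_pos add_nonneg_nonneg) (auto intro: add_pos_nonneg)
      finally have "\<bar>x - t\<bar> / (pi * n\<^sup>2) \<le> ((1 + A) / s + 1) / (1 + \<bar>x\<bar>) / pi"
        by (simp add: divide_right_mono)
      then show ?thesis unfolding conj_kernel_def n2[symmetric] \<kappa>_def by (simp add: abs_mult mult.commute)
    qed
    let ?f = "\<lambda>x t. conj_kernel s (x - t) * g t * h x"
    let ?b = "\<lambda>(x, t). (\<bar>h x\<bar> / (1 + \<bar>x\<bar>)) * (\<kappa> * B * indicator {-A..A} t)"
    have ih: "integrable lborel (\<lambda>x. \<bar>h x\<bar> / (1 + \<bar>x\<bar>))" using tameh by (simp add: tame_def)
    have ii: "integrable lborel (\<lambda>t. \<kappa> * B * indicator {-A..A} t :: real)" by (intro integrable_mult_right) simp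
    have ib: "integrable (lborel \<Otimes>\<^sub>M lborel) ?b"
    proof (rule lborel_pair.Fubini_integrable)
      show "?b \<in> borel_measurable (lborel \<Otimes>\<^sub>M lborel)" by measurable
      have "(LINT t|lborel. norm (?b (x, t))) = (\<bar>h x\<bar> / (1 + \<bar>x\<bar>)) * (LINT t|lborel. norm (\<kappa> * B * indicator {-A..A} t :: real))" for x
      proof -
        have "norm (?b (x, t)) = (\<bar>h x\<bar> / (1 + \<bar>x\<bar>)) * norm (\<kappa> * B * indicator {-A..A} t :: real)" for t
          by (simp add: abs_mult)
        then show ?thesis by (simp only: integral_mult_right_zero)
      qed
      then show "integrable lborel (\<lambda>x. LINT t|lborel. norm (?b (x, t)))"
        using ih by (simp only: integrable_mult_left)
      show "AE x in lborel. integrable lborel (\<lambda>t. ?b (x, t))"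
        using ii by (intro AE_I2) (simp only: prod.case, rule integrable_mult_right)
    qed
    have iF: "integrable (lborel \<Otimes>\<^sub>M lborel) (\<lambda>(x, t). ?f x t)"
    proof (rule Bochner_Integration.integrable_bound[OF ib], measurable, intro AE_I2)
      fix y :: "real \<times> real"
      obtain x t where y: "y = (x, t)" by (cases y)
      have k0: "\<kappa> \<ge> 0" using A(1) s by (simp add: \<kappa>_def)
      have "\<bar>?f x t\<bar> \<le> (\<bar>h x\<bar> / (1 + \<bar>x\<bar>)) * (\<kappa> * B * indicator {-A..A} t)"
      proof (cases "\<bar>t\<bar> \<le> A")
        case True
        have "\<bar>conj_kernel s (x - t)\<bar> * \<bar>g t\<bar> * \<bar>h x\<bar> \<le> \<kappa> / (1 + \<bar>x\<bar>) * B * \<bar>h x\<bar>"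
          using kd[OF True] B k0 B0 by (intro mult_mono) auto
        then show ?thesis using True by (simp add: abs_mult indicator_def abs_le_iff mult_ac)
      next
        case False
        then show ?thesis using A(2)[of t] k0 B0 by simp
      qed
      then show "norm (case y of (x, t) \<Rightarrow> ?f x t) \<le> norm (?b y)"
        unfolding y prod.case real_norm_def by (rule order_trans[OF _ abs_ge_self])
    qed
    have "V = (LINT x|lborel. v x * h x)" unfolding V_def by (simp add: vh)
    also have "\<dots> = (LINT x|lborel. LINT t|lborel. ?f x t)"
      unfolding v_def by (simp only: integral_mult_left_zero)
    also have "\<dots> = (LINT t|lborel. LINT x|lborel. ?f x t)"
      by (rule lborel_pair.Fubini_integral[OF iF, symmetric])
    also have "\<dots> = (LINT t|lborel. - (g t * w t))"
    proof (intro Bochner_Integration.integral_cong refl)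
      fix t
      have "?f x t = - g t * (conj_kernel s (t - x) * h x)" for x
      proof -
        have "conj_kernel s (x - t) = - conj_kernel s (t - x)"
          by (simp add: conj_kernel_def power2_commute[of x t] minus_divide_left)
        then show ?thesis by simp
      qed
      then show "(LINT x|lborel. ?f x t) = - (g t * w t)" unfolding w_def
        by (simp only: integral_mult_right_zero mult_minus_left Bochner_Integration.integral_minus)
    qed
    finally show ?thesis by simp
  qed
  have ig: "integrable lborel (\<lambda>x. \<bar>g x\<bar> powr p)" by (rule test_function_props(5)[OF g s p1])
  define Gp where "Gp = (LINT x|lborel. \<bar>g x\<bar> powr p)"
  have young: "\<bar>g t * w t\<bar> \<le> c powr p / p * \<bar>g t\<bar> powr p + c powr (- q) / q * \<bar>w t\<bar> powr q" for t
  proof -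
    have "(c * \<bar>g t\<bar>) * (\<bar>w t\<bar> / c) \<le> (c * \<bar>g t\<bar>) powr p / p + (\<bar>w t\<bar> / c) powr q / q"
      using p1 q c by (intro Youngs_inequality) auto
    moreover have "(c * \<bar>g t\<bar>) * (\<bar>w t\<bar> / c) = \<bar>g t * w t\<bar>" using c by (simp add: abs_mult)
    moreover have "(c * \<bar>g t\<bar>) powr p = c powr p * \<bar>g t\<bar> powr p" by (rule powr_mult)
    moreover have "(\<bar>w t\<bar> / c) powr q = c powr (- q) * \<bar>w t\<bar> powr q"
    proof -
      have "(\<bar>w t\<bar> / c) powr q = \<bar>w t\<bar> powr q / c powr q" using c by (simp add: powr_divide)
      then show ?thesis by (simp only: powr_minus divide_inverse mult.commute)
    qed
    ultimately show ?thesis by simp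
  qed
  have iyg: "integrable lborel (\<lambda>t. c powr p / p * \<bar>g t\<bar> powr p + c powr (- q) / q * \<bar>w t\<bar> powr q)"
    using ig iw by (intro Bochner_Integration.integrable_add integrable_mult_right)
  have "V \<le> (LINT t|lborel. \<bar>g t * w t\<bar>)"
    unfolding dual using integral_abs_bound[of lborel "\<lambda>t. g t * w t"] by linarith
  also have "\<dots> \<le> (LINT t|lborel. c powr p / p * \<bar>g t\<bar> powr p + c powr (- q) / q * \<bar>w t\<bar> powr q)"
  proof (rule integral_mono[OF _ iyg young])
    show "integrable lborel (\<lambda>t. \<bar>g t * w t\<bar>)"
      by (rule Bochner_Integration.integrable_bound[OF iyg])
         (use young in \<open>auto intro!: order_trans[OF _ abs_ge_self]\<close>)
  qed
  also have "\<dots> = c powr p / p * Gp + c powr (- q) / q * (LINT x|lborel. \<bar>w x\<bar> powr q)"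
    unfolding Gp_def using ig iw by (subst Bochner_Integration.integral_add) (auto simp only: integral_mult_right_zero intro!: integrable_mult_right)
  also have "\<dots> \<le> c powr p / p * Gp + c powr (- q) / q * (c powr q * V)"
    using W q by (intro add_left_mono mult_left_mono) auto
  also have "c powr (- q) / q * (c powr q * V) = V / q"
    using c by (simp flip: powr_add mult.assoc)  
  finally have "V \<le> c powr p / p * Gp + V / q" .
  moreover have "V / q = V - V / p"
  proof -
    have "V * (1 / p + 1 / q) = V" using q(3) by simp
    then have "V * (1 / p) + V * (1 / q) = V" by (simp only: distrib_left)
    then show ?thesis by simp
  qed
  ultimately have "V / p \<le> (c powr p * Gp) / p" by simp
  then have "V \<le> c powr p * Gp" using p1 by (simp add: divide_le_cancel)
  then have "ennreal V \<le> ennreal (c powr p) * ennreal Gp" by (simp add: ennreal_leI flip: ennreal_mult')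
  moreover have "mass p (\<lambda>x. of_real (v x)) = ennreal V"
    using mass_integral[of "\<lambda>x. of_real (v x)" p] iv by (simp add: V_def)
  moreover have "mass p (\<lambda>x. of_real (g x)) = ennreal Gp"
    using mass_integral[of "\<lambda>x. of_real (g x)" p] ig by (simp add: Gp_def)
  ultimately show ?thesis by (simp add: vc c_def)
qed

lemma sharp_constant_eq:
  assumes p: "p > 1" and pbar: "pbar = max p (p / (p - 1))"
  shows "p \<le> 2 \<Longrightarrow> cot (pi / (2 * pbar)) = tan (pi / (2 * p))"
    and "p \<ge> 2 \<Longrightarrow> pbar = p"
    and "p \<ge> 2 \<Longrightarrow> cot (pi / (2 * pbar)) = tan (pi / (2 * (p / (p - 1))))"
proof -
  define q where "q = p / (p - 1)"
  have cot: "cot (pi / 2 - x) = tan x" for x :: real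
    by (simp add: cot_def tan_def sin_diff cos_diff)
  have split: "pi / (2 * q) = pi / 2 - pi / (2 * p)" using p by (simp add: q_def field_simps)
  show "cot (pi / (2 * pbar)) = tan (pi / (2 * p))" if "p \<le> 2"
  proof -
    have "p \<le> q" using p that by (simp add: q_def field_simps)
    then have "pbar = q" using pbar by (simp add: q_def)
    then show ?thesis using split cot by simp
  qed
  show eq: "pbar = p" if "p \<ge> 2"
  proof -
    have "q \<le> p" using p that by (simp add: q_def field_simps)
    then show ?thesis using pbar by (simp add: q_def)
  qed
  show "cot (pi / (2 * pbar)) = tan (pi / (2 * (p / (p - 1))))" if "p \<ge> 2"
  proof -
    have "pi / (2 * p) = pi / 2 - pi / (2 * q)" using split by simp
    then show ?thesis using eq[OF that] cot by (simp add: q_def)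
  qed
qed

lemma conj_poisson_real_bound:
  fixes g :: "real \<Rightarrow> real"
  assumes p: "p > 1" and s: "s > 0" and "pbar = max p (p / (p - 1))"
    and "g \<in> borel_measurable borel" and "mass p (\<lambda>t. of_real (g t)) < \<infinity>"
  shows "mass p (\<lambda>x. conj_poisson (\<lambda>t. of_real (g t)) (Complex x s))
    \<le> ennreal (cot (pi / (2 * pbar)) powr p) * mass p (\<lambda>t. of_real (g t))"
proof (cases "p \<le> 2")
  case True
  then show ?thesis
    using conj_poisson_extend[OF p s conj_poisson_test_le2[OF p True _ s] assms(4,5)]
    by (simp add: sharp_constant_eq(1)[OF p assms(3)])
next
  case False
  then have p2: "p > 2" by simp
  then show ?thesis
    using conj_poisson_extend[OF p s conj_poisson_test_ge2[OF p2 _ s] assms(4,5)]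
    by (simp add: sharp_constant_eq(3)[OF p assms(3)])
qed

lemma nn_integral_period_shift:
  fixes f :: "real \<Rightarrow> ennreal"
  assumes [measurable]: "f \<in> borel_measurable borel" and per: "\<And>x. f (x + 2 * pi) = f x"
    and a: "0 \<le> a" "a \<le> 2 * pi"
  shows "(\<integral>\<^sup>+x. indicator {0..<2 * pi} x * f (x - a) \<partial>lborel) = (\<integral>\<^sup>+x. indicator {0..<2 * pi} x * f x \<partial>lborel)"
proof -
  have "(\<integral>\<^sup>+x. indicator {0..<2 * pi} x * f (x - a) \<partial>lborel) = (\<integral>\<^sup>+x. indicator {0..<2 * pi} (x + a) * f x \<partial>lborel)"
    using nn_integral_real_affine[of "\<lambda>x. indicator {0..<2 * pi} x * f (x - a)" 1 a] by (simp add: add.commute)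
  also have "\<dots> = (\<integral>\<^sup>+x. indicator {0..<2 * pi - a} x * f x + indicator {- a..<0} x * f x \<partial>lborel)"
    using a by (intro nn_integral_cong) (auto simp: indicator_def)
  also have "\<dots> = (\<integral>\<^sup>+x. indicator {0..<2 * pi - a} x * f x \<partial>lborel) + (\<integral>\<^sup>+x. indicator {- a..<0} x * f x \<partial>lborel)"
    by (rule nn_integral_add) measurable
  also have "(\<integral>\<^sup>+x. indicator {- a..<0} x * f x \<partial>lborel) = (\<integral>\<^sup>+x. indicator {2 * pi - a..<2 * pi} x * f x \<partial>lborel)"
  proof -
    have "(\<integral>\<^sup>+x. indicator {2 * pi - a..<2 * pi} x * f x \<partial>lborel)
        = (\<integral>\<^sup>+x. indicator {2 * pi - a..<2 * pi} (2 * pi + x) * f (2 * pi + x) \<partial>lborel)"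
      using nn_integral_real_affine[of "\<lambda>x. indicator {2 * pi - a..<2 * pi} x * f x" 1 "2 * pi"] by simp
    also have "\<dots> = (\<integral>\<^sup>+x. indicator {- a..<0} x * f x \<partial>lborel)"
      using per by (intro nn_integral_cong) (auto simp: indicator_def add.commute[of "2 * pi"])
    finally show ?thesis by simp
  qed
  also have "(\<integral>\<^sup>+x. indicator {0..<2 * pi - a} x * f x \<partial>lborel) + (\<integral>\<^sup>+x. indicator {2 * pi - a..<2 * pi} x * f x \<partial>lborel)
      = (\<integral>\<^sup>+x. indicator {0..<2 * pi - a} x * f x + indicator {2 * pi - a..<2 * pi} x * f x \<partial>lborel)"
    by (rule nn_integral_add[symmetric]) measurable
  also have "\<dots> = (\<integral>\<^sup>+x. indicator {0..<2 * pi} x * f x \<partial>lborel)"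
    using a by (intro nn_integral_cong) (auto simp: indicator_def)
  finally show ?thesis .
qed

text \<open>
  The \<open>p\<close>-th power of the modulus of a complex number is, up to a constant, the
  average of the \<open>p\<close>-th powers of the real parts of its rotations.
\<close>

lemma rotation_average:
  assumes p: "p > 0"
  obtains \<kappa> where "\<kappa> > 0" "\<And>w. (\<integral>\<^sup>+\<theta>. indicator {0..<2 * pi} \<theta> * ennreal (\<bar>Re (cis (- \<theta>) * w)\<bar> powr p) \<partial>lborel)
     = ennreal \<kappa> * ennreal (norm w powr p)"
proof -
  define I where "I = (\<integral>\<^sup>+\<theta>. indicator {0..<2 * pi} \<theta> * ennreal (\<bar>cos \<theta>\<bar> powr p) \<partial>lborel)"
  have "I \<le> (\<integral>\<^sup>+\<theta>. indicator {0..<2 * pi} \<theta> \<partial>lborel)" unfolding I_def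
  proof (intro nn_integral_mono)
    fix \<theta> :: real
    have "\<bar>cos \<theta>\<bar> powr p \<le> 1 powr p" using p by (intro powr_mono2) auto
    then have "ennreal (\<bar>cos \<theta>\<bar> powr p) \<le> 1" by simp
    then show "indicator {0..<2 * pi} \<theta> * ennreal (\<bar>cos \<theta>\<bar> powr p) \<le> indicator {0..<2 * pi} \<theta>"
      by (auto simp: indicator_def)
  qed
  also have "\<dots> < \<infinity>" by simp
  finally have fin: "I < \<infinity>" .
  have c1: "cos (1 / 2 :: real) > 0" using pi_ge_two by (intro cos_gt_zero) auto
  have "ennreal (1 / 2) * ennreal (cos (1 / 2) powr p) = (\<integral>\<^sup>+\<theta>. ennreal (cos (1 / 2) powr p) * indicator {0..1/2::real} \<theta> \<partial>lborel)"
    by (subst nn_integral_cmult_indicator) (auto simp: mult.commute)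
  also have "\<dots> \<le> I" unfolding I_def
  proof (intro nn_integral_mono)
    fix \<theta> :: real
    show "ennreal (cos (1 / 2) powr p) * indicator {0..1/2} \<theta> \<le> indicator {0..<2 * pi} \<theta> * ennreal (\<bar>cos \<theta>\<bar> powr p)"
    proof (cases "\<theta> \<in> {0..1/2}")
      case True
      have "cos (1 / 2) \<le> cos \<theta>" using True pi_ge_two by (intro cos_monotone_0_pi_le) auto
      then have "cos (1 / 2) powr p \<le> \<bar>cos \<theta>\<bar> powr p" using c1 p by (intro powr_mono2) auto
      moreover have "\<theta> \<in> {0..<2 * pi}" using True pi_ge_two by auto
      ultimately show ?thesis using True by (simp add: ennreal_leI)
    qed auto
  qed
  finally have "ennreal (1 / 2 * cos (1 / 2) powr p) \<le> I" by (simp only: ennreal_mult' zero_le_divide_1_iff zero_le_numeral)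
  moreover have "ennreal (1 / 2 * cos (1 / 2) powr p) > 0" using c1 by simp
  ultimately have pos: "I > 0" by (rule less_le_trans[rotated])
  define \<kappa> where "\<kappa> = enn2real I"
  have \<kappa>: "\<kappa> > 0" "ennreal \<kappa> = I" using pos fin by (auto simp: \<kappa>_def enn2real_positive_iff)
  show ?thesis
  proof (rule that[OF \<kappa>(1)])
    fix w :: complex
    define a where "a = Arg2pi w"
    have a: "0 \<le> a" "a \<le> 2 * pi" unfolding a_def using Arg2pi_ge_0[of w] Arg2pi_lt_2pi[of w] by auto
    have w: "w = of_real (norm w) * cis a"
      unfolding a_def using Arg2pi_eq[of w] by (simp add: cis_conv_exp)
    have re: "Re (cis (- \<theta>) * w) = norm w * cos (\<theta> - a)" for \<theta>
      by (subst w) (simp add: cos_diff algebra_simps)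
    have "(\<integral>\<^sup>+\<theta>. indicator {0..<2 * pi} \<theta> * ennreal (\<bar>Re (cis (- \<theta>) * w)\<bar> powr p) \<partial>lborel)
      = (\<integral>\<^sup>+\<theta>. ennreal (norm w powr p) * (indicator {0..<2 * pi} \<theta> * ennreal (\<bar>cos (\<theta> - a)\<bar> powr p)) \<partial>lborel)"
      unfolding re by (intro nn_integral_cong) (simp add: abs_mult powr_mult ennreal_mult mult_ac)
    also have "\<dots> = ennreal (norm w powr p) * (\<integral>\<^sup>+\<theta>. indicator {0..<2 * pi} \<theta> * ennreal (\<bar>cos (\<theta> - a)\<bar> powr p) \<partial>lborel)"
      by (rule nn_integral_cmult) measurable
    also have "(\<integral>\<^sup>+\<theta>. indicator {0..<2 * pi} \<theta> * ennreal (\<bar>cos (\<theta> - a)\<bar> powr p) \<partial>lborel) = I"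
      unfolding I_def by (rule nn_integral_period_shift[OF _ _ a]) auto
    finally show "(\<integral>\<^sup>+\<theta>. indicator {0..<2 * pi} \<theta> * ennreal (\<bar>Re (cis (- \<theta>) * w)\<bar> powr p) \<partial>lborel)
      = ennreal \<kappa> * ennreal (norm w powr p)" by (simp add: \<kappa>(2) mult.commute)
  qed
qed

lemma conj_poisson_Re_cmult:
  assumes g: "tame g" and s: "s > 0"
  shows "conj_poisson (\<lambda>t. of_real (Re (c * g t))) (Complex x s) = of_real (Re (c * conj_poisson g (Complex x s)))"
proof -
  have i: "integrable lborel (\<lambda>t. c * (of_real (conj_kernel s (x - t)) * g t))"
    using integrable_conj_kernel_tame[OF g s, of x] by (rule integrable_mult_right)
  have "conj_poisson (\<lambda>t. of_real (Re (c * g t))) (Complex x s)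
      = (LINT t|lborel. of_real (Re (c * (of_real (conj_kernel s (x - t)) * g t))))"
    unfolding conj_poisson_eq
    by (intro Bochner_Integration.integral_cong refl) (simp add: algebra_simps flip: of_real_mult)
  also have "\<dots> = of_real (LINT t|lborel. Re (c * (of_real (conj_kernel s (x - t)) * g t)))"
    by (rule integral_complex_of_real)
  also have "(LINT t|lborel. Re (c * (of_real (conj_kernel s (x - t)) * g t)))
      = Re (LINT t|lborel. c * (of_real (conj_kernel s (x - t)) * g t))"
    by (rule integral_Re[OF i])
  also have "(LINT t|lborel. c * (of_real (conj_kernel s (x - t)) * g t)) = c * conj_poisson g (Complex x s)"
    unfolding conj_poisson_eq by (rule integral_mult_right_zero)
  finally show ?thesis .
qed

text \<open>
  \<open>Q\<close> commutes with taking the real part of a rotation. So the real inequality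
  holds for each angle; averaging over the angle and cancelling \<open>\<kappa>\<close> gives
  the complex one with the same constant.
\<close>

theorem conj_poisson_bound:
  assumes p: "p > 1" and s: "s > 0" and pbar: "pbar = max p (p / (p - 1))"
    and g [measurable]: "g \<in> borel_measurable borel" and fin: "mass p g < \<infinity>"
  shows "mass p (\<lambda>x. conj_poisson g (Complex x s)) \<le> ennreal (cot (pi / (2 * pbar)) powr p) * mass p g"
proof -
  define C where "C = ennreal (cot (pi / (2 * pbar)) powr p)"
  have tame: "tame g" by (rule mass_finite_tame[OF p g fin])
  define v where "v = (\<lambda>x. conj_poisson g (Complex x s))"
  have [measurable]: "v \<in> borel_measurable borel" unfolding v_def by (rule measurable_conj_poisson[OF tame s])
  obtain \<kappa> where \<kappa>: "\<kappa> > 0" and avg: "\<And>w. (\<integral>\<^sup>+\<theta>. indicator {0..<2 * pi} \<theta> * ennreal (\<bar>Re (cis (- \<theta>) * w)\<bar> powr p) \<partial>lborel)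
     = ennreal \<kappa> * ennreal (norm w powr p)"
    using rotation_average[of p] p by auto
  have cism [measurable]: "(\<lambda>\<theta>. cis (- \<theta>)) \<in> borel_measurable borel"
    unfolding cis_conv_exp by (intro borel_measurable_continuous_onI continuous_intros)
  have rot: "ennreal \<kappa> * mass p f = (\<integral>\<^sup>+\<theta>. indicator {0..<2 * pi} \<theta> * mass p (\<lambda>x. of_real (Re (cis (- \<theta>) * f x))) \<partial>lborel)"
    if [measurable]: "f \<in> borel_measurable borel" for f
  proof -
    have "ennreal \<kappa> * mass p f = (\<integral>\<^sup>+x. ennreal \<kappa> * ennreal (norm (f x) powr p) \<partial>lborel)"
      unfolding mass_def by (rule nn_integral_cmult[symmetric]) measurable
    also have "\<dots> = (\<integral>\<^sup>+x. \<integral>\<^sup>+\<theta>. indicator {0..<2 * pi} \<theta> * ennreal (\<bar>Re (cis (- \<theta>) * f x)\<bar> powr p) \<partial>lborel \<partial>lborel)"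
      by (simp only: avg)
    also have "\<dots> = (\<integral>\<^sup>+\<theta>. \<integral>\<^sup>+x. indicator {0..<2 * pi} \<theta> * ennreal (\<bar>Re (cis (- \<theta>) * f x)\<bar> powr p) \<partial>lborel \<partial>lborel)"
      by (rule nn_integral_swap) measurable
    also have "\<dots> = (\<integral>\<^sup>+\<theta>. indicator {0..<2 * pi} \<theta> * (\<integral>\<^sup>+x. ennreal (\<bar>Re (cis (- \<theta>) * f x)\<bar> powr p) \<partial>lborel) \<partial>lborel)"
      by (intro nn_integral_cong nn_integral_cmult) measurable
    finally show ?thesis by (simp only: mass_def norm_of_real)
  qed
  have massm: "(\<lambda>\<theta>. indicator {0..<2 * pi} \<theta> * mass p (\<lambda>x. of_real (Re (cis (- \<theta>) * f x)))) \<in> borel_measurable lborel"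
    if [measurable]: "f \<in> borel_measurable borel" for f
    unfolding mass_def by measurable
  have "ennreal \<kappa> * mass p v = (\<integral>\<^sup>+\<theta>. indicator {0..<2 * pi} \<theta> * mass p (\<lambda>x. of_real (Re (cis (- \<theta>) * v x))) \<partial>lborel)"
    by (rule rot) measurable
  also have "\<dots> \<le> (\<integral>\<^sup>+\<theta>. C * (indicator {0..<2 * pi} \<theta> * mass p (\<lambda>x. of_real (Re (cis (- \<theta>) * g x)))) \<partial>lborel)"
  proof (rule nn_integral_mono)
    fix \<theta> :: real
    let ?g = "\<lambda>t. Re (cis (- \<theta>) * g t)"
    have "mass p (\<lambda>t. of_real (?g t)) \<le> mass p g"
    proof (rule mass_mono)
      fix x
      have "\<bar>Re (cis (- \<theta>) * g x)\<bar> \<le> norm (cis (- \<theta>) * g x)" by (rule abs_Re_le_cmod)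
      then show "norm (complex_of_real (Re (cis (- \<theta>) * g x))) \<le> norm (g x)"
        by (simp only: norm_mult norm_cis mult_1 norm_of_real)
    qed (use p in auto)
    then have "mass p (\<lambda>t. of_real (?g t)) < \<infinity>" using fin by (rule le_less_trans)
    then have "mass p (\<lambda>x. conj_poisson (\<lambda>t. of_real (?g t)) (Complex x s)) \<le> C * mass p (\<lambda>t. of_real (?g t))"
      unfolding C_def by (intro conj_poisson_real_bound p s pbar) measurable
    then have "mass p (\<lambda>x. of_real (Re (cis (- \<theta>) * v x))) \<le> C * mass p (\<lambda>t. of_real (?g t))"
      by (simp only: conj_poisson_Re_cmult[OF tame s] v_def)
    then show "indicator {0..<2 * pi} \<theta> * mass p (\<lambda>x. of_real (Re (cis (- \<theta>) * v x)))
        \<le> C * (indicator {0..<2 * pi} \<theta> * mass p (\<lambda>x. of_real (Re (cis (- \<theta>) * g x))))"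
      by (auto simp: indicator_def)
  qed
  also have "\<dots> = C * (\<integral>\<^sup>+\<theta>. indicator {0..<2 * pi} \<theta> * mass p (\<lambda>x. of_real (Re (cis (- \<theta>) * g x))) \<partial>lborel)"
    by (rule nn_integral_cmult[OF massm[OF g]])
  also have "\<dots> = C * (ennreal \<kappa> * mass p g)" by (simp only: rot[OF g])
  also have "\<dots> = ennreal \<kappa> * (C * mass p g)" by (simp only: mult_ac)
  finally have "mass p v \<le> C * mass p g"
    using \<kappa> by (subst (asm) ennreal_mult_le_mult_iff) auto
  then show ?thesis by (simp add: v_def C_def)
qed

section \<open>Norms and representatives\<close>

lemma Lp_norm_mass:
  "Lp_norm p g = (if mass p g = \<infinity> then \<infinity> else ennreal (enn2real (mass p g) powr (1 / p)))"
  unfolding Lp_norm_def mass_def by (simp add: nn_integral_completion)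

lemma Lp_norm_less_top_iff: "Lp_norm p g < top \<longleftrightarrow> mass p g < top"
  by (simp add: Lp_norm_mass top.not_eq_extremum)

lemma Lp_norm_le_iff:
  assumes p: "p > 0" and C: "C \<ge> 0"
  shows "Lp_norm p g \<le> ennreal C \<longleftrightarrow> mass p g \<le> ennreal (C powr p)"
proof (cases "mass p g = \<infinity>")
  case True
  then show ?thesis by (simp add: Lp_norm_mass top_unique)
next
  case False
  then obtain m where m: "m \<ge> 0" "mass p g = ennreal m" by (cases "mass p g") auto
  have "m powr (1 / p) \<le> C \<longleftrightarrow> m \<le> C powr p"
  proof
    assume "m powr (1 / p) \<le> C"
    then have "(m powr (1 / p)) powr p \<le> C powr p" using p by (intro powr_mono2) auto
    then show "m \<le> C powr p" using p m by (simp add: powr_powr)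
  next
    assume "m \<le> C powr p"
    then have "m powr (1 / p) \<le> (C powr p) powr (1 / p)" using p m by (intro powr_mono2) auto
    then show "m powr (1 / p) \<le> C" using p C by (simp add: powr_powr)
  qed
  then show ?thesis using m C by (simp add: Lp_norm_mass ennreal_le_iff)
qed

lemma ennreal_le_Lp_norm:
  assumes p: "p > 0" and C: "C \<ge> 0" and le: "ennreal (C powr p) \<le> mass p g"
  shows "ennreal C \<le> Lp_norm p g"
proof (cases "mass p g = \<infinity>")
  case True
  then show ?thesis by (simp add: Lp_norm_mass)
next
  case False
  then obtain m where m: "m \<ge> 0" "mass p g = ennreal m" by (cases "mass p g") auto
  then have "C powr p \<le> m" using le by (simp add: ennreal_le_iff)
  then have "(C powr p) powr (1 / p) \<le> m powr (1 / p)" using p by (intro powr_mono2) auto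
  then show ?thesis using m p C by (simp add: Lp_norm_mass powr_powr ennreal_leI)
qed

lemma Lp_norm_mult_le:
  assumes p: "p > 0" and c: "c > 0" and le: "mass p f \<le> ennreal (c powr p) * mass p g"
  shows "Lp_norm p f \<le> ennreal c * Lp_norm p g"
proof (cases "mass p g = \<infinity>")
  case True
  then show ?thesis using c by (simp add: Lp_norm_mass ennreal_mult_top)
next
  case False
  then obtain m where m: "m \<ge> 0" "mass p g = ennreal m" by (cases "mass p g") auto
  have "mass p f \<le> ennreal ((c * m powr (1 / p)) powr p)"
    using le m p c by (simp add: powr_mult powr_powr flip: ennreal_mult')
  then have "Lp_norm p f \<le> ennreal (c * m powr (1 / p))"
    using p c by (subst Lp_norm_le_iff) auto
  then show ?thesis using m c by (simp add: Lp_norm_mass ennreal_mult')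
qed

lemma mass_cong_AE:
  assumes "AE x in lborel. f x = g x"
  shows "mass p f = mass p g"
  unfolding mass_def by (rule nn_integral_cong_AE) (use assms in eventually_elim, simp)

lemma Lp_norm_cong_AE:
  assumes "AE x in lborel. f x = g x"
  shows "Lp_norm p f = Lp_norm p g"
  by (simp add: Lp_norm_mass mass_cong_AE[OF assms])

lemma borel_representative:
  fixes g :: "real \<Rightarrow> complex"
  assumes "g \<in> borel_measurable lebesgue"
  obtains g' where "g' \<in> borel_measurable borel" "AE x in lborel. g x = g' x"
proof -
  have "(\<lambda>x. Re (g x)) \<in> borel_measurable lebesgue" "(\<lambda>x. Im (g x)) \<in> borel_measurable lebesgue"
    using assms by measurable
  then obtain a b where a: "a \<in> borel_measurable lborel" "AE x in lborel. Re (g x) = a x"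
    and b: "b \<in> borel_measurable lborel" "AE x in lborel. Im (g x) = b x"
    using completion_ex_borel_measurable_real by metis
  show ?thesis
  proof (rule that[of "\<lambda>x. Complex (a x) (b x)"])
    show "(\<lambda>x. Complex (a x) (b x)) \<in> borel_measurable borel"
      unfolding Complex_eq using a(1) b(1) by measurable
    show "AE x in lborel. g x = Complex (a x) (b x)"
      using a(2) b(2) by eventually_elim (simp add: complex_eq_iff)
  qed
qed

lemma borel_measurable_lebesgueI:
  "g \<in> borel_measurable borel \<Longrightarrow> g \<in> borel_measurable lebesgue" for g :: "real \<Rightarrow> complex"
  by (rule measurable_completion) simp

text \<open>
  By completeness either both functions are measurable, or neither is and both integrals are 0.
\<close>

lemma lebesgue_integral_cong_AE:
  fixes f g :: "real \<Rightarrow> complex"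
  assumes ae: "AE x in lborel. f x = g x"
  shows "(LINT x|lebesgue. f x) = (LINT x|lebesgue. g x)"
proof -
  have ae': "AE x in lebesgue. f x = g x" using ae by (rule AE_completion)
  then have ae'': "AE x in lebesgue. g x = f x" by eventually_elim simp
  show ?thesis
  proof (cases "f \<in> borel_measurable lebesgue")
    case True
    then have "g \<in> borel_measurable lebesgue" by (rule borel_measurable_AE[OF _ ae'])
    with True ae' show ?thesis by (intro integral_cong_AE) auto
  next
    case False
    then have "g \<notin> borel_measurable lebesgue" using borel_measurable_AE[OF _ ae''] by blast
    with False have "\<not> integrable lebesgue f" "\<not> integrable lebesgue g" by auto
    then show ?thesis by (simp add: not_integrable_integral_eq)
  qed
qed

lemma AE_lborel_uminus:
  assumes "AE x in lborel. P x"
  shows "AE x in lborel. P (- x :: real)"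
proof -
  have "AE x in distr lborel borel uminus. P x" using assms by (simp only: lborel_distr_uminus)
  then show ?thesis by (rule AE_distrD[rotated]) simp
qed

lemma AE_lborel_shift:
  assumes "AE x in lborel. P x"
  shows "AE x in lborel. P (c + x :: real)"
proof -
  have "AE x in distr lborel borel ((+) c). P x" using assms by (simp only: lborel_distr_plus)
  then show ?thesis by (rule AE_distrD[rotated]) simp
qed

lemma poisson_cong_AE:
  assumes "AE x in lborel. f x = g x"
  shows "poisson f = poisson g"
  unfolding poisson_def by (intro ext lebesgue_integral_cong_AE) (use assms in eventually_elim, simp)

lemma hilbert_trunc_cong_AE:
  assumes "AE x in lborel. f x = g x"
  shows "hilbert_trunc f = hilbert_trunc g"
proof (intro ext)
  fix x \<epsilon>
  have "AE t in lborel. f (x + t) = g (x + t)" by (rule AE_lborel_shift[OF assms])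
  moreover have "AE t in lborel. f (x + - t) = g (x + - t)"
    by (rule AE_lborel_uminus[OF AE_lborel_shift[OF assms]])
  ultimately have "AE t in lborel. indicator {\<epsilon><..} t *\<^sub>R ((f (x + t) - f (x - t)) / of_real t)
      = indicator {\<epsilon><..} t *\<^sub>R ((g (x + t) - g (x - t)) / complex_of_real t)"
    by eventually_elim simp
  then show "hilbert_trunc f x \<epsilon> = hilbert_trunc g x \<epsilon>"
    unfolding hilbert_trunc_def set_lebesgue_integral_def by (simp only: lebesgue_integral_cong_AE)
qed

lemma hilbert_cong_AE:
  assumes "AE x in lborel. f x = g x"
  shows "hilbert f = hilbert g"
  unfolding hilbert_def[abs_def] hilbert_trunc_cong_AE[OF assms] ..

section \<open>The Hilbert transform on \<open>L\<^sup>p\<close>\<close>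

lemma sharp_constant_pos:
  assumes p: "p > 1" and pbar: "pbar = max p (p / (p - 1))"
  shows "cot (pi / (2 * pbar)) > 0"
proof -
  have "pbar > 1" using p pbar by auto
  then have "0 < pi / (2 * pbar)" "pi / (2 * pbar) < pi / 2" by (auto simp: field_simps)
  then show ?thesis by (intro cot_gt_zero)
qed

text \<open>
  \<open>Q[g]\<close> is the Poisson integral of some \<open>h\<close>. At common Poisson points
  of \<open>g\<close> and \<open>h\<close> the truncated integrals tend to the boundary value of
  \<open>Q[g]\<close>, which is \<open>h\<close>.
\<close>

theorem hilbert_boundary_values:
  assumes p: "p > 1" and pbar: "pbar = max p (p / (p - 1))"
    and g: "g \<in> borel_measurable borel" and fin: "mass p g < \<infinity>"
  obtains h where "h \<in> borel_measurable borel"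
    "mass p h \<le> ennreal (cot (pi / (2 * pbar)) powr p) * mass p g"
    "AE x in lborel. (hilbert_trunc g x \<longlongrightarrow> h x) (at_right 0)"
    "AE x in lborel. hilbert g x = h x"
    "\<forall>z. Im z > 0 \<longrightarrow> conj_poisson g z = poisson h z"
proof -
  have tame: "tame g" by (rule mass_finite_tame[OF p g fin])
  obtain m where m: "m \<ge> 0" "mass p g = ennreal m" using fin by (cases "mass p g") auto
  define M where "M = cot (pi / (2 * pbar)) powr p * m"
  have M: "M \<ge> 0" "ennreal (cot (pi / (2 * pbar)) powr p) * mass p g = ennreal M"
    using m by (auto simp: M_def ennreal_mult)
  have "mass p (\<lambda>x. conj_poisson g (Complex x y)) \<le> ennreal M" if "y > 0" for y
    using conj_poisson_bound[OF p that pbar g fin] M by simp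
  then obtain h where h: "h \<in> borel_measurable borel" "mass p h \<le> ennreal M"
    "\<And>z. Im z > 0 \<Longrightarrow> conj_poisson g z = poisson h z"
    using poisson_representation[OF p harmonic_poisson(2)[OF tame] M(1)] by blast
  have th: "tame h" using h(2) by (intro mass_finite_tame[OF p h(1)]) (auto intro: le_less_trans)
  have lim: "AE x in lborel. (hilbert_trunc g x \<longlongrightarrow> h x) (at_right 0)"
    using poisson_point_AE[OF tame] poisson_point_AE[OF th]
  proof eventually_elim
    case (elim x)
    have "((\<lambda>y. conj_poisson g (Complex x y)) \<longlongrightarrow> h x) (at_right 0)"
    proof (rule Lim_transform_eventually[OF poisson_tendsto_boundary[OF th elim(2)]])
      show "\<forall>\<^sub>F y in at_right 0. poisson h (Complex x y) = conj_poisson g (Complex x y)"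
        using h(3) by (auto simp: eventually_at_filter)
    qed
    from tendsto_diff[OF this conj_poisson_hilbert_trunc_tendsto[OF tame elim(1)]]
    show ?case by simp
  qed
  moreover have "AE x in lborel. hilbert g x = h x"
    using lim by eventually_elim (simp add: hilbert_def tendsto_Lim)
  ultimately show ?thesis using that[of h] h M by simp
qed

lemma Lp_borel:
  assumes "g \<in> Lp p"
  obtains g' where "g' \<in> borel_measurable borel" "AE x in lborel. g x = g' x" "mass p g' < \<infinity>"
    "hilbert_trunc g = hilbert_trunc g'" "hilbert g = hilbert g'" "poisson g = poisson g'" "Lp_norm p g = Lp_norm p g'"
proof -
  have g: "g \<in> borel_measurable lebesgue" "Lp_norm p g < \<infinity>" using assms by (auto simp: Lp_def)
  obtain g' where g': "g' \<in> borel_measurable borel" "AE x in lborel. g x = g' x"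
    using borel_representative[OF g(1)] by blast
  show ?thesis
  proof (rule that[OF g'])
    show "mass p g' < \<infinity>" using g(2) by (simp add: Lp_norm_less_top_iff mass_cong_AE[OF g'(2)])
  qed (rule hilbert_trunc_cong_AE[OF g'(2)] hilbert_cong_AE[OF g'(2)] poisson_cong_AE[OF g'(2)] Lp_norm_cong_AE[OF g'(2)])+
qed

lemma LpI: "g \<in> borel_measurable borel \<Longrightarrow> mass p g < \<infinity> \<Longrightarrow> g \<in> Lp p"
  by (simp add: Lp_def borel_measurable_lebesgueI Lp_norm_less_top_iff)

lemma hilbert_Lp:
  assumes p: "p > 1" and pbar: "pbar = max p (p / (p - 1))" and g: "g \<in> Lp p"
  shows "AE x in lebesgue. \<exists>l. (hilbert_trunc g x \<longlongrightarrow> l) (at_right 0)"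
    and "hilbert g \<in> Lp p"
    and "Lp_norm p (hilbert g) \<le> ennreal (cot (pi / (2 * pbar))) * Lp_norm p g"
proof -
  obtain g' where g': "g' \<in> borel_measurable borel" "AE x in lborel. g x = g' x" "mass p g' < \<infinity>"
    "hilbert_trunc g = hilbert_trunc g'" "hilbert g = hilbert g'" "poisson g = poisson g'" "Lp_norm p g = Lp_norm p g'"
    by (rule Lp_borel[OF g])
  obtain h where h: "h \<in> borel_measurable borel"
    "mass p h \<le> ennreal (cot (pi / (2 * pbar)) powr p) * mass p g'"
    "AE x in lborel. (hilbert_trunc g' x \<longlongrightarrow> h x) (at_right 0)"
    "AE x in lborel. hilbert g' x = h x"
    "\<forall>z. Im z > 0 \<longrightarrow> conj_poisson g' z = poisson h z"
    by (rule hilbert_boundary_values[OF p pbar g'(1,3)])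
  show "AE x in lebesgue. \<exists>l. (hilbert_trunc g x \<longlongrightarrow> l) (at_right 0)"
    unfolding g'(4) using AE_completion[OF h(3)] by eventually_elim blast
  have p0: "p > 0" using p by simp
  have N: "Lp_norm p h \<le> ennreal (cot (pi / (2 * pbar))) * Lp_norm p g'"
    by (rule Lp_norm_mult_le[OF p0 sharp_constant_pos[OF p pbar] h(2)])
  then show "Lp_norm p (hilbert g) \<le> ennreal (cot (pi / (2 * pbar))) * Lp_norm p g"
    unfolding g'(5,7) Lp_norm_cong_AE[OF h(4)] .
  have "AE x in lebesgue. h x = hilbert g x"
    unfolding g'(5) using AE_completion[OF h(4)] by eventually_elim simp
  then have "hilbert g \<in> borel_measurable lebesgue"
    by (rule borel_measurable_AE[OF borel_measurable_lebesgueI[OF h(1)]])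
  moreover have "mass p h < \<infinity>"
    using g'(3) by (intro le_less_trans[OF h(2)]) (auto simp: ennreal_mult_less_top)
  then have "Lp_norm p (hilbert g) < \<infinity>"
    unfolding g'(5) Lp_norm_cong_AE[OF h(4)] by (simp add: Lp_norm_less_top_iff)
  ultimately show "hilbert g \<in> Lp p" by (simp add: Lp_def)
qed

section \<open>Poisson integrals and the harmonic Hardy space\<close>

text \<open>
  The norm does not exceed that of \<open>g\<close> since the Poisson kernel contracts; the
  other inequality is Fatou along heights \<open>1 / (n + 1)\<close>.
\<close>

lemma poisson_Lp:
  assumes p: "p > 1" and g: "g \<in> Lp p"
  shows "poisson g \<in> hp p" and "hp_norm p (poisson g) = Lp_norm p g"
proof -
  obtain g' where g': "g' \<in> borel_measurable borel" "AE x in lborel. g x = g' x" "mass p g' < \<infinity>"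
    "hilbert_trunc g = hilbert_trunc g'" "hilbert g = hilbert g'" "poisson g = poisson g'" "Lp_norm p g = Lp_norm p g'"
    by (rule Lp_borel[OF g])
  have tame: "tame g'" by (rule mass_finite_tame[OF p g'(1,3)])
  have p0: "p > 0" using p by simp
  have le: "hp_norm p (poisson g') \<le> Lp_norm p g'"
    unfolding hp_norm_def
  proof (rule SUP_least)
    fix y :: real assume "y \<in> {0<..}"
    then have "mass p (\<lambda>x. poisson g' (Complex x y)) \<le> mass p g'" by (intro mass_poisson_le p tame) simp
    then show "Lp_norm p (\<lambda>x. poisson g' (Complex x y)) \<le> Lp_norm p g'"
      using Lp_norm_mult_le[OF p0 zero_less_one, of "\<lambda>x. poisson g' (Complex x y)" g'] by simp
  qed
  have fin: "Lp_norm p g' < \<infinity>" using g'(3) by (simp add: Lp_norm_less_top_iff)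
  have hfin: "hp_norm p (poisson g') < \<infinity>" using le fin by (rule le_less_trans)
  have ge: "Lp_norm p g' \<le> hp_norm p (poisson g')"
  proof -
    obtain C where C: "C \<ge> 0" "hp_norm p (poisson g') = ennreal C"
      using hfin by (cases "hp_norm p (poisson g')") auto
    have "mass p g' \<le> ennreal (C powr p)"
    proof (rule fatou_mass[of "\<lambda>n x. poisson g' (Complex x (inverse (real (Suc n))))"])
      show "(\<lambda>x. poisson g' (Complex x (inverse (real (Suc n))))) \<in> borel_measurable borel" for n
        by (intro borel_measurable_continuous_onI continuous_on_horizontal harmonic_on_continuous harmonic_poisson tame) simp
      have seq: "filterlim (\<lambda>n. inverse (real (Suc n))) (at_right 0) sequentially"
        unfolding filterlim_at using LIMSEQ_inverse_real_of_nat by auto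
      show "AE x in lborel. (\<lambda>n. poisson g' (Complex x (inverse (real (Suc n))))) \<longlonglongrightarrow> g' x"
        using poisson_point_AE[OF tame]
        by eventually_elim (rule filterlim_compose[OF poisson_tendsto_boundary[OF tame] seq])
      show "mass p (\<lambda>x. poisson g' (Complex x (inverse (real (Suc n))))) \<le> ennreal (C powr p)" for n
      proof -
        have "Lp_norm p (\<lambda>x. poisson g' (Complex x (inverse (real (Suc n))))) \<le> ennreal C"
          unfolding C(2)[symmetric] hp_norm_def by (rule SUP_upper) simp
        then show ?thesis using Lp_norm_le_iff[OF p0 C(1)] by simp
      qed
    qed (use p in auto)
    then show ?thesis unfolding C(2) Lp_norm_le_iff[OF p0 C(1)] .
  qed
  show "hp_norm p (poisson g) = Lp_norm p g" unfolding g'(6,7) using le ge by (rule antisym)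
  show "poisson g \<in> hp p" unfolding g'(6) hp_def using harmonic_poisson(1)[OF tame] hfin by simp
qed

lemma hp_representation:
  assumes p: "p > 1" and f: "f \<in> hp p"
  shows "\<exists>g. g \<in> Lp p \<and> (\<forall>z\<in>upper_half_plane. f z = poisson g z)"
proof -
  have p0: "p > 0" using p by simp
  obtain C where C: "C \<ge> 0" "hp_norm p f = ennreal C"
    using f by (cases "hp_norm p f") (auto simp: hp_def)
  have "mass p (\<lambda>x. f (Complex x y)) \<le> ennreal (C powr p)" if "y > 0" for y
  proof -
    have "Lp_norm p (\<lambda>x. f (Complex x y)) \<le> ennreal C"
      unfolding C(2)[symmetric] hp_norm_def using that by (intro SUP_upper) simp
    then show ?thesis using Lp_norm_le_iff[OF p0 C(1)] by simp
  qed
  then obtain g where "g \<in> borel_measurable borel" "mass p g \<le> ennreal (C powr p)" "\<And>z. Im z > 0 \<Longrightarrow> f z = poisson g z"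
    using poisson_representation[OF p _ powr_ge_zero, of f C] f by (auto simp: hp_def)
  then show ?thesis
    by (intro exI[of _ g] conjI LpI) (auto simp: upper_half_plane_def intro: le_less_trans)
qed

text \<open>
  The boundary function is the almost everywhere limit of its Poisson integral. Hence the choice
  made by \<open>hp_hilbert\<close> affects it on a null set only.
\<close>

lemma poisson_injective:
  assumes p: "p > 1" and "g \<in> Lp p" "g' \<in> Lp p"
    and eq: "\<And>z. z \<in> upper_half_plane \<Longrightarrow> poisson g z = poisson g' z"
  shows "AE x in lborel. g x = g' x"
proof -
  have *: "AE x in lborel. ((\<lambda>y. poisson f (Complex x y)) \<longlongrightarrow> f x) (at_right 0)" if f: "f \<in> Lp p" for f
  proof -
    obtain f' where f': "f' \<in> borel_measurable borel" "AE x in lborel. f x = f' x" "mass p f' < \<infinity>"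
    "hilbert_trunc f = hilbert_trunc f'" "hilbert f = hilbert f'" "poisson f = poisson f'" "Lp_norm p f = Lp_norm p f'"
      by (rule Lp_borel[OF f])
    have tame: "tame f'" by (rule mass_finite_tame[OF p f'(1,3)])
    show ?thesis
      unfolding f'(6) using f'(2) poisson_point_AE[OF tame]
      by eventually_elim (simp add: poisson_tendsto_boundary[OF tame])
  qed
  from *[OF assms(2)] *[OF assms(3)] show ?thesis
  proof eventually_elim
    case (elim x)
    have "((\<lambda>y. poisson g' (Complex x y)) \<longlongrightarrow> g x) (at_right 0)"
    proof (rule Lim_transform_eventually[OF elim(1)])
      show "\<forall>\<^sub>F y in at_right 0. poisson g (Complex x y) = poisson g' (Complex x y)"
        using eq by (auto simp: eventually_at_filter upper_half_plane_def)
    qed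
    with elim(2) show ?case by (intro tendsto_unique[of "at_right 0"]) auto
  qed
qed

lemma hp_norm_cong:
  assumes "\<And>z. z \<in> upper_half_plane \<Longrightarrow> f z = f' z"
  shows "hp_norm p f = hp_norm p f'"
  unfolding hp_norm_def
proof (rule SUP_cong[OF refl])
  fix y :: real assume "y \<in> {0<..}"
  then have "(\<lambda>x. f (Complex x y)) = (\<lambda>x. f' (Complex x y))"
    using assms by (auto simp: upper_half_plane_def)
  then show "Lp_norm p (\<lambda>x. f (Complex x y)) = Lp_norm p (\<lambda>x. f' (Complex x y))" by simp
qed

lemma hp_hilbert_eq:
  assumes p: "p > 1" and f: "f \<in> hp p"
  obtains g where "g \<in> Lp p" "\<And>z. z \<in> upper_half_plane \<Longrightarrow> f z = poisson g z"
    "hp_hilbert p f = poisson (hilbert g)" "hp_norm p f = Lp_norm p g"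
proof -
  define g where "g = (SOME g. g \<in> Lp p \<and> (\<forall>z\<in>upper_half_plane. f z = poisson g z))"
  have g: "g \<in> Lp p \<and> (\<forall>z\<in>upper_half_plane. f z = poisson g z)"
    unfolding g_def by (rule someI_ex[OF hp_representation[OF p f]])
  show ?thesis
  proof (rule that[of g])
    show "hp_hilbert p f = poisson (hilbert g)" unfolding hp_hilbert_def g_def ..
    have "hp_norm p f = hp_norm p (poisson g)" by (rule hp_norm_cong) (use g in blast)
    also have "\<dots> = Lp_norm p g" by (rule poisson_Lp(2)[OF p]) (use g in blast)
    finally show "hp_norm p f = Lp_norm p g" .
  qed (use g in auto)
qed

section \<open>Sharpness\<close>

text \<open>
  Let \<open>G\<close> be the boundary function of \<open>F\<close> and \<open>K\<close> its
  Cauchy transform. From \<open>F = P[G]\<close> it follows that \<open>K (cnj z) = K z - 2 pi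
  \<i> F z\<close>; this function is holomorphic and antiholomorphic, hence constant, and it
  tends to 0 at infinity. So it vanishes, \<open>K = 2 pi \<i> F\<close> and \<open>Q[G] = -
  \<i> F\<close>.
\<close>

lemma hardy_boundary:
  fixes F :: "complex \<Rightarrow> complex"
  assumes p: "p > 1" and F: "F holomorphic_on upper_half_plane" and cont: "continuous_on {z. Im z \<ge> 0} F"
    and M: "M \<ge> 0" and mass: "\<And>y. y > 0 \<Longrightarrow> mass p (\<lambda>x. F (Complex x y)) \<le> ennreal M"
  shows "AE x in lborel. hilbert (\<lambda>x. of_real (Re (c * F (of_real x)))) x = of_real (Re (- \<i> * (c * F (of_real x))))"
proof -
  have harm: "harmonic_on F upper_half_plane"
    using harmonic_on_holomorphic_cnj[OF F, of "\<lambda>_. 0"] by simp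
  obtain G where G: "G \<in> borel_measurable borel" "mass p G \<le> ennreal M" "\<And>z. Im z > 0 \<Longrightarrow> F z = poisson G z"
    using poisson_representation[OF p harm M mass] by blast
  have finG: "mass p G < \<infinity>" using G(2) by (auto intro: le_less_trans)
  have tame: "tame G" by (rule mass_finite_tame[OF p G(1) finG])
  have limF: "((\<lambda>y. F (Complex x y)) \<longlongrightarrow> F (of_real x)) (at_right 0)" for x
  proof -
    have "((\<lambda>y. Complex x y) \<longlongrightarrow> Complex x 0) (at_right 0)"
      by (intro tendsto_Complex tendsto_const tendsto_ident_at)
    then have "((\<lambda>y. Complex x y) \<longlongrightarrow> of_real x) (at_right 0)" by (simp add: complex_of_real_def)
    moreover have "\<forall>\<^sub>F y in at_right 0. Complex x y \<in> {z. Im z \<ge> 0}"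
      by (auto simp: eventually_at_filter)
    moreover have "complex_of_real x \<in> {z. Im z \<ge> 0}" by simp
    ultimately show ?thesis using continuous_on_tendsto_compose[OF cont] by blast
  qed
  have GF: "AE x in lborel. G x = F (of_real x)"
    using poisson_point_AE[OF tame]
  proof eventually_elim
    case (elim x)
    have "((\<lambda>y. F (Complex x y)) \<longlongrightarrow> G x) (at_right 0)"
    proof (rule Lim_transform_eventually[OF poisson_tendsto_boundary[OF tame elim]])
      show "\<forall>\<^sub>F y in at_right 0. poisson G (Complex x y) = F (Complex x y)"
        using G(3) by (auto simp: eventually_at_filter)
    qed
    then show ?case using limF by (rule tendsto_unique[rotated]) auto
  qed
  define K where "K = cauchy_transform G"
  have holK: "K holomorphic_on {z. Im z \<noteq> 0}" unfolding K_def by (rule holomorphic_cauchy_transform[OF tame]) simp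
  have opn: "open {z. Im z \<noteq> 0}"
  proof -
    have "{z. Im z \<noteq> 0} = {z. Im z > 0} \<union> {z. Im z < 0}" by auto
    then show ?thesis by (simp add: open_Un open_halfspace_Im_gt open_halfspace_Im_lt)
  qed
  define L where "L = (\<lambda>z. K (cnj z))"
  have LF: "L z = K z - 2 * pi * \<i> * F z" if "Im z > 0" for z
    unfolding L_def K_def G(3)[OF that] using that by (subst poisson_cauchy[OF tame]) auto
  have "\<exists>c. \<forall>z\<in>upper_half_plane. L z = c"
  proof (rule has_derivative_zero_constant[OF convex_upper_half_plane])
    fix z assume z: "z \<in> upper_half_plane"
    then have imz: "Im z > 0" by (simp add: upper_half_plane_def)
    have "(K has_field_derivative deriv K (cnj z)) (at (cnj z))"
      by (rule holomorphic_derivI[OF holK opn]) (use imz in simp)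
    then have "(K has_derivative (\<lambda>h. deriv K (cnj z) * h)) (at (cnj z))" by (simp add: has_field_derivative_def)
    from has_derivative_compose[OF bounded_linear_imp_has_derivative[OF bounded_linear_cnj] this]
    have d1: "(L has_derivative (\<lambda>h. deriv K (cnj z) * cnj h)) (at z)" by (simp add: L_def)
    have dK: "(K has_field_derivative deriv K z) (at z)"
      by (rule holomorphic_derivI[OF holK opn]) (use imz in simp)
    have dF: "(F has_field_derivative deriv F z) (at z)"
      by (rule holomorphic_derivI[OF F open_upper_half_plane z])
    have "((\<lambda>z. K z - 2 * pi * \<i> * F z) has_field_derivative (deriv K z - 2 * pi * \<i> * deriv F z)) (at z)"
      by (intro DERIV_diff DERIV_cmult dK dF)
    then have "((\<lambda>z. K z - 2 * pi * \<i> * F z) has_derivative (\<lambda>h. (deriv K z - 2 * pi * \<i> * deriv F z) * h)) (at z)"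
      by (simp add: has_field_derivative_def)
    then have d2: "(L has_derivative (\<lambda>h. (deriv K z - 2 * pi * \<i> * deriv F z) * h)) (at z)"
      by (rule has_derivative_transform_within_open[OF _ open_upper_half_plane z])
         (simp add: LF upper_half_plane_def)
    have "(\<lambda>h. deriv K (cnj z) * cnj h) = (\<lambda>h. (deriv K z - 2 * pi * \<i> * deriv F z) * h)"
      by (rule has_derivative_unique[OF d1 d2])
    from fun_cong[OF this, of 1] fun_cong[OF this, of \<i>]
    have "deriv K (cnj z) = 0" by (simp add: complex_eq_iff)
    then have "(L has_derivative (\<lambda>h. 0)) (at z)" using d1 by simp
    then show "(L has_derivative (\<lambda>h. 0)) (at z within upper_half_plane)" by (rule has_derivative_at_withinI)
  qed
  then obtain k where k: "\<And>z. z \<in> upper_half_plane \<Longrightarrow> L z = k" by blast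
  have "k = 0"
  proof -
    note [measurable] = G(1)
    have "(\<lambda>n. LINT t|lborel. G t / (of_real t - Complex 0 (- real (Suc n)))) \<longlonglongrightarrow> integral\<^sup>L lborel (\<lambda>t::real. 0::complex)"
    proof (rule integral_dominated_convergence[where f = "\<lambda>t::real. 0::complex" and s = "\<lambda>n t. G t / (of_real t - Complex 0 (- real (Suc n)))"
          and w = "\<lambda>t. norm (G t) / norm (of_real t - Complex 0 (-1))"])
      show "integrable lborel (\<lambda>t. norm (G t) / norm (of_real t - Complex 0 (-1)))"
        by (rule integrable_norm_cauchy[OF tame]) simp
      have bd: "norm (of_real t - Complex 0 (- real (Suc n))) \<ge> real (Suc n)" for t n
        using abs_Im_le_cmod[of "of_real t - Complex 0 (- real (Suc n))"] by simp
      show "AE t in lborel. (\<lambda>n. G t / (of_real t - Complex 0 (- real (Suc n)))) \<longlonglongrightarrow> 0"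
      proof (rule AE_I2)
        fix t
        have "norm (G t / (of_real t - Complex 0 (- real (Suc n)))) \<le> norm (G t) * inverse (real (Suc n))" for n
          unfolding divide_inverse norm_mult norm_inverse
          by (intro mult_left_mono le_imp_inverse_le bd) auto
        then show "(\<lambda>n. G t / (of_real t - Complex 0 (- real (Suc n)))) \<longlonglongrightarrow> 0"
          by (rule Lim_null_comparison[OF always_eventually[OF allI] tendsto_mult_right_zero[OF LIMSEQ_inverse_real_of_nat]])
      qed
      show "AE t in lborel. norm (G t / (of_real t - Complex 0 (- real (Suc n)))) \<le> norm (G t) / norm (of_real t - Complex 0 (-1))" for n
      proof (intro AE_I2)
        fix t
        have "norm (of_real t - Complex 0 (-1)) \<le> norm (of_real t - Complex 0 (- real (Suc n)))"
          by (simp add: cmod_def power_mono)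
        moreover have "norm (of_real t - Complex 0 (-1)) > 0"
          using of_real_neq_nonreal[of "Complex 0 (-1)" t] by simp
        ultimately show "norm (G t / (of_real t - Complex 0 (- real (Suc n)))) \<le> norm (G t) / norm (of_real t - Complex 0 (-1))"
          unfolding norm_divide by (intro frac_le) auto
      qed
    qed measurable
    moreover have "(LINT t|lborel. G t / (of_real t - Complex 0 (- real (Suc n)))) = k" for n
    proof -
      have "L (Complex 0 (real (Suc n))) = k" by (rule k) (simp add: upper_half_plane_def)
      then show ?thesis by (simp add: L_def K_def cauchy_transform_def complex_cnj)
    qed
    ultimately have "(\<lambda>n::nat. k) \<longlonglongrightarrow> 0" by simp
    then show ?thesis by (simp add: LIMSEQ_const_iff)
  qed
  have QF: "conj_poisson G z = - \<i> * F z" if "Im z > 0" for z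
  proof -
    have "L z = 0" using k[of z] \<open>k = 0\<close> that by (simp add: upper_half_plane_def)
    then have "K z = 2 * pi * \<i> * F z" and Lz: "K (cnj z) = 0" using LF[OF that] by (auto simp: L_def)
    then have "conj_poisson G z = - (2 * pi * \<i> * F z) / (2 * pi)"
      using integrable_poisson_kernel_mult(4)[OF tame, of z] that by (simp add: K_def)
    then show ?thesis by simp
  qed
  define g where "g = (\<lambda>x. complex_of_real (Re (c * G x)))"
  have mg: "g \<in> borel_measurable borel" unfolding g_def using G(1) by measurable
  have fing: "mass p g < \<infinity>"
  proof -
    obtain m where m: "m \<ge> 0" "mass p G = ennreal m" using finG by (cases "mass p G") auto
    have "mass p g \<le> mass p (\<lambda>x. c * G x)"
      using p by (intro mass_mono) (auto simp: g_def intro: abs_Re_le_cmod simp del: times_complex.sel)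
    also have "\<dots> = ennreal (norm c powr p) * mass p G"
      unfolding mass_def using G(1)
      by (subst nn_integral_cmult[symmetric]) (auto simp: norm_mult powr_mult ennreal_mult)
    also have "\<dots> < \<infinity>" using finG by (simp add: ennreal_mult_less_top)
    finally show ?thesis .
  qed
  obtain h where h: "h \<in> borel_measurable borel"
    "mass p h \<le> ennreal (cot (pi / (2 * max p (p / (p - 1)))) powr p) * mass p g"
    "AE x in lborel. (hilbert_trunc g x \<longlongrightarrow> h x) (at_right 0)"
    "AE x in lborel. hilbert g x = h x" "\<forall>z. Im z > 0 \<longrightarrow> conj_poisson g z = poisson h z"
    by (rule hilbert_boundary_values[OF p refl mg fing])
  have th: "tame h"
    using fing by (intro mass_finite_tame[OF p h(1)] le_less_trans[OF h(2)]) (auto simp: ennreal_mult_less_top)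
  have gg: "hilbert g = hilbert (\<lambda>x. of_real (Re (c * F (of_real x))))"
    by (rule hilbert_cong_AE) (use GF in \<open>eventually_elim, simp add: g_def\<close>)
  show ?thesis
    unfolding gg[symmetric] using h(4) poisson_point_AE[OF th]
  proof eventually_elim
    case (elim x)
    have "((\<lambda>y. of_real (Re (- \<i> * (c * F (Complex x y)))) :: complex) \<longlongrightarrow> h x) (at_right 0)"
    proof (rule Lim_transform_eventually[OF poisson_tendsto_boundary[OF th elim(2)]])
      have "poisson h (Complex x y) = of_real (Re (- \<i> * (c * F (Complex x y))))" if y: "y > 0" for y
      proof -
        have "poisson h (Complex x y) = conj_poisson g (Complex x y)" using h(5) y by simp
        also have "\<dots> = of_real (Re (c * conj_poisson G (Complex x y)))"
          unfolding g_def by (rule conj_poisson_Re_cmult[OF tame y])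
        also have "conj_poisson G (Complex x y) = - \<i> * F (Complex x y)" using y by (intro QF) simp
        also have "c * (- \<i> * F (Complex x y)) = - \<i> * (c * F (Complex x y))" by simp
        finally show ?thesis .
      qed
      then show "\<forall>\<^sub>F y in at_right 0. poisson h (Complex x y) = of_real (Re (- \<i> * (c * F (Complex x y))))"
        by (auto simp: eventually_at_filter simp del: times_complex.sel)
    qed
    moreover have "((\<lambda>y. of_real (Re (- \<i> * (c * F (Complex x y)))) :: complex) \<longlongrightarrow> of_real (Re (- \<i> * (c * F (of_real x))))) (at_right 0)"
      by (intro tendsto_of_real tendsto_Re tendsto_mult tendsto_const limF)
    ultimately have "h x = of_real (Re (- \<i> * (c * F (of_real x))))" by (intro tendsto_unique[of "at_right 0"]) auto
    then show ?case using elim(1) by simp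
  qed
qed

text \<open>
  On the real line the argument is \<open>b arctan x\<close> and the modulus is comparable with
  \<open>(1 + \<bar>x\<bar>) powr (- b)\<close>, so that the \<open>p\<close>-th power is
  integrable for \<open>b p > 1\<close>.
\<close>

definition power_example :: "real \<Rightarrow> complex \<Rightarrow> complex" where
  "power_example b z = (1 - \<i> * z) powr of_real (- b)"

lemma Im_powr_polar:
  fixes w :: complex
  assumes "w \<noteq> 0"
  shows "Im (w powr of_real p) = norm w powr p * sin (p * Im (Ln w))"
  using assms by (simp add: powr_def Im_exp)

lemma power_example_boundary:
  shows "Re (power_example b (of_real x)) = norm (1 - \<i> * of_real x) powr (- b) * cos (b * arctan x)"
    and "Im (power_example b (of_real x)) = norm (1 - \<i> * of_real x) powr (- b) * sin (b * arctan x)"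
proof -
  have nz: "1 - \<i> * of_real x \<noteq> 0" by (simp add: complex_eq_iff)
  have "Im (Ln (1 - \<i> * of_real x)) = - arctan x"
    using nz by (subst Im_Ln_eq) (auto simp: arctan_minus)
  then show "Re (power_example b (of_real x)) = norm (1 - \<i> * of_real x) powr (- b) * cos (b * arctan x)"
    "Im (power_example b (of_real x)) = norm (1 - \<i> * of_real x) powr (- b) * sin (b * arctan x)"
    unfolding power_example_def Re_powr_polar[OF nz] Im_powr_polar[OF nz] by simp_all
qed

lemma power_example_norm_bounds:
  fixes x :: real
  shows "(1 + \<bar>x\<bar>) / 2 \<le> norm (1 - \<i> * of_real x)" "norm (1 - \<i> * of_real x) \<le> 1 + \<bar>x\<bar>" "1 \<le> norm (1 - \<i> * of_real x)"
proof -
  show 1: "1 \<le> norm (1 - \<i> * of_real x)" using abs_Re_le_cmod[of "1 - \<i> * of_real x"] by simp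
  have "\<bar>x\<bar> \<le> norm (1 - \<i> * of_real x)" using abs_Im_le_cmod[of "1 - \<i> * of_real x"] by simp
  with 1 show "(1 + \<bar>x\<bar>) / 2 \<le> norm (1 - \<i> * of_real x)" by (simp add: field_simps)
  show "norm (1 - \<i> * of_real x) \<le> 1 + \<bar>x\<bar>"
    using norm_triangle_ineq4[of 1 "\<i> * of_real x"] by (simp add: norm_mult)
qed

lemma power_example_integrable:
  assumes b: "b * p > 1" and p: "p > 0"
  shows "integrable lborel (\<lambda>x. norm (power_example b (of_real x)) powr p)"
    and "(\<lambda>x. power_example b (of_real x)) \<in> borel_measurable borel"
proof -
  have b0: "b > 0" using b p by (metis zero_less_mult_pos2 less_trans zero_less_one)
  have "continuous_on UNIV (\<lambda>x. power_example b (of_real x))"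
    unfolding power_example_def
  proof (intro continuous_on_powr_complex)
    show "UNIV \<subseteq> {x. 0 \<le> Re (1 - \<i> * complex_of_real x) \<or> Im (1 - \<i> * complex_of_real x) \<noteq> 0}" by auto
    show "0 < Re (complex_of_real (- b))" if "1 - \<i> * complex_of_real x = 0" for x
      using that by (simp add: complex_eq_iff)
  qed (intro continuous_intros)+
  then show m [measurable]: "(\<lambda>x. power_example b (of_real x)) \<in> borel_measurable borel"
    by (rule borel_measurable_continuous_onI)
  show "integrable lborel (\<lambda>x. norm (power_example b (of_real x)) powr p)"
  proof (rule Bochner_Integration.integrable_bound[OF integrable_mult_right[OF integrable_powr_tail[OF b]]])
    have "norm (power_example b (of_real x)) powr p \<le> 2 powr (b * p) * (1 + \<bar>x\<bar>) powr - (b * p)" for x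
    proof -
      have n: "norm (power_example b (of_real x)) = norm (1 - \<i> * of_real x) powr (- b)"
        unfolding power_example_def by (subst norm_powr_real_powr') auto
      have "norm (power_example b (of_real x)) powr p = norm (1 - \<i> * of_real x) powr - (b * p)"
        unfolding n by (simp add: powr_powr)
      also have "\<dots> \<le> ((1 + \<bar>x\<bar>) / 2) powr - (b * p)"
        using power_example_norm_bounds(1)[of x] b by (intro powr_mono2') auto
      also have "\<dots> = (1 + \<bar>x\<bar>) powr - (b * p) / 2 powr - (b * p)" by (rule powr_divide)
      also have "\<dots> = 2 powr (b * p) * (1 + \<bar>x\<bar>) powr - (b * p)" by (simp add: powr_minus divide_inverse)
      finally show ?thesis .
    qed
    then show "AE x in lborel. norm (norm (power_example b (of_real x)) powr p) \<le> norm (2 powr (b * p) * (1 + \<bar>x\<bar>) powr - (b * p))"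
      by (intro AE_I2) (simp add: abs_mult)
  qed measurable
qed

lemma power_example_hilbert:
  assumes b: "b * p > 1" and p: "p > 1"
  shows "AE x in lborel. hilbert (\<lambda>x. of_real (Re (power_example b (of_real x)))) x = of_real (Im (power_example b (of_real x)))"
    and "AE x in lborel. hilbert (\<lambda>x. of_real (Im (power_example b (of_real x)))) x = of_real (- Re (power_example b (of_real x)))"
proof -
  have b0: "b > 0" using b p by (metis zero_less_mult_pos2 less_trans zero_less_one)
  have pos: "Re (1 - \<i> * z) > 0" if "Im z \<ge> 0" for z using that by simp
  have hol: "power_example b holomorphic_on upper_half_plane"
    unfolding power_example_def[abs_def]
  proof (intro holomorphic_intros)
    fix z assume "z \<in> upper_half_plane"
    then have "Re (1 - \<i> * z) > 0" by (intro pos) (simp add: upper_half_plane_def)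
    then show "1 - \<i> * z \<notin> \<real>\<^sub>\<le>\<^sub>0" by (auto simp: complex_nonpos_Reals_iff)
  qed
  have cont: "continuous_on {z. Im z \<ge> 0} (power_example b)"
    unfolding power_example_def[abs_def]
  proof (intro continuous_on_powr_complex)
    show "{z. 0 \<le> Im z} \<subseteq> {z. 0 \<le> Re (1 - \<i> * z) \<or> Im (1 - \<i> * z) \<noteq> 0}" by auto
    show "0 < Re (complex_of_real (- b))" if "z \<in> {z. 0 \<le> Im z}" "1 - \<i> * z = 0" for z
      using that pos[of z] by auto
  qed (intro continuous_intros)+
  define M where "M = (LINT x|lborel. norm (power_example b (of_real x)) powr p)"
  have M: "M \<ge> 0" unfolding M_def by (intro integral_nonneg_AE) auto
  have mass0: "mass p (\<lambda>x. power_example b (of_real x)) = ennreal M"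
    unfolding M_def using power_example_integrable(1)[OF b] p by (intro mass_integral) auto
  have mass: "mass p (\<lambda>x. power_example b (Complex x y)) \<le> ennreal M" if y: "y > 0" for y
    unfolding mass0[symmetric]
  proof (rule mass_mono)
    fix x
    have n: "norm (power_example b z) = norm (1 - \<i> * z) powr (- b)" for z
      unfolding power_example_def by (subst norm_powr_real_powr') auto
    have "norm (1 - \<i> * of_real x) \<le> norm (1 - \<i> * Complex x y)"
      using y by (auto simp: cmod_def intro!: real_sqrt_le_mono)
    then show "norm (power_example b (Complex x y)) \<le> norm (power_example b (of_real x))"
      unfolding n using b0 power_example_norm_bounds(3)[of x] by (intro powr_mono2') auto
  qed (use p in auto)
  show "AE x in lborel. hilbert (\<lambda>x. of_real (Re (power_example b (of_real x)))) x = of_real (Im (power_example b (of_real x)))"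
    using hardy_boundary[OF p hol cont M mass, of 1] by simp
  show "AE x in lborel. hilbert (\<lambda>x. of_real (Im (power_example b (of_real x)))) x = of_real (- Re (power_example b (of_real x)))"
    using hardy_boundary[OF p hol cont M mass, of "- \<i>"] by simp
qed

lemma AE_lborel_not_False: "\<not> (AE x in (lborel :: real measure). False)"
  by (simp add: eventually_False ae_filter_eq_bot_iff)

text \<open>
  The modulus of the argument never exceeds \<open>b pi / 2\<close>, so in absolute value the
  real part is everywhere at least \<open>cot (b pi / 2)\<close> times the imaginary part.
\<close>

lemma sharp_cot:
  assumes p: "p > 1" and b: "1 / p < b" "b < 1"
  defines "g \<equiv> \<lambda>x. complex_of_real (Im (power_example b (of_real x)))"
  shows "g \<in> borel_measurable borel" "0 < mass p g" "mass p g < \<infinity>"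
    "ennreal (cot (b * pi / 2) powr p) * mass p g \<le> mass p (hilbert g)"
proof -
  have bp: "b * p > 1" using b(1) p by (simp add: field_simps)
  have b0: "b > 0" using b(1) p by (intro less_trans[OF _ b(1)]) auto
  have p0: "p > 0" using p by simp
  note [measurable] = power_example_integrable(2)[OF bp p0]
  show mg [measurable]: "g \<in> borel_measurable borel" unfolding g_def using p by measurable
  have "mass p g \<le> mass p (\<lambda>x. power_example b (of_real x))"
    using p by (intro mass_mono) (auto simp: g_def abs_Im_le_cmod)
  also have "\<dots> < \<infinity>"
    using mass_integral[OF power_example_integrable(1)[OF bp]] p by simp
  finally show "mass p g < \<infinity>" .
  have th: "\<bar>arctan x\<bar> < pi / 2" for x using arctan_bounded[of x] by auto
  have rpos: "norm (1 - \<i> * of_real x) powr (- b) > 0" for x using power_example_norm_bounds(3)[of x] by simp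
  show "0 < mass p g"
  proof (rule ccontr)
    assume "\<not> 0 < mass p g"
    then have "mass p g = 0" by simp
    then have "AE x in lborel. ennreal (norm (g x) powr p) = 0"
      unfolding mass_def by (subst (asm) nn_integral_0_iff_AE) auto
    moreover have "AE x in lborel. x \<noteq> (0 :: real)" by (rule AE_lborel_singleton)
    ultimately have "AE x in (lborel :: real measure). False"
    proof eventually_elim
      case (elim x)
      then have "sin (b * arctan x) = 0"
        using rpos[of x] by (auto simp: g_def power_example_boundary)
      moreover have "\<bar>b * arctan x\<bar> < pi"
      proof -
        have "\<bar>b * arctan x\<bar> \<le> 1 * \<bar>arctan x\<bar>" unfolding abs_mult using b b0 by (intro mult_right_mono) auto
        then show ?thesis using th[of x] pi_gt_zero by linarith
      qed
      ultimately have "b * arctan x = 0" using sin_eq_0_pi[of "b * arctan x"] by (auto simp: abs_less_iff)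
      then show ?case using b0 elim by simp
    qed
    then show False using AE_lborel_not_False by simp
  qed
  have sb: "sin (b * pi / 2) > 0" using b0 b by (intro sin_gt_zero) auto
  have cb: "cos (b * pi / 2) > 0" using b0 b by (intro cos_gt_zero) auto
  have pt: "cot (b * pi / 2) * norm (g x) \<le> \<bar>Re (power_example b (of_real x))\<bar>" for x
  proof -
    define t where "t = b * \<bar>arctan x\<bar>"
    have t: "0 \<le> t" "t \<le> b * pi / 2" using th[of x] b0 by (auto simp: t_def)
    have "b * pi / 2 \<le> pi" using b by simp
    then have "sin (b * pi / 2 - t) \<ge> 0" using t by (intro sin_ge_zero; linarith)
    then have "cos (b * pi / 2) * sin t \<le> sin (b * pi / 2) * cos t" by (simp add: sin_diff)
    then have c: "cot (b * pi / 2) * sin t \<le> cos t" using sb by (simp add: cot_def field_simps)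
    have st: "sin t \<ge> 0" using t \<open>b * pi / 2 \<le> pi\<close> by (intro sin_ge_zero; linarith)
    have "\<bar>sin (b * arctan x)\<bar> = sin t" "cos (b * arctan x) = cos t"
      using st by (auto simp: t_def abs_if)
    moreover have "cot (b * pi / 2) \<ge> 0" using sb cb by (simp add: cot_def)
    then have "cot (b * pi / 2) * sin t \<ge> 0" using st by simp
    then have "\<bar>cos t\<bar> = cos t" using c by simp
    moreover have "norm (g x) = norm (1 - \<i> * of_real x) powr (- b) * \<bar>sin (b * arctan x)\<bar>"
      and "\<bar>Re (power_example b (of_real x))\<bar> = norm (1 - \<i> * of_real x) powr (- b) * \<bar>cos (b * arctan x)\<bar>"
      unfolding g_def norm_of_real power_example_boundary abs_mult using rpos[of x] by simp_all
    ultimately show ?thesis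
      using mult_left_mono[OF c less_imp_le[OF rpos[of x]]] by (simp only: mult.left_commute)
  qed
  have "ennreal (cot (b * pi / 2) powr p) * mass p g = (\<integral>\<^sup>+x. ennreal (cot (b * pi / 2) powr p) * ennreal (norm (g x) powr p) \<partial>lborel)"
    unfolding mass_def by (rule nn_integral_cmult[symmetric]) measurable
  also have "\<dots> \<le> mass p (\<lambda>x. of_real (- Re (power_example b (of_real x))))"
    unfolding mass_def
  proof (rule nn_integral_mono)
    fix x
    have "cot (b * pi / 2) \<ge> 0" using sb cb by (simp add: cot_def)
    then have "(cot (b * pi / 2) * norm (g x)) powr p \<le> \<bar>Re (power_example b (of_real x))\<bar> powr p"
      using pt[of x] p by (intro powr_mono2) auto
    then show "ennreal (cot (b * pi / 2) powr p) * ennreal (norm (g x) powr p) \<le> ennreal (norm (complex_of_real (- Re (power_example b (of_real x)))) powr p)"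
      by (simp add: powr_mult ennreal_leI flip: ennreal_mult')
  qed
  also have "\<dots> = mass p (hilbert g)"
    unfolding g_def by (rule mass_cong_AE) (use power_example_hilbert(2)[OF bp p] in eventually_elim, simp)
  finally show "ennreal (cot (b * pi / 2) powr p) * mass p g \<le> mass p (hilbert g)" .
qed

text \<open>
  Outside \<open>[-X, X]\<close>, with \<open>X = tan a\<close>, the imaginary part is in
  absolute value at least \<open>T = tan (a / p) > c\<close> times the real part. Inside, the
  real part contributes at most \<open>2 X\<close> to its mass \<open>U\<close>, while
  \<open>U\<close> exceeds a fixed multiple of \<open>1 / (b p - 1)\<close>, which is as large
  as desired when \<open>b\<close> is close to \<open>1 / p\<close>.
\<close>

lemma sharp_tan:
  assumes p: "p > 1" and c: "0 \<le> c" "c < tan (pi / (2 * p))"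
  shows "\<exists>g. g \<in> borel_measurable borel \<and> 0 < mass p g \<and> mass p g < \<infinity> \<and> ennreal (c powr p) * mass p g \<le> mass p (hilbert g)"
proof -
  have "\<exists>a. 0 < a \<and> a < pi / 2 \<and> c < tan (a / p)"
  proof -
    have "isCont (\<lambda>a. tan (a / p)) (pi / 2)"
    proof -
      have "cos (pi / 2 / p) > 0" using p by (intro cos_gt_zero) (auto simp: field_simps)
      then show ?thesis using p by (intro continuous_intros) auto
    qed
    then have "((\<lambda>a. tan (a / p)) \<longlongrightarrow> tan (pi / 2 / p)) (at_left (pi / 2))"
      unfolding isCont_def by (rule filterlim_mono) (auto simp: at_le)
    then have "\<forall>\<^sub>F a in at_left (pi / 2). c < tan (a / p)"
      by (rule order_tendstoD(1)) (use c in simp)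
    moreover have "\<forall>\<^sub>F a in at_left (pi / 2). a \<in> {0<..<pi / 2}" by (rule eventually_at_left_real) simp
    ultimately have "\<forall>\<^sub>F a in at_left (pi / 2). 0 < a \<and> a < pi / 2 \<and> c < tan (a / p)" by eventually_elim auto
    then show ?thesis using eventually_happens[of _ "at_left (pi / 2)"] by auto
  qed
  then obtain a where a: "0 < a" "a < pi / 2" "c < tan (a / p)" by blast
  define T where "T = tan (a / p)"
  have T: "c < T" "T > 0" using a c by (auto simp: T_def)
  define X where "X = tan a"
  have X: "X > 0" unfolding X_def using a by (intro tan_gt_zero) auto
  define b0 where "b0 = (1 / p + 1) / 2"
  have b0: "1 / p < b0" "b0 < 1" using p by (auto simp: b0_def field_simps)
  \<comment> \<open>A lower bound for the cosine of the argument, uniform in \<open>b \<le> b0\<close>.\<close>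
  define k where "k = cos (b0 * (pi / 2))"
  have b00: "b0 > 0" using b0(1) p by (intro less_trans[OF _ b0(1)]) auto
  have k: "k > 0" unfolding k_def using b00 b0 by (intro cos_gt_zero) auto
  \<comment> \<open>For \<open>b p - 1 \<le> d\<close> the lower bound for \<open>U\<close> compensates the
    loss \<open>2 X T powr p\<close>.\<close>
  define d where "d = (k / 2) powr p * (T powr p - c powr p) / (2 * X * T powr p)"
  have Tc: "T powr p > c powr p" using T c p by (intro powr_less_mono2) auto
  have d: "d > 0" unfolding d_def using Tc k X T by (intro divide_pos_pos mult_pos_pos) auto
  define b where "b = 1 / p + min (b0 - 1 / p) (d / p)"
  have b: "1 / p < b" "b \<le> b0" "b < 1" using b0 d p by (auto simp: b_def)
  have bd: "b * p - 1 \<le> d"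
  proof -
    have "b \<le> 1 / p + d / p" by (simp add: b_def)
    then have "b * p \<le> (1 / p + d / p) * p" using p by (intro mult_right_mono) auto
    also have "\<dots> = 1 + d" using p by (simp add: field_simps)
    finally show ?thesis by simp
  qed
  have bp: "b * p > 1" using b(1) p by (simp add: field_simps)
  have bpos: "b > 0" using b(1) p by (intro less_trans[OF _ b(1)]) auto
  have p0: "p > 0" using p by simp
  note [measurable] = power_example_integrable(2)[OF bp p0]
  have iF: "integrable lborel (\<lambda>x. norm (power_example b (of_real x)) powr p)"
    using power_example_integrable(1)[OF bp] p by simp
  define u where "u = (\<lambda>x. Re (power_example b (complex_of_real x)))"
  define v where "v = (\<lambda>x. Im (power_example b (complex_of_real x)))"
  have m: "u \<in> borel_measurable borel" "v \<in> borel_measurable borel"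
    unfolding u_def v_def using p by measurable
  note [measurable] = m
  have iu: "integrable lborel (\<lambda>x. \<bar>u x\<bar> powr p)"
    by (rule Bochner_Integration.integrable_bound[OF iF])
       (use p in \<open>auto simp: u_def intro!: powr_mono2 abs_Re_le_cmod\<close>)
  have iv: "integrable lborel (\<lambda>x. \<bar>v x\<bar> powr p)"
    by (rule Bochner_Integration.integrable_bound[OF iF])
       (use p in \<open>auto simp: v_def intro!: powr_mono2 abs_Im_le_cmod\<close>)
  define U where "U = (LINT x|lborel. \<bar>u x\<bar> powr p)"
  define V where "V = (LINT x|lborel. \<bar>v x\<bar> powr p)"
  define r where "r = (\<lambda>x. norm (1 - \<i> * complex_of_real x) powr (- b))"
  have r0: "r x > 0" for x unfolding r_def using power_example_norm_bounds(3)[of x] by simp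
  have uv: "u x = r x * cos (b * arctan x)" "v x = r x * sin (b * arctan x)" for x
    by (simp_all add: u_def v_def r_def power_example_boundary)
  have th: "\<bar>arctan x\<bar> < pi / 2" for x using arctan_bounded[of x] by auto
  have bt: "b * \<bar>arctan x\<bar> \<le> b0 * (pi / 2)" for x
    using th[of x] b b00 bpos by (intro mult_mono) auto
  have ct: "cos (b * arctan x) \<ge> k" for x
  proof -
    have "b0 * (pi / 2) \<le> pi" using b0 by simp
    then have "cos (b0 * (pi / 2)) \<le> cos (b * \<bar>arctan x\<bar>)"
      using bt[of x] bpos by (intro cos_monotone_0_pi_le) auto
    moreover have "cos (b * \<bar>arctan x\<bar>) = cos (b * arctan x)" by (simp add: abs_if)
    ultimately show ?thesis by (simp add: k_def)
  qed
  have r1: "r x \<le> 1" for x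
  proof -
    have "r x \<le> 1 powr (- b)" unfolding r_def
      using power_example_norm_bounds(3)[of x] bpos by (intro powr_mono2') auto
    then show ?thesis by simp
  qed
  have u1: "\<bar>u x\<bar> \<le> 1" for x
  proof -
    have "\<bar>u x\<bar> \<le> 1 * 1" unfolding uv abs_mult using r0[of x] r1[of x] by (intro mult_mono) auto
    then show ?thesis by simp
  qed
  have Ulow: "(k / 2) powr p / (b * p - 1) \<le> U"
  proof -
    have "((\<lambda>x. x powr (- (b * p))) has_integral - (1 powr (- (b * p) + 1)) / (- (b * p) + 1)) {1..}"
      by (rule has_integral_powr_to_inf) (use bp in auto)
    then have hi: "((\<lambda>x. x powr (- (b * p))) has_integral 1 / (b * p - 1)) {1..}"
    proof -
      have "- (1 powr (- (b * p) + 1)) / (- (b * p) + 1) = 1 / (b * p - 1)"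
        using bp by (simp add: minus_divide_left[symmetric] divide_simps)
      then show ?thesis using \<open>((\<lambda>x. x powr (- (b * p))) has_integral - (1 powr (- (b * p) + 1)) / (- (b * p) + 1)) {1..}\<close> by simp
    qed
    then have "(\<lambda>x. x powr (- (b * p))) absolutely_integrable_on {1..}"
      by (intro nonnegative_absolutely_integrable_1) (auto simp: integrable_on_def)
    then have si: "set_integrable lborel {1..} (\<lambda>x. x powr (- (b * p)))"
      unfolding set_integrable_def by (subst (asm) integrable_completion) auto
    have val: "(LINT x|lborel. indicator {1..} x *\<^sub>R x powr (- (b * p))) = 1 / (b * p - 1)"
      using set_borel_integral_eq_integral(2)[OF si] hi by (simp add: set_lebesgue_integral_def integral_unique)
    have "(k / 2) powr p * (1 / (b * p - 1)) = (LINT x|lborel. (k / 2) powr p * (indicator {1..} x *\<^sub>R x powr (- (b * p))))"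
      unfolding val[symmetric] by (rule integral_mult_right_zero[symmetric])
    also have "\<dots> \<le> U"
      unfolding U_def
    proof (rule integral_mono[OF _ iu])
      show "integrable lborel (\<lambda>x. (k / 2) powr p * (indicator {1..} x *\<^sub>R x powr (- (b * p))))"
        using si unfolding set_integrable_def by (rule integrable_mult_right)
      fix x :: real
      show "(k / 2) powr p * (indicator {1..} x *\<^sub>R x powr (- (b * p))) \<le> \<bar>u x\<bar> powr p"
      proof (cases "x \<ge> 1")
        case True
        have "(2 * x) powr (- b) \<le> r x" unfolding r_def
          using power_example_norm_bounds(2,3)[of x] True bpos by (intro powr_mono2') auto
        then have "(2 * x) powr (- b) * k \<le> r x * cos (b * arctan x)"
          using ct[of x] k r0[of x] by (intro mult_mono) auto
        moreover have "x powr (- b) / 2 \<le> (2 * x) powr (- b)"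
        proof -
          have "(2 * x) powr (- b) = 2 powr (- b) * x powr (- b)" by (rule powr_mult)
          moreover have "2 powr (- 1) \<le> (2::real) powr (- b)" using b by (intro powr_mono) auto
          then have "1 / 2 * x powr (- b) \<le> 2 powr (- b) * x powr (- b)"
            by (intro mult_right_mono) (auto simp: powr_minus)
          ultimately show ?thesis by simp
        qed
        then have "x powr (- b) / 2 * k \<le> (2 * x) powr (- b) * k" using k by (intro mult_right_mono) auto
        ultimately have "k / 2 * x powr (- b) \<le> \<bar>u x\<bar>" unfolding uv by (simp add: mult.commute)
        then have "(k / 2 * x powr (- b)) powr p \<le> \<bar>u x\<bar> powr p" using k p by (intro powr_mono2) auto
        moreover have "(k / 2 * x powr (- b)) powr p = (k / 2) powr p * x powr (- (b * p))"
          by (simp only: powr_mult powr_powr mult_minus_left)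
        moreover have "indicator {1..} x *\<^sub>R x powr (- (b * p)) = x powr (- (b * p))" using True by simp
        ultimately show ?thesis by (simp only:)
      qed auto
    qed
    finally show ?thesis by simp
  qed
  have bp1: "b * p - 1 > 0" using bp by simp
  have Upos: "U > 0"
    using Ulow k bp1 by (intro less_le_trans[OF _ Ulow]) auto
  have UV: "T powr p * (U - 2 * X) \<le> V"
  proof -
    have pt: "T powr p * (\<bar>u x\<bar> powr p - indicator {-X..X} x) \<le> \<bar>v x\<bar> powr p" for x
    proof (cases "\<bar>x\<bar> \<le> X")
      case True
      have "\<bar>u x\<bar> powr p \<le> 1 powr p" using u1[of x] p by (intro powr_mono2) auto
      then have "T powr p * (\<bar>u x\<bar> powr p - indicator {-X..X} x) \<le> 0"
        using True by (intro mult_nonneg_nonpos) (auto simp: abs_le_iff)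
      then show ?thesis by (rule order_trans) simp
    next
      case False
      define t where "t = b * \<bar>arctan x\<bar>"
      have "arctan X \<le> arctan \<bar>x\<bar>" using False by (simp add: arctan_le_iff)
      moreover have "arctan X = a" unfolding X_def using a by (intro arctan_tan) auto
      moreover have "arctan \<bar>x\<bar> = \<bar>arctan x\<bar>" by (simp add: abs_if arctan_minus)
      ultimately have "a \<le> \<bar>arctan x\<bar>" by simp
      then have "1 / p * a \<le> b * \<bar>arctan x\<bar>" using b a p bpos by (intro mult_mono) auto
      then have t1: "a / p \<le> t" by (simp add: t_def)
      have "b0 * (pi / 2) < 1 * (pi / 2)" using b0 by (intro mult_strict_right_mono) auto
      then have t2: "t < pi / 2" unfolding t_def using bt[of x] by linarith
      have ap: "a / p > 0" using a p by simp
      have "T \<le> tan t" unfolding T_def using t1 t2 ap by (intro tan_mono_le) auto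
      moreover have ctp: "cos t > 0" using t1 t2 ap by (intro cos_gt_zero) auto
      ultimately have "T * cos t \<le> sin t" by (simp add: tan_def field_simps)
      moreover have st: "sin t \<ge> 0" using t1 t2 ap by (intro sin_ge_zero) auto
      moreover have "\<bar>sin (b * arctan x)\<bar> = \<bar>sin t\<bar>" "\<bar>cos (b * arctan x)\<bar> = \<bar>cos t\<bar>"
        by (cases "arctan x \<ge> 0"; simp add: t_def)+
      then have "\<bar>sin (b * arctan x)\<bar> = sin t" "\<bar>cos (b * arctan x)\<bar> = cos t"
        using st ctp by simp_all
      ultimately have "T * \<bar>u x\<bar> \<le> \<bar>v x\<bar>"
        unfolding uv abs_mult using mult_left_mono[of "T * cos t" "sin t" "r x"] r0[of x] by (simp add: mult_ac)
      then have "(T * \<bar>u x\<bar>) powr p \<le> \<bar>v x\<bar> powr p" using T p by (intro powr_mono2) auto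
      moreover have "indicator {-X..X} x = (0 :: real)" using False by (auto simp: indicator_def)
      ultimately show ?thesis by (simp add: powr_mult)
    qed
    have "T powr p * (U - 2 * X) = (LINT x|lborel. T powr p * (\<bar>u x\<bar> powr p - indicator {-X..X} x))"
      unfolding U_def using iu X by (simp add: Bochner_Integration.integral_diff)
    also have "\<dots> \<le> V" unfolding V_def
      using iu by (intro integral_mono iv pt integrable_mult_right Bochner_Integration.integrable_diff) auto
    finally show ?thesis .
  qed
  have "c powr p * U \<le> V"
  proof -
    have "(k / 2) powr p / d \<le> (k / 2) powr p / (b * p - 1)" using bd bp1 d by (intro divide_left_mono) auto
    also note Ulow
    finally have "(k / 2) powr p / d \<le> U" .
    then have "(k / 2) powr p \<le> U * d" using d by (simp add: pos_divide_le_eq)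
    then have "(k / 2) powr p * (2 * X * T powr p) \<le> U * d * (2 * X * T powr p)"
      using X by (intro mult_right_mono) auto
    also have "U * d * (2 * X * T powr p) = (k / 2) powr p * (U * (T powr p - c powr p))"
      unfolding d_def using X T by simp
    finally have "2 * X * T powr p \<le> U * (T powr p - c powr p)" using k by (subst (asm) mult_le_cancel_left_pos) auto
    then have "c powr p * U \<le> T powr p * (U - 2 * X)" by (simp add: algebra_simps)
    then show ?thesis using UV by simp
  qed
  then have le: "ennreal (c powr p) * ennreal U \<le> ennreal V" by (simp add: ennreal_leI flip: ennreal_mult')
  have mu: "mass p (\<lambda>x. of_real (u x)) = ennreal U"
    unfolding U_def using mass_integral[of "\<lambda>x. of_real (u x)" p] iu by simp
  have "mass p (\<lambda>x. of_real (v x)) = ennreal V"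
    unfolding V_def using mass_integral[of "\<lambda>x. of_real (v x)" p] iv by simp
  moreover have "mass p (hilbert (\<lambda>x. of_real (u x))) = mass p (\<lambda>x. of_real (v x))"
    by (rule mass_cong_AE) (use power_example_hilbert(1)[OF bp p] in \<open>simp add: u_def v_def\<close>)
  ultimately show ?thesis
    using mu le Upos by (intro exI[of _ "\<lambda>x. of_real (u x)"]) auto
qed

lemma sharp_example:
  assumes p: "p > 1" and pbar: "pbar = max p (p / (p - 1))" and c: "0 \<le> c" "c < cot (pi / (2 * pbar))"
  shows "\<exists>g. g \<in> borel_measurable borel \<and> 0 < mass p g \<and> mass p g < \<infinity> \<and> ennreal (c powr p) * mass p g \<le> mass p (hilbert g)"
proof (cases "p \<le> 2")
  case True
  then show ?thesis using sharp_tan[OF p c(1)] c(2) by (simp add: sharp_constant_eq(1)[OF p pbar])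
next
  case False
  then have pb: "pbar = p" by (intro sharp_constant_eq(2)[OF p pbar]) simp
  have "\<exists>b. 1 / p < b \<and> b < 1 \<and> c < cot (b * pi / 2)"
  proof -
    have "sin (1 / p * pi / 2) > 0" using p by (intro sin_gt_zero) (auto simp: field_simps)
    then have "isCont (\<lambda>b. cot (b * pi / 2)) (1 / p)" by (intro continuous_intros) auto
    then have "((\<lambda>b. cot (b * pi / 2)) \<longlongrightarrow> cot (1 / p * pi / 2)) (at_right (1 / p))"
      unfolding isCont_def by (rule filterlim_mono) (auto simp: at_le)
    then have "\<forall>\<^sub>F b in at_right (1 / p). c < cot (b * pi / 2)"
      by (rule order_tendstoD(1)) (use c pb in \<open>simp add: mult.commute\<close>)
    moreover have "\<forall>\<^sub>F b in at_right (1 / p). b \<in> {1 / p<..<1}" by (rule eventually_at_right_real) (use p in simp)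
    ultimately have "\<forall>\<^sub>F b in at_right (1 / p). 1 / p < b \<and> b < 1 \<and> c < cot (b * pi / 2)" by eventually_elim auto
    then show ?thesis using eventually_happens[of _ "at_right (1 / p)"] by auto
  qed
  then obtain b where b: "1 / p < b" "b < 1" "c < cot (b * pi / 2)" by blast
  note S = sharp_cot[OF p b(1,2)]
  have "ennreal (c powr p) * m \<le> ennreal (cot (b * pi / 2) powr p) * m" for m
    using b(3) c(1) p by (intro mult_right_mono ennreal_leI powr_mono2) auto
  from order_trans[OF this S(4)] S(1-3) show ?thesis by blast
qed

lemma hilbert_cmult_AE:
  assumes p: "p > 1" and g: "g \<in> borel_measurable borel" and fin: "mass p g < \<infinity>"
  shows "AE x in lborel. hilbert (\<lambda>x. c * g x) x = c * hilbert g x"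
proof -
  have trunc: "hilbert_trunc (\<lambda>x. c * g x) x e = c * hilbert_trunc g x e" for x e
  proof -
    have "indicator {e<..} t *\<^sub>R ((c * g (x + t) - c * g (x - t)) / of_real t)
        = c * (indicator {e<..} t *\<^sub>R ((g (x + t) - g (x - t)) / of_real t))" for t
      by (simp add: right_diff_distrib diff_divide_distrib scaleR_conv_of_real algebra_simps)
    then show ?thesis
      unfolding hilbert_trunc_def set_lebesgue_integral_def by (simp only: integral_mult_right_zero mult.left_commute)
  qed
  obtain h where h: "h \<in> borel_measurable borel"
    "mass p h \<le> ennreal (cot (pi / (2 * max p (p / (p - 1)))) powr p) * mass p g"
    "AE x in lborel. (hilbert_trunc g x \<longlongrightarrow> h x) (at_right 0)"
    "AE x in lborel. hilbert g x = h x" "\<forall>z. Im z > 0 \<longrightarrow> conj_poisson g z = poisson h z"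
    by (rule hilbert_boundary_values[OF p refl g fin])
  from h(3,4) show ?thesis
  proof eventually_elim
    case (elim x)
    have "((\<lambda>e. c * hilbert_trunc g x e) \<longlongrightarrow> c * h x) (at_right 0)" by (intro tendsto_intros elim)
    moreover have "hilbert_trunc (\<lambda>x. c * g x) x = (\<lambda>e. c * hilbert_trunc g x e)" by (rule ext) (rule trunc)
    ultimately have "(hilbert_trunc (\<lambda>x. c * g x) x \<longlongrightarrow> c * h x) (at_right 0)" by (simp only:)
    then have "hilbert (\<lambda>x. c * g x) x = c * h x" unfolding hilbert_def by (intro tendsto_Lim) auto
    then show ?case using elim by simp
  qed
qed

lemma mass_cmult:
  assumes [measurable]: "g \<in> borel_measurable borel"
  shows "mass p (\<lambda>x. c * g x) = ennreal (norm c powr p) * mass p g"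
  unfolding mass_def
  by (subst nn_integral_cmult[symmetric]) (auto simp: norm_mult powr_mult ennreal_mult)

lemma sharp_normalized:
  assumes p: "p > 1" and pbar: "pbar = max p (p / (p - 1))" and c: "0 \<le> c" "c < cot (pi / (2 * pbar))"
  obtains g where "g \<in> Lp p" "Lp_norm p g \<le> 1" "ennreal c \<le> Lp_norm p (hilbert g)"
proof -
  have p0: "p > 0" using p by simp
  obtain g where g: "g \<in> borel_measurable borel" "0 < mass p g" "mass p g < \<infinity>" "ennreal (c powr p) * mass p g \<le> mass p (hilbert g)"
    using sharp_example[OF p pbar c] by blast
  obtain m where m: "mass p g = ennreal m" "m > 0" using g(2,3) by (cases "mass p g") auto
  \<comment> \<open>Scaling by \<open>k\<close> normalises the \<open>p\<close>-norm of \<open>g\<close> to 1.\<close>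
  define k where "k = m powr (- (1 / p))"
  have k: "k > 0" using m by (simp add: k_def)
  have "k powr p = m powr (- (1 / p) * p)" unfolding k_def by (rule powr_powr)
  moreover have "- (1 / p) * p = - 1" using p by simp
  ultimately have kp: "k powr p = inverse m" using m by (simp add: powr_minus)
  let ?g = "\<lambda>x. of_real k * g x"
  have mk: "mass p ?g = 1"
    using m k by (simp add: mass_cmult[OF g(1)] kp flip: ennreal_mult')
  have mg: "?g \<in> borel_measurable borel" using g(1) by measurable
  have fin: "mass p ?g < \<infinity>" by (simp add: mk)
  obtain h where h: "h \<in> borel_measurable borel"
    "mass p h \<le> ennreal (cot (pi / (2 * max p (p / (p - 1)))) powr p) * mass p g"
    "AE x in lborel. (hilbert_trunc g x \<longlongrightarrow> h x) (at_right 0)"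
    "AE x in lborel. hilbert g x = h x" "\<forall>z. Im z > 0 \<longrightarrow> conj_poisson g z = poisson h z"
    by (rule hilbert_boundary_values[OF p refl g(1,3)])
  show ?thesis
  proof (rule that[of ?g])
    show "?g \<in> Lp p" by (rule LpI[OF mg fin])
    have "Lp_norm p ?g \<le> ennreal 1" by (subst Lp_norm_le_iff[OF p0]) (auto simp: mk)
    then show "Lp_norm p ?g \<le> 1" by simp
    have "mass p (hilbert ?g) = mass p (\<lambda>x. of_real k * h x)"
      by (rule mass_cong_AE) (use hilbert_cmult_AE[OF p g(1,3), of "of_real k"] h(4) in eventually_elim, simp)
    also have "\<dots> = ennreal (k powr p) * mass p h" using k by (simp add: mass_cmult[OF h(1)])
    also have "mass p h = mass p (hilbert g)" by (rule mass_cong_AE) (use h(4) in eventually_elim, simp)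
    finally have eq: "mass p (hilbert ?g) = ennreal (k powr p) * mass p (hilbert g)" .
    have "ennreal (c powr p) = ennreal (k powr p) * (ennreal (c powr p) * mass p g)"
      using m k by (simp add: kp flip: ennreal_mult') 
    also have "\<dots> \<le> mass p (hilbert ?g)" unfolding eq by (rule mult_left_mono[OF g(4)]) simp
    finally show "ennreal c \<le> Lp_norm p (hilbert ?g)" by (rule ennreal_le_Lp_norm[OF p0 c(1)])
  qed
qed

lemma ennreal_le_approx:
  fixes V :: ennreal
  assumes "C > 0" "\<And>c. 0 \<le> c \<Longrightarrow> c < C \<Longrightarrow> ennreal c \<le> V"
  shows "ennreal C \<le> V"
proof (rule ccontr)
  assume "\<not> ennreal C \<le> V"
  then have less: "V < ennreal C" by simp
  then obtain r where r: "r \<ge> 0" "V = ennreal r" by (cases V) auto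
  then have "r < C" using less by (simp add: ennreal_less_iff)
  then have "ennreal ((r + C) / 2) \<le> ennreal r" using assms(2)[of "(r + C) / 2"] r by simp
  then show False using \<open>r < C\<close> r by (simp add: ennreal_le_iff)
qed

theorem corollary2p8:
  fixes p pbar :: real
  assumes "p > 1" and "pbar = max p (p / (p - 1))"
  shows
    "(\<forall>g\<in>Lp p.
        (AE x in lebesgue. \<exists>l. (hilbert_trunc g x \<longlongrightarrow> l) (at_right 0)) \<and>
        hilbert g \<in> Lp p \<and>
        Lp_norm p (hilbert g) \<le> ennreal (cot (pi / (2 * pbar))) * Lp_norm p g) \<and>
     (\<forall>g\<in>Lp p.
        poisson g \<in> hp p \<and> poisson (hilbert g) \<in> hp p \<and>
        hp_norm p (poisson (hilbert g)) \<le> ennreal (cot (pi / (2 * pbar))) * hp_norm p (poisson g)) \<and>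
     operator_norm (Lp p) (Lp_norm p) hilbert = ennreal (cot (pi / (2 * pbar))) \<and>
     hp_hilbert p ` hp p \<subseteq> hp p \<and>
     operator_norm (hp p) (hp_norm p) (hp_hilbert p) = ennreal (cot (pi / (2 * pbar)))"
proof -
  note p = assms(1) and pbar = assms(2)
  define C where "C = cot (pi / (2 * pbar))"
  have C: "C > 0" unfolding C_def by (rule sharp_constant_pos[OF p pbar])
  have A: "AE x in lebesgue. \<exists>l. (hilbert_trunc g x \<longlongrightarrow> l) (at_right 0)"
    and B: "hilbert g \<in> Lp p" and N: "Lp_norm p (hilbert g) \<le> ennreal C * Lp_norm p g" if "g \<in> Lp p" for g
    using hilbert_Lp[OF p pbar that] by (simp_all add: C_def)
  have P: "poisson g \<in> hp p" "hp_norm p (poisson g) = Lp_norm p g" if "g \<in> Lp p" for g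
    using poisson_Lp[OF p that] by auto
  have one: "ennreal C * n \<le> ennreal C" if "n \<le> 1" for n
    using mult_left_mono[OF that, of "ennreal C"] by simp
  have O1: "operator_norm (Lp p) (Lp_norm p) hilbert = ennreal C"
  proof (rule antisym)
    show "operator_norm (Lp p) (Lp_norm p) hilbert \<le> ennreal C"
      unfolding operator_norm_def
      by (intro SUP_least) (auto intro: order_trans[OF N one])
    show "ennreal C \<le> operator_norm (Lp p) (Lp_norm p) hilbert"
    proof (rule ennreal_le_approx[OF C])
      fix c assume c: "0 \<le> c" "c < C"
      obtain g where g: "g \<in> Lp p" "Lp_norm p g \<le> 1" "ennreal c \<le> Lp_norm p (hilbert g)"
        using sharp_normalized[OF p pbar c(1) c(2)[unfolded C_def]] by blast
      have "Lp_norm p (hilbert g) \<le> operator_norm (Lp p) (Lp_norm p) hilbert"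
        unfolding operator_norm_def by (rule SUP_upper) (use g in simp)
      with g(3) show "ennreal c \<le> operator_norm (Lp p) (Lp_norm p) hilbert" by (rule order_trans)
    qed
  qed
  have Hsub: "hp_hilbert p ` hp p \<subseteq> hp p"
  proof
    fix F assume "F \<in> hp_hilbert p ` hp p"
    then obtain f where f: "f \<in> hp p" "F = hp_hilbert p f" by auto
    obtain g where "g \<in> Lp p" "hp_hilbert p f = poisson (hilbert g)"
      using hp_hilbert_eq[OF p f(1)] by metis
    then show "F \<in> hp p" using f(2) P(1) B by metis
  qed
  have O2: "operator_norm (hp p) (hp_norm p) (hp_hilbert p) = ennreal C"
  proof (rule antisym)
    show "operator_norm (hp p) (hp_norm p) (hp_hilbert p) \<le> ennreal C"
      unfolding operator_norm_def
    proof (rule SUP_least)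
      fix f assume "f \<in> {f \<in> hp p. hp_norm p f \<le> 1}"
      then have f: "f \<in> hp p" "hp_norm p f \<le> 1" by auto
      obtain g where g: "g \<in> Lp p" "hp_hilbert p f = poisson (hilbert g)" "hp_norm p f = Lp_norm p g"
        using hp_hilbert_eq[OF p f(1)] by metis
      have "hp_norm p (hp_hilbert p f) = Lp_norm p (hilbert g)" unfolding g(2) by (rule P(2)[OF B[OF g(1)]])
      also have "\<dots> \<le> ennreal C * Lp_norm p g" by (rule N[OF g(1)])
      also have "\<dots> \<le> ennreal C" using f(2) g(3) by (intro one) simp
      finally show "hp_norm p (hp_hilbert p f) \<le> ennreal C" .
    qed
    show "ennreal C \<le> operator_norm (hp p) (hp_norm p) (hp_hilbert p)"
    proof (rule ennreal_le_approx[OF C])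
      fix c assume c: "0 \<le> c" "c < C"
      obtain g where g: "g \<in> Lp p" "Lp_norm p g \<le> 1" "ennreal c \<le> Lp_norm p (hilbert g)"
        using sharp_normalized[OF p pbar c(1) c(2)[unfolded C_def]] by blast
      obtain g' where g': "g' \<in> Lp p" "\<And>z. z \<in> upper_half_plane \<Longrightarrow> poisson g z = poisson g' z"
        "hp_hilbert p (poisson g) = poisson (hilbert g')"
        using hp_hilbert_eq[OF p P(1)[OF g(1)]] by metis
      have "hilbert g = hilbert g'" by (rule hilbert_cong_AE[OF poisson_injective[OF p g(1) g'(1,2)]])
      then have "hp_norm p (hp_hilbert p (poisson g)) = Lp_norm p (hilbert g)"
        unfolding g'(3) using P(2)[OF B[OF g'(1)]] by simp
      moreover have "hp_norm p (hp_hilbert p (poisson g)) \<le> operator_norm (hp p) (hp_norm p) (hp_hilbert p)"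
        unfolding operator_norm_def by (rule SUP_upper) (use P[OF g(1)] g(2) in simp)
      ultimately show "ennreal c \<le> operator_norm (hp p) (hp_norm p) (hp_hilbert p)" using g(3) by simp
    qed
  qed
  show ?thesis
    unfolding C_def[symmetric] using A B N P O1 Hsub O2 by simp
qed

end
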